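(* Let $f\in C^1(\mathbb{R})$ and let $u\in C^1(\mathbb{R}^n)\cap H^1(\mathbb{R}^n,\mu)\cap L^\infty(\mathbb{R}^n)$ be a bounded weak solution to $$\Delta u-\langle x,\nabla u\rangle+f(u)=0\quad\text{in }\mathbb{R}^n$$ with Morse index $k$. Then: (i) if $k\leq 2$, then $u$ is one-dimensional, i.e. there exist $\omega\in\mathbb{S}^{n-1}$ and $u_0:\mathbb{R}\to\mathbb{R}$ such that $u(x)=u_0(\langle\omega,x\rangle)$ for all $x\in\mathbb{R}^n$; (ii) if $3\leq k\leq n$, then $u$ is a function of at most $k-1$ variables, i.e. there exist a real $(k-1)\times n$ matrix $C$ and $u_0:\mathbb{R}^{k-1}\to\mathbb{R}$ such that $u(x)=u_0(Cx)$ for all $x\in\mathbb{R}^n$.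
   Context: Notation: $d\mu=e^{-|x|^2/2}dx$, and $H^1(\mathbb{R}^n,\mu)$ is the Sobolev space of functions which, together with their first weak derivatives, belong to $L^2(\mathbb{R}^n,\mu)$. Weak solution: $\int_{\mathbb{R}^n}\langle\nabla u,\nabla\varphi\rangle-f(u)\varphi\,d\mu=0$ for all $\varphi\in C^1_c(\mathbb{R}^n)$. Morse index: a bounded weak solution $u$ has Morse index $k\in\mathbb{N}$ (with $k=0$ allowed) if $k$ is the maximal dimension of a linear subspace $X$ of $H^1(\mathbb{R}^n,\mu)$ such that $$Q_u(\varphi):=\int_{\mathbb{R}^n}|\nabla\varphi|^2-f'(u)\varphi^2\,d\mu<0\quad\forall\varphi\in X\setminus\{0\}.$$ *)

theory Defs
  imports "HOL-Analysis.Analysis" "HOL-Library.Function_Algebras"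
begin

text \<open>The pointwise real vector space structure on functions, so that the library notions
  \<^const>\<open>subspace\<close>, \<^const>\<open>span\<close> and \<^const>\<open>dim\<close> apply to spaces of functions.\<close>

instantiation "fun" :: (type, real_vector) real_vector
begin

definition scaleR_fun_def: "c *\<^sub>R g = (\<lambda>x. c *\<^sub>R g x)"

instance
  by standard (simp_all add: scaleR_fun_def fun_eq_iff scaleR_add_right scaleR_add_left)

end

definition gauss :: "'a::euclidean_space measure" where
  "gauss = density lborel (\<lambda>x. ennreal (exp (- (norm x)\<^sup>2 / 2)))"

definition grad :: "('a::euclidean_space \<Rightarrow> real) \<Rightarrow> 'a \<Rightarrow> 'a" where
  "grad u x = (THE D. GDERIV u x :> D)"

definition C1 :: "('a::euclidean_space \<Rightarrow> real) set" where
  "C1 = {u. u differentiable_on UNIV \<and> continuous_on UNIV (grad u)}"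

definition C1c :: "('a::euclidean_space \<Rightarrow> real) set" where
  "C1c = {\<phi> \<in> C1. compact (closure {x. \<phi> x \<noteq> 0})}"

definition locally_integrable :: "('a::euclidean_space \<Rightarrow> 'b::euclidean_space) \<Rightarrow> bool" where
  "locally_integrable g \<longleftrightarrow> (\<forall>K. compact K \<longrightarrow> set_integrable lborel K g)"

text \<open>The identity below is between vectors, so it contains the integration by parts formula for
  each partial derivative. It refers to Lebesgue measure: the weak derivatives are the usual
  distributional ones.\<close>

definition has_weak_gradient ::
    "('a::euclidean_space \<Rightarrow> real) \<Rightarrow> ('a \<Rightarrow> 'a) \<Rightarrow> bool" where
  "has_weak_gradient \<phi> G \<longleftrightarrow> locally_integrable \<phi> \<and> locally_integrable G \<and>
     (\<forall>\<psi>\<in>C1c. (LINT x|lborel. \<phi> x *\<^sub>R grad \<psi> x) = - (LINT x|lborel. \<psi> x *\<^sub>R G x))"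

text \<open>Weak gradients are unique up to null sets, hence integrals involving the chosen one do not
  depend on the choice.\<close>

definition weak_grad :: "('a::euclidean_space \<Rightarrow> real) \<Rightarrow> 'a \<Rightarrow> 'a" where
  "weak_grad \<phi> = (SOME G. has_weak_gradient \<phi> G)"

text \<open>Elements are Borel functions rather than classes modulo almost everywhere equality.\<close>

definition H1_gauss :: "('a::euclidean_space \<Rightarrow> real) set" where
  "H1_gauss = {\<phi> \<in> borel_measurable borel. integrable gauss (\<lambda>x. (\<phi> x)\<^sup>2) \<and>
     (\<exists>G. has_weak_gradient \<phi> G \<and> integrable gauss (\<lambda>x. (norm (G x))\<^sup>2))}"

definition weak_solution ::
    "(real \<Rightarrow> real) \<Rightarrow> ('a::euclidean_space \<Rightarrow> real) \<Rightarrow> bool" where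
  "weak_solution f u \<longleftrightarrow>
     (\<forall>\<phi>\<in>C1c. (LINT x|gauss. grad u x \<bullet> grad \<phi> x - f (u x) * \<phi> x) = 0)"

definition Q ::
    "(real \<Rightarrow> real) \<Rightarrow> ('a::euclidean_space \<Rightarrow> real) \<Rightarrow> ('a \<Rightarrow> real) \<Rightarrow> real" where
  "Q f u \<phi> = (LINT x|gauss. (norm (weak_grad \<phi> x))\<^sup>2 - deriv f (u x) * (\<phi> x)\<^sup>2)"

definition negative_subspace ::
    "(real \<Rightarrow> real) \<Rightarrow> ('a::euclidean_space \<Rightarrow> real) \<Rightarrow> ('a \<Rightarrow> real) set \<Rightarrow> bool" where
  "negative_subspace f u X \<longleftrightarrow>
     subspace X \<and> X \<subseteq> H1_gauss \<and> (\<forall>\<phi>\<in>X - {0}. Q f u \<phi> < 0)"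

text \<open>\<^const>\<open>dim\<close> is \<open>0\<close> on infinite-dimensional spaces, so finite dimension is required separately.\<close>

definition has_dimension :: "'b::real_vector set \<Rightarrow> nat \<Rightarrow> bool" where
  "has_dimension X d \<longleftrightarrow> (\<exists>B. finite B \<and> span B = X) \<and> dim X = d"

text \<open>A function that vanishes almost everywhere has \<open>Q f u \<phi> = 0\<close>. Hence a negative subspace
  contains no such function but \<open>0\<close>, and its dimension is that of the corresponding space of
  classes modulo almost everywhere equality. The second conjunct also excludes
  infinite-dimensional negative subspaces.\<close>

definition morse_index ::
    "(real \<Rightarrow> real) \<Rightarrow> ('a::euclidean_space \<Rightarrow> real) \<Rightarrow> nat \<Rightarrow> bool" where
  "morse_index f u k \<longleftrightarrow>
     (\<exists>X. negative_subspace f u X \<and> has_dimension X k) \<and>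
     (\<forall>X. negative_subspace f u X \<longrightarrow> (\<exists>d\<le>k. has_dimension X d))"

text \<open>The product of an \<open>m \<times> n\<close> matrix with a vector, where \<open>m\<close> need not be the cardinality of a
  type. \<open>\<real>\<^sup>m\<close> is represented by \<open>{..<m} \<rightarrow>\<^sub>E UNIV\<close>, and the entries \<open>C i j\<close> with \<open>i \<ge> m\<close> are
  ignored.\<close>

definition matrix_app :: "nat \<Rightarrow> (nat \<Rightarrow> 'n::finite \<Rightarrow> real) \<Rightarrow> real^'n \<Rightarrow> (nat \<Rightarrow> real)" where
  "matrix_app m C x = (\<lambda>i\<in>{..<m}. \<Sum>j\<in>UNIV. C i j * x $ j)"

end

theory Submission
  imports Defs
begin

text \<open>Differentiating the equation in a direction \<open>e\<close> shows that \<open>v e = e \<bullet> \<nabla>u\<close> formally satisfies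
  \<open>L (v e) + f'(u) v e = v e\<close>, with \<open>L = \<Delta> - x \<bullet> \<nabla>\<close>, so that the quadratic form \<open>Q\<close> equals
  \<open>- \<parallel>v e\<parallel>\<^sup>2\<close> on the space of these functions, whose dimension is that of the span of the values of \<open>\<nabla>u\<close>.
  If \<open>- 1\<close> were the bottom of the spectrum of the linearized operator and this dimension were at least \<open>2\<close>,
  then some \<open>v e \<noteq> 0\<close> would vanish at a point; but \<open>\<bar>v e\<bar>\<close> would be a minimizer as well, hence a weak
  solution, contradicting the strong maximum principle. So either the dimension is at most \<open>1\<close>, or there
  is one more negative direction and the dimension is at most \<open>k - 1\<close>; and \<open>u\<close> depends only on the
  projection of \<open>x\<close> to the span.

  No second derivatives of \<open>u\<close> are used: \<open>v e\<close> is replaced by difference quotients of \<open>u\<close> multiplied by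
  cutoffs. They satisfy a translated weak equation exactly, their energies converge to \<open>- \<parallel>v e\<parallel>\<^sup>2\<close>, and
  being negative definite on a finite-dimensional space is an open condition.\<close>

section \<open>Continuously differentiable functions\<close>

text \<open>The value \<open>- 1\<close> comes from the commutator of
  \<open>e \<bullet> \<nabla>\<close> with the drift \<open>x \<bullet> \<nabla>\<close>, which is
  \<open>e \<bullet> \<nabla>\<close> again. Adding the squared norm to the form, that is, replacing
  the potential \<open>f'(u)\<close> by \<open>f'(u) - 1\<close>, makes each \<open>v e\<close>
  formally a null vector; a negative direction of the shifted form is then what raises the index
  above the dimension of the span. The obstacle is regularity. As \<open>u\<close> is only C1,
  \<open>v e\<close> is merely continuous, and the gradients of the difference quotients of
  \<open>u\<close> need not converge. So no limit is taken before every derivative of a quotient has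
  been removed, either by the equation of the quotient itself or by integration by parts onto the
  test function. For the absolute value the second way is taken, with radial tests
  \<open>\<psi>\<close> such that \<open>\<nabla>\<psi> = - \<theta> (x - y)\<close> and
  \<open>\<theta>\<close> is C1: then \<open>- L \<psi>\<close> is \<open>n \<theta> + (x - y)
  \<bullet> \<nabla>\<theta> - \<theta> x \<bullet> (x - y)\<close>, an expression free of Hessians.
  Hence the maximum principle is proved directly, from a radial barrier, for functions that are only
  continuous.\<close>

lemma GDERIV_unique:
  fixes u :: "'a::euclidean_space \<Rightarrow> real"
  assumes "GDERIV u x :> D" "GDERIV u x :> E"
  shows "D = E"
proof -
  have "(\<lambda>h. h \<bullet> D) = (\<lambda>h. h \<bullet> E)"
    using assms unfolding gderiv_def by (rule has_derivative_unique)
  then have "\<forall>h. h \<bullet> D = h \<bullet> E" by metis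
  then show ?thesis by (simp only: vector_eq_ldot)
qed

lemma grad_eqI: "GDERIV u x :> D \<Longrightarrow> grad u x = D"
  unfolding grad_def by (blast intro: GDERIV_unique)

lemma C1I:
  assumes "\<And>x. GDERIV u x :> g x" "continuous_on UNIV g"
  shows "u \<in> C1"
proof -
  have "grad u = g" using assms(1) by (auto intro: grad_eqI)
  moreover have "u differentiable (at x)" for x
    using assms(1) unfolding gderiv_def differentiable_def by blast
  ultimately show ?thesis
    using assms(2) by (simp add: C1_def differentiable_on_def)
qed

text \<open>The values of the derivative on the basis are the coordinates of its representing
  vector, so the definite description in \<open>grad\<close> has a referent at every point.\<close>

lemma C1_GDERIV:
  assumes "u \<in> C1"
  shows "GDERIV u x :> grad u x"
proof -
  obtain d where d: "(u has_derivative d) (at x)"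
    using assms by (auto simp: C1_def differentiable_on_def differentiable_def)
  interpret bounded_linear d using d by (rule has_derivative_bounded_linear)
  have "d h = h \<bullet> (\<Sum>b\<in>Basis. d b *\<^sub>R b)" for h
        by (subst euclidean_representation[symmetric, of h])
       (simp add: sum scaleR inner_sum_right inner_commute mult.commute del: euclidean_representation)
  then have "d = (\<lambda>h. h \<bullet> (\<Sum>b\<in>Basis. d b *\<^sub>R b))" by blast
  then have "GDERIV u x :> (\<Sum>b\<in>Basis. d b *\<^sub>R b)"
    using d unfolding gderiv_def by metis
  then show ?thesis using grad_eqI by metis
qed

lemma C1_grad_continuous: "u \<in> C1 \<Longrightarrow> continuous_on UNIV (grad u)"
  by (simp add: C1_def)

lemma C1_continuous: "u \<in> C1 \<Longrightarrow> continuous_on UNIV u"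
  by (auto simp: C1_def intro: differentiable_imp_continuous_on)

lemma C1_continuous_on: "u \<in> C1 \<Longrightarrow> continuous_on A u"
  by (metis C1_continuous continuous_on_subset subset_UNIV)

lemma C1_grad_continuous_on [continuous_intros]: "u \<in> C1 \<Longrightarrow> continuous_on A (grad u)"
  by (metis C1_grad_continuous continuous_on_subset subset_UNIV)

lemma C1_measurable [measurable_dest]: "u \<in> C1 \<Longrightarrow> u \<in> borel_measurable borel"
  by (rule borel_measurable_continuous_onI) (rule C1_continuous)

lemma C1_grad_measurable [measurable_dest]: "u \<in> C1 \<Longrightarrow> grad u \<in> borel_measurable borel"
  by (rule borel_measurable_continuous_onI) (rule C1_grad_continuous)

lemma grad_const: "grad (\<lambda>x. c) x = 0"
  by (rule grad_eqI) (rule GDERIV_const)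

lemma C1_const [simp, intro]: "(\<lambda>x. c) \<in> C1"
  by (rule C1I[of _ "\<lambda>x. 0"]) (auto intro: GDERIV_const)

lemma grad_inner: "grad (\<lambda>x. x \<bullet> a) x = a"
  and C1_inner [simp, intro]: "(\<lambda>x. x \<bullet> a) \<in> C1"
proof -
  have "GDERIV (\<lambda>x. x \<bullet> a) x :> a" for x
    unfolding gderiv_def by (auto intro!: derivative_eq_intros)
  then show "grad (\<lambda>x. x \<bullet> a) x = a" "(\<lambda>x. x \<bullet> a) \<in> C1"
    by (auto intro: grad_eqI C1I[of _ "\<lambda>x. a"])
qed

lemma grad_add: "u \<in> C1 \<Longrightarrow> v \<in> C1 \<Longrightarrow> grad (\<lambda>x. u x + v x) x = grad u x + grad v x"
  by (intro grad_eqI GDERIV_add C1_GDERIV)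

lemma C1_add [intro]: "u \<in> C1 \<Longrightarrow> v \<in> C1 \<Longrightarrow> (\<lambda>x. u x + v x) \<in> C1"
  by (rule C1I[OF GDERIV_add[OF C1_GDERIV C1_GDERIV]]) (auto intro!: continuous_intros)

lemma grad_diff: "u \<in> C1 \<Longrightarrow> v \<in> C1 \<Longrightarrow> grad (\<lambda>x. u x - v x) x = grad u x - grad v x"
  by (intro grad_eqI GDERIV_diff C1_GDERIV)

lemma C1_diff [intro]: "u \<in> C1 \<Longrightarrow> v \<in> C1 \<Longrightarrow> (\<lambda>x. u x - v x) \<in> C1"
  by (rule C1I[OF GDERIV_diff[OF C1_GDERIV C1_GDERIV]]) (auto intro!: continuous_intros)

lemma grad_mult:
  "u \<in> C1 \<Longrightarrow> v \<in> C1 \<Longrightarrow> grad (\<lambda>x. u x * v x) x = u x *\<^sub>R grad v x + v x *\<^sub>R grad u x"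
  by (intro grad_eqI GDERIV_mult C1_GDERIV)

lemma C1_mult [intro]: "u \<in> C1 \<Longrightarrow> v \<in> C1 \<Longrightarrow> (\<lambda>x. u x * v x) \<in> C1"
  by (rule C1I[OF GDERIV_mult[OF C1_GDERIV C1_GDERIV]])
     (auto intro!: continuous_intros intro: C1_continuous_on)

lemma grad_cmult: "u \<in> C1 \<Longrightarrow> grad (\<lambda>x. c * u x) x = c *\<^sub>R grad u x"
  by (simp add: grad_mult grad_const)

lemma C1_prod:
  assumes "finite I" "\<And>i. i \<in> I \<Longrightarrow> u i \<in> C1"
  shows "(\<lambda>x. \<Prod>i\<in>I. u i x) \<in> C1"
  using assms by (induction I) auto

lemma grad_compose:
  "u \<in> C1 \<Longrightarrow> DERIV g (u x) :> g' \<Longrightarrow> grad (\<lambda>x. g (u x)) x = g' *\<^sub>R grad u x"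
  by (intro grad_eqI GDERIV_DERIV_compose C1_GDERIV)

text \<open>The hypotheses concern \<open>g\<close> only at values of \<open>u\<close>, which admits
  outer functions such as \<open>inverse\<close> or \<open>1 / t ^ N\<close> that are singular
  elsewhere.\<close>

lemma C1_compose:
  assumes "u \<in> C1" "\<And>x. DERIV g (u x) :> g' (u x)" "continuous_on (range u) g'"
  shows "(\<lambda>x. g (u x)) \<in> C1"
proof (rule C1I[OF GDERIV_DERIV_compose[OF C1_GDERIV[OF assms(1)] assms(2)]])
  show "continuous_on UNIV (\<lambda>x. g' (u x) *\<^sub>R grad u x)"
    using assms by (auto intro!: continuous_intros continuous_on_compose2[OF assms(3)] intro: C1_continuous_on)
qed

lemma GDERIV_shift:
  "GDERIV u (x + h) :> D \<Longrightarrow> GDERIV (\<lambda>x. u (x + h)) x :> D"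
  unfolding gderiv_def
  by (rule has_derivative_compose[of "\<lambda>x. x + h" "\<lambda>x. x" x UNIV u, simplified])
     (auto intro!: derivative_eq_intros)

lemma grad_shift: "u \<in> C1 \<Longrightarrow> grad (\<lambda>x. u (x + h)) x = grad u (x + h)"
  by (intro grad_eqI GDERIV_shift C1_GDERIV)

lemma C1_shift [intro]: "u \<in> C1 \<Longrightarrow> (\<lambda>x. u (x + h)) \<in> C1"
  by (rule C1I[OF GDERIV_shift[OF C1_GDERIV]])
     (auto intro!: continuous_on_compose2[OF C1_grad_continuous] continuous_intros)

lemma DERIV_along_line:
  assumes "u \<in> C1"
  shows "DERIV (\<lambda>t. u (x + t *\<^sub>R a)) t :> a \<bullet> grad u (x + t *\<^sub>R a)"
proof -
  have "(u has_derivative (\<lambda>h. h \<bullet> grad u (x + t *\<^sub>R a))) (at (x + t *\<^sub>R a))"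
    using C1_GDERIV[OF assms] unfolding gderiv_def by blast
  then have "((\<lambda>t. u (x + t *\<^sub>R a)) has_derivative (\<lambda>s. (s *\<^sub>R a) \<bullet> grad u (x + t *\<^sub>R a))) (at t)"
    by (rule has_derivative_compose[rotated]) (auto intro!: derivative_eq_intros)
  then show ?thesis
    by (simp add: has_field_derivative_def mult.commute[of _ "a \<bullet> _"])
qed

lemma C1c_C1: "\<phi> \<in> C1c \<Longrightarrow> \<phi> \<in> C1"
  by (simp add: C1c_def)

lemma C1c_bounded_support:
  assumes "\<phi> \<in> C1c"
  obtains R where "R > 0" "\<And>x. norm x \<ge> R \<Longrightarrow> \<phi> x = 0"
proof -
  have "bounded {x. \<phi> x \<noteq> 0}"
    using assms compact_imp_bounded[of "closure {x. \<phi> x \<noteq> 0}"] closure_subset bounded_subset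
    unfolding C1c_def by blast
  then obtain R where "\<And>x. \<phi> x \<noteq> 0 \<Longrightarrow> norm x \<le> R"
    unfolding bounded_iff by auto
  then have "\<And>x. norm x \<ge> max 1 (R + 1) \<Longrightarrow> \<phi> x = 0" by force
  then show ?thesis by (intro that[of "max 1 (R + 1)"]) auto
qed

lemma C1cI:
  assumes "\<phi> \<in> C1" "\<And>x. norm x \<ge> R \<Longrightarrow> \<phi> x = 0"
  shows "\<phi> \<in> C1c"
proof -
  have "bounded {x. \<phi> x \<noteq> 0}"
    unfolding bounded_iff using assms(2) by (intro exI[of _ R]) force
  then show ?thesis using assms(1) by (simp add: C1c_def)
qed

lemma grad_locally_constant:
  assumes "open S" "x \<in> S" "\<And>y. y \<in> S \<Longrightarrow> u y = k"
  shows "grad u x = 0"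
proof (rule grad_eqI)
  show "GDERIV u x :> 0"
    unfolding gderiv_def inner_zero_right
    by (rule has_derivative_transform_within_open[OF has_derivative_const[of k] assms(1,2)])
       (use assms(3) in simp)
qed

lemma C1c_grad_support:
  assumes "\<phi> \<in> C1c"
  obtains R where "R > 0" "\<And>x. norm x \<ge> R \<Longrightarrow> \<phi> x = 0" "\<And>x. norm x \<ge> R \<Longrightarrow> grad \<phi> x = 0"
proof -
  obtain R where R: "R > 0" "\<And>x. norm x \<ge> R \<Longrightarrow> \<phi> x = 0"
    using C1c_bounded_support assms by blast
  have "grad \<phi> x = 0" if "norm x \<ge> R + 1" for x
    by (rule grad_locally_constant[of "- cball 0 R" _ _ 0]) (use R that in auto)
  then show ?thesis using R by (intro that[of "R + 1"]) auto
qed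

lemma C1c_zero [simp, intro]: "(\<lambda>x. 0) \<in> C1c"
  by (rule C1cI[of _ 0]) auto

lemma C1c_mult [intro]: "\<phi> \<in> C1c \<Longrightarrow> v \<in> C1 \<Longrightarrow> (\<lambda>x. \<phi> x * v x) \<in> C1c"
  by (frule C1c_C1, erule C1c_bounded_support, rule C1cI) (rule C1_mult, auto)

lemma C1c_mult' [intro]: "\<phi> \<in> C1c \<Longrightarrow> v \<in> C1 \<Longrightarrow> (\<lambda>x. v x * \<phi> x) \<in> C1c"
  by (frule C1c_C1, erule C1c_bounded_support, rule C1cI) (rule C1_mult, auto)

lemma C1c_add [intro]:
  assumes "\<phi> \<in> C1c" "\<psi> \<in> C1c" shows "(\<lambda>x. \<phi> x + \<psi> x) \<in> C1c"
proof -
  obtain R S where "\<And>x. norm x \<ge> R \<Longrightarrow> \<phi> x = 0" "\<And>x. norm x \<ge> S \<Longrightarrow> \<psi> x = 0"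
    using C1c_bounded_support assms by meson
  then show ?thesis
    using assms by (intro C1cI[of _ "max R S"]) (auto dest: C1c_C1)
qed

lemma C1c_sum:
  assumes "finite I" "\<And>i. i \<in> I \<Longrightarrow> u i \<in> C1c"
  shows "(\<lambda>x. \<Sum>i\<in>I. u i x) \<in> C1c"
  using assms by (induction I) auto

lemma C1c_compose:
  assumes "\<phi> \<in> C1c" "\<And>t. DERIV g t :> g' t" "continuous_on UNIV g'" "g 0 = 0"
  shows "(\<lambda>x. g (\<phi> x)) \<in> C1c"
proof -
  obtain R where "\<And>x. norm x \<ge> R \<Longrightarrow> \<phi> x = 0"
    using C1c_bounded_support assms by meson
  then show ?thesis
    using assms
    by (intro C1cI[of _ R] C1_compose[of \<phi> g g'])
       (auto dest: C1c_C1 intro: continuous_on_subset)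
qed

section \<open>Continuous functions with compact support\<close>

text \<open>Most integrands below are products of a test function or its gradient with functions
  that are merely continuous. The closure rules for products therefore ask for compact support of
  one factor only, and integrability against both measures follows.\<close>

definition ccs :: "('a::euclidean_space \<Rightarrow> 'b::euclidean_space) \<Rightarrow> bool" where
  "ccs g \<longleftrightarrow> continuous_on UNIV g \<and> (\<exists>R. \<forall>x. norm x \<ge> R \<longrightarrow> g x = 0)"

lemma ccs_C1c: "\<phi> \<in> C1c \<Longrightarrow> ccs \<phi>" "\<phi> \<in> C1c \<Longrightarrow> ccs (grad \<phi>)"
  unfolding ccs_def
  by (meson C1c_grad_support C1c_C1 C1_continuous C1_grad_continuous)+

lemma ccs_scaleR [intro]: "ccs g \<Longrightarrow> continuous_on UNIV c \<Longrightarrow> ccs (\<lambda>x. c x *\<^sub>R g x)"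
  and ccs_scaleR' [intro]: "ccs c' \<Longrightarrow> continuous_on UNIV g' \<Longrightarrow> ccs (\<lambda>x. c' x *\<^sub>R g' x)"
  and ccs_mult [intro]: "ccs p \<Longrightarrow> continuous_on UNIV q \<Longrightarrow> ccs (\<lambda>x. p x * q x)"
  and ccs_mult' [intro]: "ccs p \<Longrightarrow> continuous_on UNIV q \<Longrightarrow> ccs (\<lambda>x. q x * p x :: real)"
  and ccs_inner [intro]: "ccs v \<Longrightarrow> continuous_on UNIV w \<Longrightarrow> ccs (\<lambda>x. v x \<bullet> w x)"
  and ccs_inner' [intro]: "ccs v \<Longrightarrow> continuous_on UNIV w \<Longrightarrow> ccs (\<lambda>x. w x \<bullet> v x)"
  unfolding ccs_def by (auto intro!: continuous_intros) (metis inner_zero_left inner_zero_right)+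

lemma
  assumes "ccs g" "ccs h"
  shows ccs_add [intro]: "ccs (\<lambda>x. g x + h x)"
    and ccs_diff [intro]: "ccs (\<lambda>x. g x - h x)"
proof -
  obtain R S where "\<And>x. norm x \<ge> R \<Longrightarrow> g x = 0" "\<And>x. norm x \<ge> S \<Longrightarrow> h x = 0"
    using assms unfolding ccs_def by meson
  then show "ccs (\<lambda>x. g x + h x)" "ccs (\<lambda>x. g x - h x)"
    using assms unfolding ccs_def by (auto intro!: continuous_intros exI[of _ "max R S"])
qed

lemma ccs_integrable: 
  assumes "ccs g" shows "integrable lborel g"
proof -
  obtain R where R: "\<And>x. norm x \<ge> R \<Longrightarrow> g x = 0" using assms unfolding ccs_def by blast
  have "integrable lborel (\<lambda>x. indicator (cball 0 R) x *\<^sub>R g x)"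
    using assms by (intro borel_integrable_compact) (auto simp: ccs_def intro: continuous_on_subset)
  moreover have "(\<lambda>x. indicator (cball 0 R) x *\<^sub>R g x) = g"
    using R by (auto simp: fun_eq_iff indicator_def)
  ultimately show ?thesis by simp
qed

lemma ccs_measurable [measurable_dest]: "ccs g \<Longrightarrow> g \<in> borel_measurable borel"
  unfolding ccs_def by (auto intro: borel_measurable_continuous_onI)

lemma ccs_bounded:
  assumes "ccs g" obtains B where "B > 0" "\<And>x. norm (g x) \<le> B"
proof -
  obtain R where R: "\<And>x. norm x \<ge> R \<Longrightarrow> g x = 0" using assms unfolding ccs_def by blast
  have "compact (g ` cball 0 R)"
    using assms by (intro compact_continuous_image) (auto simp: ccs_def intro: continuous_on_subset)
  then obtain B where "\<And>x. x \<in> cball 0 R \<Longrightarrow> norm (g x) \<le> B"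
    by (meson bounded_iff compact_imp_bounded image_eqI)
  then have "norm (g x) \<le> max 1 B" for x
    using R[of x] by (cases "norm x \<le> R") (auto simp: le_max_iff_disj)
  then show ?thesis by (intro that[of "max 1 B"]) auto
qed

lemma integral_shift:
  fixes g :: "'a::euclidean_space \<Rightarrow> 'b::euclidean_space"
  assumes [measurable]: "g \<in> borel_measurable borel"
  shows "(LINT x|lborel. g (x + h)) = (LINT x|lborel. g x)"
proof -
  have "(LINT x|lborel. g x) = (LINT x|distr lborel borel ((+) h). g x)"
    by (simp add: lborel_distr_plus)
  also have "\<dots> = (LINT x|lborel. g (h + x))" by (rule integral_distr) simp_all
  finally show ?thesis by (simp add: add.commute)
qed

section \<open>Integration by parts and weak gradients\<close>

lemma C1_increment_bound:
  assumes "\<phi> \<in> C1" "\<And>x. norm x \<le> R \<Longrightarrow> norm (grad \<phi> x) \<le> B" "norm x + norm a \<le> R"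
    "0 \<le> s" "s \<le> 1"
  shows "\<bar>\<phi> (x + s *\<^sub>R a) - \<phi> x\<bar> \<le> s * (norm a * B)"
proof (cases "s = 0")
  case False
  then have "s > 0" using assms by simp
  obtain t where t: "0 < t" "t < s" "\<phi> (x + s *\<^sub>R a) - \<phi> (x + 0 *\<^sub>R a) = (s - 0) * (a \<bullet> grad \<phi> (x + t *\<^sub>R a))"
    using MVT2[OF \<open>s > 0\<close>, of "\<lambda>t. \<phi> (x + t *\<^sub>R a)" "\<lambda>t. a \<bullet> grad \<phi> (x + t *\<^sub>R a)"]
      DERIV_along_line[OF assms(1)] by blast
  have "norm (x + t *\<^sub>R a) \<le> norm x + norm a"
    using t assms norm_triangle_ineq[of x "t *\<^sub>R a"] mult_right_mono[of t 1 "norm a"] by simp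
  then have "\<bar>a \<bullet> grad \<phi> (x + t *\<^sub>R a)\<bar> \<le> norm a * B"
    using assms Cauchy_Schwarz_ineq2[of a "grad \<phi> (x + t *\<^sub>R a)"]
    by (meson mult_left_mono norm_ge_zero order_trans)
  then show ?thesis using t \<open>s > 0\<close> by (simp add: abs_mult)
qed simp

text \<open>The step is restricted to \<open>1 / (m + 1)\<close>, so that limits run along a
  sequence, as dominated convergence requires, and the translation is never longer than
  \<open>a\<close>.\<close>

definition dq :: "'a \<Rightarrow> nat \<Rightarrow> ('a::euclidean_space \<Rightarrow> real) \<Rightarrow> 'a \<Rightarrow> real" where
  "dq a m g x = real (Suc m) * (g (x + (1 / real (Suc m)) *\<^sub>R a) - g x)"

lemma C1_dq [intro]: "g \<in> C1 \<Longrightarrow> dq a m g \<in> C1"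
  unfolding dq_def[abs_def] by (intro C1_mult C1_const C1_diff C1_shift)

lemma grad_dq:
  "g \<in> C1 \<Longrightarrow> grad (dq a m g) x
     = real (Suc m) *\<^sub>R (grad g (x + (1 / real (Suc m)) *\<^sub>R a) - grad g x)"
  unfolding dq_def[abs_def] by (subst grad_cmult) (intro C1_diff C1_shift | simp add: grad_diff grad_shift C1_shift)+

lemma dq_tendsto:
  assumes "g \<in> C1"
  shows "(\<lambda>m. dq a m g x) \<longlonglongrightarrow> a \<bullet> grad g x"
proof -
  have "((\<lambda>t. (g (x + t *\<^sub>R a) - g x) / t) \<longlongrightarrow> a \<bullet> grad g x) (at 0)"
    using DERIV_along_line[OF assms, of x a 0] by (simp add: DERIV_def)
  moreover have "filterlim (\<lambda>m. 1 / real (Suc m)) (at 0) sequentially"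
    by (intro filterlim_atI LIMSEQ_Suc[OF lim_1_over_n]) auto
  ultimately have "((\<lambda>t. (g (x + t *\<^sub>R a) - g x) / t) \<circ> (\<lambda>m. 1 / real (Suc m))) \<longlonglongrightarrow> a \<bullet> grad g x"
    unfolding o_def by (rule filterlim_compose)
  then show ?thesis by (simp add: o_def dq_def mult.commute)
qed

text \<open>The translation has length at most \<open>norm a\<close>, so one bound of the gradient
  on the ball of radius \<open>R + norm a\<close> serves all \<open>m\<close>.\<close>

lemma dq_bound:
  assumes "g \<in> C1"
  obtains B where "B \<ge> 0" "\<And>m x. norm x \<le> R \<Longrightarrow> \<bar>dq a m g x\<bar> \<le> B"
proof -
  have "compact (grad g ` cball 0 (R + norm a))"
    by (intro compact_continuous_image C1_grad_continuous_on assms compact_cball)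
  then obtain B where B: "B > 0" "\<And>x. norm x \<le> R + norm a \<Longrightarrow> norm (grad g x) \<le> B"
    using compact_imp_bounded[THEN bounded_pos[THEN iffD1]]
    by (metis image_eqI mem_cball_0)
  have "\<bar>dq a m g x\<bar> \<le> norm a * B" if "norm x \<le> R" for m x
  proof -
    have "\<bar>g (x + (1 / real (Suc m)) *\<^sub>R a) - g x\<bar> \<le> 1 / real (Suc m) * (norm a * B)"
      by (rule C1_increment_bound[OF assms B(2)]) (use that in auto)
    then have "real (Suc m) * \<bar>g (x + (1 / real (Suc m)) *\<^sub>R a) - g x\<bar> \<le> norm a * B"
      by (simp add: field_simps)
    then show ?thesis by (simp add: dq_def abs_mult)
  qed
  then show ?thesis using B(1) by (intro that[of "norm a * B"]) auto
qed

lemma norm_triangle_add_le: "norm x \<le> norm (x + y) + norm (y :: 'a::real_normed_vector)"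
  using norm_triangle_ineq4[of "x + y" y] by simp

text \<open>By translation invariance every difference quotient of \<open>\<phi>\<close> has integral \<open>0\<close>.\<close>

lemma integral_grad_C1c:
  assumes "\<phi> \<in> C1c"
  shows "(LINT x|lborel. a \<bullet> grad \<phi> x) = 0"
proof -
  have C1: "\<phi> \<in> C1" using assms by (rule C1c_C1)
  obtain R where R: "R > 0" "\<And>x. norm x \<ge> R \<Longrightarrow> \<phi> x = 0"
    using C1c_bounded_support assms by blast
  obtain B where B: "B \<ge> 0" "\<And>m x. norm x \<le> R + norm a \<Longrightarrow> \<bar>dq a m \<phi> x\<bar> \<le> B"
    using dq_bound[OF C1] by blast
  have z: "dq a m \<phi> x = 0" if "norm x > R + norm a" for m x
  proof -
    have "norm x \<le> norm (x + (1 / real (Suc m)) *\<^sub>R a) + norm ((1 / real (Suc m)) *\<^sub>R a)"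
      by (rule norm_triangle_add_le)
    moreover have "norm ((1 / real (Suc m)) *\<^sub>R a) \<le> norm a"
      by (simp add: divide_le_eq mult_le_cancel_left1)
    ultimately have "norm (x + (1 / real (Suc m)) *\<^sub>R a) \<ge> R" using that by linarith
    moreover have "norm x \<ge> R" using that norm_ge_zero[of a] by linarith
    ultimately show ?thesis using R by (simp add: dq_def)
  qed
  have "(\<lambda>m. LINT x|lborel. dq a m \<phi> x) \<longlonglongrightarrow> (LINT x|lborel. a \<bullet> grad \<phi> x)"
  proof (rule integral_dominated_convergence[where w = "\<lambda>x. indicator (cball 0 (R + norm a)) x * B"])
    show "(\<lambda>x. a \<bullet> grad \<phi> x) \<in> borel_measurable lborel"
      using C1_grad_measurable[OF C1] by measurable
    show "dq a m \<phi> \<in> borel_measurable lborel" for m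
      using C1_measurable[OF C1_dq[OF C1]] by simp
    show "integrable lborel (\<lambda>x. indicator (cball 0 (R + norm a)) x * B :: real)"
      by (auto intro!: emeasure_compact_finite integrable_mult_left)
    show "AE x in lborel. (\<lambda>m. dq a m \<phi> x) \<longlonglongrightarrow> a \<bullet> grad \<phi> x"
      using dq_tendsto[OF C1] by auto
    show "AE x in lborel. norm (dq a m \<phi> x) \<le> indicator (cball 0 (R + norm a)) x * B" for m
      using z[of _ m] B by (auto simp: indicator_def not_le)
  qed
  moreover have "(LINT x|lborel. dq a m \<phi> x) = 0" for m
  proof -
    have i: "integrable lborel \<phi>" using assms by (intro ccs_integrable ccs_C1c)
    have "(\<lambda>x. \<phi> (x + (1 / real (Suc m)) *\<^sub>R a)) \<in> C1c"
    proof (rule C1cI[of _ "R + norm a"])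
      fix x :: 'a assume x: "norm x \<ge> R + norm a"
      have "norm x \<le> norm (x + (1 / real (Suc m)) *\<^sub>R a) + norm ((1 / real (Suc m)) *\<^sub>R a)"
        by (rule norm_triangle_add_le)
      moreover have "norm ((1 / real (Suc m)) *\<^sub>R a) \<le> norm a"
        by (simp add: divide_le_eq mult_le_cancel_left1)
      ultimately show "\<phi> (x + (1 / real (Suc m)) *\<^sub>R a) = 0" using R x by simp
    qed (use C1 in auto)
    then have i': "integrable lborel (\<lambda>x. \<phi> (x + (1 / real (Suc m)) *\<^sub>R a))"
      by (intro ccs_integrable ccs_C1c)
    show ?thesis
      unfolding dq_def using i i' C1_measurable[OF C1]
      by (simp add: integral_shift)
  qed
  ultimately show ?thesis by (simp add: LIMSEQ_const_iff)
qed

lemma integral_grad_C1c_vector: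
  assumes "\<phi> \<in> C1c"
  shows "(LINT x|lborel. grad \<phi> x) = 0"
proof -
  have "integrable lborel (grad \<phi>)" by (intro ccs_integrable ccs_C1c assms)
  then have "a \<bullet> (LINT x|lborel. grad \<phi> x) = 0" for a
    using integral_grad_C1c[OF assms, of a] by simp
  then show ?thesis by (metis inner_eq_zero_iff)
qed

text \<open>The integrand is the divergence of the compactly supported field
  \<open>\<phi> x *\<^sub>R (x - x0)\<close>, whose components are the \<open>p b\<close> of the
  proof. Both the mass bound for the kernels and the integration by parts against radial tests are
  instances.\<close>

lemma dilation_identity:
  fixes \<phi> :: "'a::euclidean_space \<Rightarrow> real"
  assumes "\<phi> \<in> C1c"
  shows "(LINT x|lborel. real (DIM('a)) * \<phi> x + (x - x0) \<bullet> grad \<phi> x) = 0"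
proof -
  have C1: "\<phi> \<in> C1" using assms by (rule C1c_C1)
  define p where "p b = (\<lambda>x. \<phi> x * (x \<bullet> b - x0 \<bullet> b))" for b
  have p: "p b \<in> C1c" for b unfolding p_def by (intro C1c_mult assms C1_diff C1_inner C1_const)
  have gp: "b \<bullet> grad (p b) x = \<phi> x + ((x - x0) \<bullet> b) * (b \<bullet> grad \<phi> x)" if "b \<in> Basis" for b x
    unfolding p_def using that C1
    by (subst grad_mult) (auto simp: grad_diff grad_inner grad_const inner_add_right inner_diff_left C1_diff)
  have "(LINT x|lborel. real (DIM('a)) * \<phi> x + (x - x0) \<bullet> grad \<phi> x)
        = (LINT x|lborel. (\<Sum>b\<in>Basis. b \<bullet> grad (p b) x))"
  proof (intro Bochner_Integration.integral_cong refl)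
    fix x
    have "(x - x0) \<bullet> grad \<phi> x = (\<Sum>b\<in>Basis. ((x - x0) \<bullet> b) * (b \<bullet> grad \<phi> x))"
      using euclidean_inner[of "x - x0" "grad \<phi> x"] by (simp only: inner_commute[of "grad \<phi> x"])
    then show "real (DIM('a)) * \<phi> x + (x - x0) \<bullet> grad \<phi> x = (\<Sum>b\<in>Basis. b \<bullet> grad (p b) x)"
      by (simp add: gp sum.distrib)
  qed
  also have "\<dots> = (\<Sum>b\<in>Basis. (LINT x|lborel. b \<bullet> grad (p b) x))"
    by (intro Bochner_Integration.integral_sum integrable_inner_right ccs_integrable ccs_C1c p)
  also have "\<dots> = 0" by (simp add: integral_grad_C1c p)
  finally show ?thesis .
qed

lemma ccs_scaleR_locally_integrable:
  fixes F :: "'a::euclidean_space \<Rightarrow> 'b::euclidean_space"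
  assumes "locally_integrable F" "ccs \<psi>"
  shows "integrable lborel (\<lambda>x. \<psi> x *\<^sub>R F x)"
proof -
  obtain R where R: "\<And>x. norm x \<ge> R \<Longrightarrow> \<psi> x = 0"
    using assms unfolding ccs_def by blast
  obtain B where B: "B > 0" "\<And>x. norm (\<psi> x) \<le> B" using ccs_bounded assms by blast
  have i: "integrable lborel (\<lambda>x. indicator (cball 0 R) x *\<^sub>R F x)"
    using assms(1) compact_cball[of 0 R] by (simp add: locally_integrable_def set_integrable_def)
  have [measurable]: "\<psi> \<in> borel_measurable borel" by (rule ccs_measurable[OF assms(2)])
  have "integrable lborel (\<lambda>x. \<psi> x *\<^sub>R (indicator (cball 0 R) x *\<^sub>R F x))"
  proof (rule Bochner_Integration.integrable_bound)
    show "integrable lborel (\<lambda>x. B *\<^sub>R (indicator (cball 0 R) x *\<^sub>R F x))"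
      using i by (intro integrable_scaleR_right)
    show "(\<lambda>x. \<psi> x *\<^sub>R indicat_real (cball 0 R) x *\<^sub>R F x) \<in> borel_measurable lborel"
      using i[THEN borel_measurable_integrable] by (rule borel_measurable_scaleR[rotated]) simp
    show "AE x in lborel. norm (\<psi> x *\<^sub>R indicat_real (cball 0 R) x *\<^sub>R F x)
        \<le> norm (B *\<^sub>R indicat_real (cball 0 R) x *\<^sub>R F x)"
      using B by (intro always_eventually allI) (auto simp: indicator_def intro!: mult_right_mono)
  qed
  moreover have "(\<lambda>x. \<psi> x *\<^sub>R (indicator (cball 0 R) x *\<^sub>R F x)) = (\<lambda>x. \<psi> x *\<^sub>R F x)"
    using R by (auto simp: fun_eq_iff indicator_def) (meson nle_le)
  ultimately show ?thesis by simp
qed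

lemma continuous_locally_integrable: "continuous_on UNIV F \<Longrightarrow> locally_integrable F"
  unfolding locally_integrable_def set_integrable_def
  by (auto intro: borel_integrable_compact continuous_on_subset)

lemma C1_has_weak_gradient:
  assumes "\<phi> \<in> C1"
  shows "has_weak_gradient \<phi> (grad \<phi>)"
  unfolding has_weak_gradient_def
proof (intro conjI ballI)
  show "locally_integrable \<phi>" "locally_integrable (grad \<phi>)"
    using assms by (auto intro!: continuous_locally_integrable C1_continuous C1_grad_continuous)
  fix \<psi> :: "'a \<Rightarrow> real" assume \<psi>: "\<psi> \<in> C1c"
  have i: "integrable lborel (\<lambda>x. \<psi> x *\<^sub>R grad \<phi> x)"
    using ccs_C1c[OF \<psi>] C1_grad_continuous[OF assms] by (intro ccs_integrable) auto
  have i': "integrable lborel (\<lambda>x. \<phi> x *\<^sub>R grad \<psi> x)"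
    using ccs_C1c[OF \<psi>] C1_continuous[OF assms] by (intro ccs_integrable) auto
  have "(LINT x|lborel. \<phi> x *\<^sub>R grad \<psi> x) + (LINT x|lborel. \<psi> x *\<^sub>R grad \<phi> x)
      = (LINT x|lborel. grad (\<lambda>x. \<phi> x * \<psi> x) x)"
    using i i' C1c_C1[OF \<psi>] by (simp add: grad_mult assms)
  also have "\<dots> = 0"
    using \<psi> assms by (intro integral_grad_C1c_vector) auto
  finally show "(LINT x|lborel. \<phi> x *\<^sub>R grad \<psi> x) = - (LINT x|lborel. \<psi> x *\<^sub>R grad \<phi> x)"
    by (simp add: add_eq_0_iff)
qed

section \<open>C1 cutoffs and the fundamental lemma of the calculus of variations\<close>

text \<open>The squared positive part is C1 and vanishes exactly on a half-line. Box approximations,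
  cutoffs and the barrier are all built from it.\<close>

definition pos_sq :: "real \<Rightarrow> real" where
  "pos_sq t = (max 0 t)\<^sup>2"

lemma DERIV_pos_sq: "DERIV pos_sq t :> 2 * max 0 t"
proof (cases t "0 :: real" rule: linorder_cases)
  case less
  show ?thesis
    by (rule DERIV_cong[OF has_field_derivative_transform_within_open[where f = "\<lambda>_. 0" and S = "{..<0}"]])
       (use less in \<open>auto simp: pos_sq_def\<close>)
next
  case greater
  show ?thesis
    by (rule DERIV_cong[OF has_field_derivative_transform_within_open[where f = "\<lambda>t. t\<^sup>2" and S = "{0<..}"]])
       (use greater in \<open>auto simp: pos_sq_def intro!: derivative_eq_intros\<close>)
next
  case equal
  have "((\<lambda>h. (pos_sq (0 + h) - pos_sq 0) / h) \<longlongrightarrow> 0) (at 0)"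
  proof (rule Lim_null_comparison)
    show "\<forall>\<^sub>F h in at 0. norm ((pos_sq (0 + h) - pos_sq 0) / h) \<le> \<bar>h\<bar>"
      by (auto simp: pos_sq_def max_def power2_eq_square intro!: always_eventually)
    show "((\<lambda>h. \<bar>h\<bar>) \<longlongrightarrow> (0::real)) (at 0)" by (intro tendsto_eq_intros) auto
  qed
  then show ?thesis using equal by (simp add: DERIV_def)
qed

lemma pos_sq_nonneg: "0 \<le> pos_sq t" and pos_sq_eq_0_iff: "pos_sq t = 0 \<longleftrightarrow> t \<le> 0"
  and pos_sq_0: "t \<le> 0 \<Longrightarrow> pos_sq t = 0"
  by (auto simp: pos_sq_def max_def)

lemma continuous_pos_sq: "continuous_on S pos_sq"
  unfolding pos_sq_def by (intro continuous_intros)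

lemma C1_pos_sq:
  assumes "u \<in> C1" shows "(\<lambda>x. pos_sq (u x)) \<in> C1"
  by (rule C1_compose[of _ _ "\<lambda>t. 2 * max 0 t"]) (auto intro!: assms DERIV_pos_sq continuous_intros)

lemma C1_divide:
  assumes "u \<in> C1" "v \<in> C1" "\<And>x. v x \<noteq> 0"
  shows "(\<lambda>x. u x / v x) \<in> C1"
proof -
  have "(\<lambda>x. inverse (v x)) \<in> C1"
    by (rule C1_compose[of v inverse "\<lambda>t. - (inverse t ^ Suc (Suc 0))"])
       (use assms in \<open>auto intro!: derivative_eq_intros continuous_intros\<close>)
  then show ?thesis using assms by (auto simp: divide_inverse)
qed

text \<open>A box is an intersection of half-spaces. With \<open>p = pos_sq t\<close>, the C1
  functions \<open>n p / (1 + n p)\<close> vanish for \<open>t \<le> 0\<close> and tend to 1 for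
  \<open>t > 0\<close>; their product over all faces approximates the indicator from below.\<close>

lemma C1c_approximates_box:
  fixes l r :: "'a::euclidean_space"
  obtains \<psi> where "\<And>n. \<psi> n \<in> C1c" "\<And>n x. 0 \<le> \<psi> n x \<and> \<psi> n x \<le> indicator (box l r) x"
    "\<And>x. (\<lambda>n. \<psi> n x) \<longlonglongrightarrow> (indicator (box l r) x :: real)"
proof -
  define e where "e n t = real n * pos_sq t / (1 + real n * pos_sq t)" for n t
  define \<psi> where "\<psi> n x = (\<Prod>b\<in>Basis. e n (x \<bullet> b - l \<bullet> b) * e n (r \<bullet> b - x \<bullet> b))" for n and x :: 'a
  have pos: "1 + real n * pos_sq t \<noteq> 0" for n t
    using mult_nonneg_nonneg[OF of_nat_0_le_iff[of n] pos_sq_nonneg[of t]] by linarith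
  have e01: "0 \<le> e n t" "e n t \<le> 1" for n t
    using mult_nonneg_nonneg[OF of_nat_0_le_iff[of n] pos_sq_nonneg[of t]]
    by (auto simp: e_def divide_le_eq)
  have e0: "e n t = 0" if "t \<le> 0" for n t using that by (simp add: e_def pos_sq_0)
  have e_lim: "(\<lambda>n. e n t) \<longlonglongrightarrow> 1" if "t > 0" for t
  proof -
    have p: "pos_sq t > 0" using that pos_sq_nonneg[of t] pos_sq_eq_0_iff[of t] by linarith
    have "filterlim (\<lambda>n. 1 + real n * pos_sq t) at_top sequentially"
      by (intro filterlim_tendsto_add_at_top[OF tendsto_const] filterlim_at_top_mult_tendsto_pos[OF tendsto_const p]
          filterlim_real_sequentially)
    then have "(\<lambda>n. 1 - inverse (1 + real n * pos_sq t)) \<longlonglongrightarrow> 1 - 0"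
      by (intro tendsto_diff tendsto_const tendsto_inverse_0_at_top)
    moreover have "1 - inverse (1 + real n * pos_sq t) = e n t" for n
      using pos[of n t] by (simp add: e_def field_simps)
    ultimately show ?thesis by simp
  qed
  have in_box: "\<psi> n x = 0" if x: "x \<notin> box l r" for n x
  proof -
    obtain b where "b \<in> Basis" "x \<bullet> b \<le> l \<bullet> b \<or> r \<bullet> b \<le> x \<bullet> b"
      using x by (auto simp: mem_box not_less)
    then have "\<exists>b\<in>Basis. e n (x \<bullet> b - l \<bullet> b) * e n (r \<bullet> b - x \<bullet> b) = 0"
      by (intro bexI[of _ b]) (auto simp: e0)
    then show ?thesis unfolding \<psi>_def by (intro prod_zero finite_Basis)
  qed
  have "\<psi> n \<in> C1" for n
    unfolding \<psi>_def e_def by (intro C1_prod C1_mult C1_divide C1_add C1_pos_sq C1_diff pos finite_Basis) auto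
  moreover obtain R where R: "\<And>x. x \<in> box l r \<Longrightarrow> norm x \<le> R"
    using bounded_box unfolding bounded_iff by blast
  ultimately have "\<psi> n \<in> C1c" for n
    by (rule_tac R = "R + 1" in C1cI) (auto intro!: in_box dest: R)
  moreover have "0 \<le> \<psi> n x \<and> \<psi> n x \<le> indicator (box l r) x" for n x
  proof (cases "x \<in> box l r")
    case True
    have "\<psi> n x \<le> 1" unfolding \<psi>_def by (intro prod_le_1) (auto simp: e01 intro!: mult_le_one)
    moreover have "0 \<le> \<psi> n x" unfolding \<psi>_def by (intro prod_nonneg) (auto simp: e01)
    ultimately show ?thesis using True by simp
  qed (simp add: in_box)
  moreover have "(\<lambda>n. \<psi> n x) \<longlonglongrightarrow> indicator (box l r) x" for x
  proof (cases "x \<in> box l r")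
    case True
    have "(\<lambda>n. \<psi> n x) \<longlonglongrightarrow> (\<Prod>b\<in>(Basis::'a set). 1 * 1)"
      unfolding \<psi>_def by (intro tendsto_prod tendsto_mult e_lim) (use True in \<open>auto simp: mem_box\<close>)
    then show ?thesis using True by simp
  qed (simp add: in_box)
  ultimately show ?thesis using that by blast
qed

text \<open>The positive and negative parts of \<open>g\<close> are densities of measures that agree on boxes.\<close>

lemma fundamental_lemma:
  fixes g :: "'a::euclidean_space \<Rightarrow> real"
  assumes loc: "locally_integrable g"
    and meas [measurable]: "g \<in> borel_measurable borel"
    and zero: "\<And>\<psi>. \<psi> \<in> C1c \<Longrightarrow> (LINT x|lborel. \<psi> x * g x) = 0"
  shows "AE x in lborel. g x = 0"
proof -
  have ib: "integrable lborel (\<lambda>x. indicator (box l r) x * g x)" for l r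
  proof -
    have "set_integrable lborel (cbox l r) g"
      using loc unfolding locally_integrable_def by (simp add: compact_cbox)
    then have "set_integrable lborel (box l r) g"
      by (rule set_integrable_subset) (auto simp: box_subset_cbox)
    then show ?thesis by (simp add: set_integrable_def)
  qed
  have box0: "(LINT x|lborel. indicator (box l r) x * g x) = 0" for l r
  proof -
    obtain \<psi> where \<psi>: "\<And>n. \<psi> n \<in> C1c" "\<And>n x. 0 \<le> \<psi> n x \<and> \<psi> n x \<le> indicator (box l r) x"
      "\<And>x. (\<lambda>n. \<psi> n x) \<longlonglongrightarrow> (indicator (box l r) x :: real)"
      using C1c_approximates_box[of l r] by metis
    have "(\<lambda>n. LINT x|lborel. \<psi> n x * g x) \<longlonglongrightarrow> (LINT x|lborel. indicator (box l r) x * g x)"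
    proof (rule integral_dominated_convergence[where w = "\<lambda>x. norm (indicator (box l r) x * g x)"])
      show "(\<lambda>x. \<psi> n x * g x) \<in> borel_measurable lborel" for n
        using C1_measurable[OF C1c_C1[OF \<psi>(1)]] by simp
      show "AE x in lborel. (\<lambda>n. \<psi> n x * g x) \<longlonglongrightarrow> indicator (box l r) x * g x"
        by (intro always_eventually allI tendsto_mult \<psi> tendsto_const)
      show "AE x in lborel. norm (\<psi> n x * g x) \<le> norm (indicator (box l r) x * g x)" for n
        using \<psi>(2)[of n] by (auto simp: abs_mult intro!: mult_right_mono)
      show "integrable lborel (\<lambda>x. norm (indicator (box l r) x * g x))"
        by (intro integrable_norm ib)
    qed simp
    then show ?thesis using zero[OF \<psi>(1)] by (simp add: LIMSEQ_const_iff)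
  qed
  \<comment> \<open>\<open>ennreal\<close> sends negative reals to 0, so these densities are the
    positive and the negative part of \<open>g\<close>.\<close>
  define M N where "M = density lborel (\<lambda>x. ennreal (g x))" and "N = density lborel (\<lambda>x. ennreal (- g x))"
  have em: "emeasure (density lborel (\<lambda>x. ennreal (h x))) (box l r)
      = ennreal (LINT x|lborel. indicator (box l r) x * max 0 (h x))"
    if [measurable]: "h \<in> borel_measurable borel"
      and i: "integrable lborel (\<lambda>x. indicator (box l r) x * max 0 (h x))" for h l r
  proof -
    have "emeasure (density lborel (\<lambda>x. ennreal (h x))) (box l r)
        = (\<integral>\<^sup>+x. ennreal (indicator (box l r) x * max 0 (h x)) \<partial>lborel)"
      by (subst emeasure_density) (auto intro!: nn_integral_cong simp: indicator_def max_def ennreal_neg)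
    also have "\<dots> = ennreal (LINT x|lborel. indicator (box l r) x * max 0 (h x))"
      by (rule nn_integral_eq_integral) (auto intro: i)
    finally show ?thesis .
  qed
  have ip: "integrable lborel (\<lambda>x. indicator (box l r) x * max 0 (c * g x))" if "\<bar>c\<bar> = 1" for l r c
    by (rule Bochner_Integration.integrable_bound[OF ib[of l r]])
       (use that in \<open>auto simp: indicator_def max_def abs_mult abs_if split: if_splits\<close>)
  have eq: "emeasure M (box l r) = emeasure N (box l r)" for l r
  proof -
    have "(LINT x|lborel. indicator (box l r) x * max 0 (g x)) - (LINT x|lborel. indicator (box l r) x * max 0 (- g x))
      = (LINT x|lborel. indicator (box l r) x * g x)"
      using ip[of 1 l r] ip[of "-1" l r]
      by (subst Bochner_Integration.integral_diff[symmetric])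
         (simp, simp, rule Bochner_Integration.integral_cong, auto simp: max_def)
    then show ?thesis
      unfolding M_def N_def using ip[of 1 l r] ip[of "-1" l r] by (simp add: em box0)
  qed
  have "M = N"
  proof (rule measure_eqI_generator_eq)
    let ?E = "range (\<lambda>(a, b). box a b::'a set)"
    show "Int_stable ?E" by (auto simp: Int_stable_def box_Int_box)
    show "?E \<subseteq> Pow UNIV" "sets M = sigma_sets UNIV ?E" "sets N = sigma_sets UNIV ?E"
      by (simp_all add: borel_eq_box M_def N_def)
    show "emeasure M X = emeasure N X" if "X \<in> ?E" for X using that eq by auto
    let ?A = "\<lambda>n::nat. box (- (real n *\<^sub>R One)) (real n *\<^sub>R One) :: 'a set"
    show "range ?A \<subseteq> ?E" "(\<Union>i. ?A i) = UNIV" unfolding UN_box_eq_UNIV by auto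
    show "emeasure M (?A i) \<noteq> \<infinity>" for i
      unfolding M_def using ip[of 1] by (subst em) auto
  qed
  then have "AE x in lborel. ennreal (g x) = ennreal (- g x)"
    unfolding M_def N_def by (subst (asm) sigma_finite_measure.density_unique_iff[OF lborel.sigma_finite_measure_axioms]) auto
  then show ?thesis
    by eventually_elim (auto simp: ennreal_eq_0_iff not_le ennreal_neg dest: sym split: if_splits
        intro: ccontr elim!: linorder_neqE_linordered_idom)
qed

text \<open>Integrability on compact sets makes the truncations to balls measurable, and the
  function is their pointwise limit.\<close>

lemma locally_integrable_measurable:
  fixes F :: "'a::euclidean_space \<Rightarrow> 'b::euclidean_space"
  assumes "locally_integrable F"
  shows "F \<in> borel_measurable borel"
proof (rule borel_measurable_LIMSEQ_metric)
  show "(\<lambda>x. indicator (cball 0 (real n)) x *\<^sub>R F x) \<in> borel_measurable borel" for n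
  proof -
    have "integrable lborel (\<lambda>x. indicator (cball 0 (real n)) x *\<^sub>R F x)"
      using assms compact_cball[of 0 "real n"]
      by (simp add: locally_integrable_def set_integrable_def)
    then show ?thesis using borel_measurable_integrable by fastforce
  qed
  show "(\<lambda>n. indicator (cball 0 (real n)) x *\<^sub>R F x) \<longlonglongrightarrow> F x" for x
  proof (rule tendsto_eventually)
    obtain N where "norm x \<le> real N" using real_arch_simple by blast
    then show "\<forall>\<^sub>F n in sequentially. indicator (cball 0 (real n)) x *\<^sub>R F x = F x"
      by (auto simp: eventually_sequentially indicator_def intro!: exI[of _ N])
  qed
qed

text \<open>The fundamental lemma is scalar and is applied to each component of
  \<open>G - H\<close>; as the basis is finite, the exceptional null sets can be united.\<close>

lemma has_weak_gradient_unique: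
  assumes "has_weak_gradient \<phi> G" "has_weak_gradient \<phi> H"
  shows "AE x in lborel. G x = H x"
proof -
  have loc: "locally_integrable G" "locally_integrable H"
    using assms by (auto simp: has_weak_gradient_def)
  note [measurable] = loc[THEN locally_integrable_measurable]
  have "AE x in lborel. b \<bullet> (G x - H x) = 0" for b
  proof (rule fundamental_lemma)
    show "locally_integrable (\<lambda>x. b \<bullet> (G x - H x))"
      unfolding locally_integrable_def set_integrable_def
    proof (intro allI impI)
      fix K :: "'a set" assume K: "compact K"
      have "integrable lborel (\<lambda>x. b \<bullet> (indicator K x *\<^sub>R G x - indicator K x *\<^sub>R H x))"
        using loc K unfolding locally_integrable_def set_integrable_def
        by (intro integrable_inner_right Bochner_Integration.integrable_diff) auto
      then show "integrable lborel (\<lambda>x. indicat_real K x *\<^sub>R (b \<bullet> (G x - H x)))"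
        by (simp add: scaleR_diff_right[symmetric])
    qed
    show "(LINT x|lborel. \<psi> x * (b \<bullet> (G x - H x))) = 0" if "\<psi> \<in> C1c" for \<psi>
    proof -
      have i: "integrable lborel (\<lambda>x. \<psi> x *\<^sub>R G x)" "integrable lborel (\<lambda>x. \<psi> x *\<^sub>R H x)"
        using that by (auto intro!: ccs_scaleR_locally_integrable loc ccs_C1c)
      have "(LINT x|lborel. \<psi> x *\<^sub>R G x) = (LINT x|lborel. \<psi> x *\<^sub>R H x)"
        using assms that by (auto simp: has_weak_gradient_def)
      then have "0 = b \<bullet> (LINT x|lborel. \<psi> x *\<^sub>R G x - \<psi> x *\<^sub>R H x)"
        using i by simp
      also have "\<dots> = (LINT x|lborel. b \<bullet> (\<psi> x *\<^sub>R G x - \<psi> x *\<^sub>R H x))"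
        using i by (intro integral_inner_right[symmetric]) auto
      finally show ?thesis by (simp add: inner_diff_right right_diff_distrib)
    qed
  qed simp
  then have "AE x in lborel. \<forall>b\<in>Basis. b \<bullet> (G x - H x) = 0"
    by (intro AE_finite_allI finite_Basis) auto
  then show ?thesis
    by eventually_elim (simp add: euclidean_eq_iff[of "G _"] inner_diff_right inner_commute)
qed

lemma weak_grad_C1:
  assumes "\<phi> \<in> C1"
  shows "AE x in lborel. weak_grad \<phi> x = grad \<phi> x"
proof -
  have "has_weak_gradient \<phi> (weak_grad \<phi>)"
    unfolding weak_grad_def by (rule someI[of _ "grad \<phi>"]) (rule C1_has_weak_gradient[OF assms])
  then show ?thesis
    using has_weak_gradient_unique C1_has_weak_gradient[OF assms] by blast
qed

section \<open>Integration against the Gaussian measure\<close>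

lemma AE_gauss:
  "AE x in lborel. P x \<Longrightarrow> AE x in (gauss :: 'a::euclidean_space measure). P x"
  unfolding gauss_def by (subst AE_density) auto

lemma sets_gauss [measurable_cong]: "sets gauss = sets borel"
  by (simp add: gauss_def)

lemma integral_gauss:
  fixes g :: "'a::euclidean_space \<Rightarrow> 'b::euclidean_space"
  assumes [measurable]: "g \<in> borel_measurable borel"
  shows "(LINT x|gauss. g x) = (LINT x|lborel. exp (- (norm x)\<^sup>2 / 2) *\<^sub>R g x)"
  unfolding gauss_def by (subst integral_density) auto

lemma integrable_gauss_iff:
  fixes g :: "'a::euclidean_space \<Rightarrow> 'b::euclidean_space"
  assumes [measurable]: "g \<in> borel_measurable borel"
  shows "integrable gauss g \<longleftrightarrow> integrable lborel (\<lambda>x. exp (- (norm x)\<^sup>2 / 2) *\<^sub>R g x)"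
  unfolding gauss_def by (subst integrable_density) auto

lemma integrable_gauss:
  fixes g :: "'a::euclidean_space \<Rightarrow> 'b::euclidean_space"
  assumes "ccs g" shows "integrable gauss g"
proof -
  have "ccs (\<lambda>x. exp (- (norm x)\<^sup>2 / 2) *\<^sub>R g x)"
    using assms by (intro ccs_scaleR) (auto intro!: continuous_intros)
  then show ?thesis
    using assms by (simp add: integrable_gauss_iff ccs_measurable ccs_integrable)
qed

text \<open>If the integral were 0, then \<open>g\<close> would vanish almost everywhere, but the
  set where it does not vanish is open and nonempty, hence not Lebesgue null.\<close>

lemma integral_gauss_pos:
  fixes g :: "'a::euclidean_space \<Rightarrow> real"
  assumes "integrable gauss g" "continuous_on UNIV g" "\<And>x. 0 \<le> g x" "g x0 \<noteq> 0"
  shows "(LINT x|gauss. g x) > 0"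
proof (rule ccontr)
  have [measurable]: "g \<in> borel_measurable borel"
    using assms(2) by (rule borel_measurable_continuous_onI)
  assume "\<not> ?thesis"
  then have "(LINT x|gauss. g x) = 0"
    using Bochner_Integration.integral_nonneg[of gauss g] assms(3) by fastforce
  then have "AE x in gauss. g x = 0" using assms by (subst (asm) integral_nonneg_eq_0_iff_AE) auto
  then have "AE x in lborel. g x = 0" unfolding gauss_def by (subst (asm) AE_density) auto
  then have "{x. g x \<noteq> 0} \<in> null_sets lborel"
    by (subst (asm) AE_iff_null) auto
  moreover have "open {x. g x \<noteq> 0}"
    using assms(2) by (intro open_Collect_neq) auto
  moreover have "{x. g x \<noteq> 0} \<noteq> {}" using assms(4) by blast
  ultimately show False
    by (metis negligible_iff_null_sets null_sets_completionI open_not_negligible)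
qed

section \<open>Energy and difference quotients of the solution\<close>

text \<open>The square integrable weak gradient agrees almost everywhere with the classical one. The
  resulting finiteness of the norms of \<open>v e\<close> is what allows the cutoffs to be removed
  in the limit.\<close>

lemma H1_gauss_grad_square_integrable:
  assumes "u \<in> C1" "u \<in> H1_gauss"
  shows "integrable gauss (\<lambda>x. (norm (grad u x))\<^sup>2)"
proof -
  obtain G where G: "has_weak_gradient u G" "integrable gauss (\<lambda>x. (norm (G x))\<^sup>2)"
    using assms(2) by (auto simp: H1_gauss_def)
  have "AE x in lborel. G x = grad u x"
    by (rule has_weak_gradient_unique[OF G(1) C1_has_weak_gradient[OF assms(1)]])
  then have ae: "AE x in gauss. (norm (G x))\<^sup>2 = (norm (grad u x))\<^sup>2"
    by (rule AE_gauss[THEN AE_mp]) auto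
  have [measurable]: "grad u \<in> borel_measurable borel" by (rule C1_grad_measurable[OF assms(1)])
  show ?thesis
    by (rule integrable_cong_AE_imp[OF G(2)]) (use ae in auto)
qed

lemma C1c_H1_gauss: "\<phi> \<in> C1c \<Longrightarrow> \<phi> \<in> H1_gauss"
proof -
  assume \<phi>: "\<phi> \<in> C1c"
  have "integrable gauss (\<lambda>x. (\<phi> x)\<^sup>2)" "integrable gauss (\<lambda>x. (norm (grad \<phi> x))\<^sup>2)"
    using ccs_C1c[OF \<phi>] C1_continuous[OF C1c_C1[OF \<phi>]] C1_grad_continuous[OF C1c_C1[OF \<phi>]]
    by (auto intro!: integrable_gauss ccs_mult ccs_inner simp: power2_eq_square[of "\<phi> _"] power2_norm_eq_inner)
  then show ?thesis
    unfolding H1_gauss_def using C1_has_weak_gradient C1c_C1[OF \<phi>] C1_measurable by blast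
qed

section \<open>The quadratic form on compactly supported C1 functions\<close>

text \<open>The polarized form, with the potential left free: \<open>deriv f (u x)\<close> gives
  \<open>Q\<close>, and the same potential minus 1 gives \<open>Q\<close> plus the squared norm in
  \<open>gauss\<close>.\<close>

definition energy :: "('a::euclidean_space \<Rightarrow> real) \<Rightarrow> ('a \<Rightarrow> real) \<Rightarrow> ('a \<Rightarrow> real) \<Rightarrow> real" where
  "energy c \<phi> \<psi> = (LINT x|gauss. grad \<phi> x \<bullet> grad \<psi> x - c x * \<phi> x * \<psi> x)"

text \<open>The arbitrary choice in \<open>weak_grad\<close> affects only a null set. All later
  estimates of \<open>Q\<close> pass through this identity and thus use classical gradients.\<close>

lemma Q_eq_energy:
  assumes "\<phi> \<in> C1c" "continuous_on UNIV (\<lambda>x. deriv f (u x))"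
  shows "Q f u \<phi> = energy (\<lambda>x. deriv f (u x)) \<phi> \<phi>"
proof -
  have "AE x in lborel. weak_grad \<phi> x = grad \<phi> x" by (rule weak_grad_C1[OF C1c_C1[OF assms(1)]])
  then have ae: "AE x in gauss. grad \<phi> x \<bullet> grad \<phi> x - deriv f (u x) * \<phi> x * \<phi> x
     = (norm (weak_grad \<phi> x))\<^sup>2 - deriv f (u x) * (\<phi> x)\<^sup>2"
    by (rule AE_gauss[THEN AE_mp]) (auto simp: power2_norm_eq_inner power2_eq_square[of "\<phi> _"])
  have "has_weak_gradient \<phi> (weak_grad \<phi>)"
    unfolding weak_grad_def
    by (rule someI[of _ "grad \<phi>"]) (rule C1_has_weak_gradient[OF C1c_C1[OF assms(1)]])
  then have [measurable]: "weak_grad \<phi> \<in> borel_measurable borel"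
    by (auto simp: has_weak_gradient_def intro: locally_integrable_measurable)
  have [measurable]: "\<phi> \<in> borel_measurable borel" "grad \<phi> \<in> borel_measurable borel"
    "(\<lambda>x. deriv f (u x)) \<in> borel_measurable borel"
    using C1_measurable C1_grad_measurable C1c_C1[OF assms(1)] borel_measurable_continuous_onI[OF assms(2)]
    by blast+
  show ?thesis
    unfolding Q_def energy_def
    by (rule integral_cong_AE[symmetric]) (use ae in auto)
qed

lemma energy_integrand_ccs:
  assumes "\<phi> \<in> C1c" "\<psi> \<in> C1" "continuous_on UNIV c"
  shows "ccs (\<lambda>x. grad \<phi> x \<bullet> grad \<psi> x - c x * \<phi> x * \<psi> x)"
  by (intro ccs_diff ccs_inner ccs_mult ccs_mult' ccs_C1c assms C1_continuous C1_grad_continuous)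

lemma energy_commute: "energy c \<phi> \<psi> = energy c \<psi> \<phi>"
  by (simp add: energy_def inner_commute mult.commute mult.left_commute)

lemma energy_add:
  assumes "\<phi> \<in> C1c" "\<phi>' \<in> C1c" "\<psi> \<in> C1c" "continuous_on UNIV c"
  shows "energy c (\<lambda>x. \<phi> x + \<phi>' x) \<psi> = energy c \<phi> \<psi> + energy c \<phi>' \<psi>"
proof -
  have "energy c \<phi> \<psi> + energy c \<phi>' \<psi> = (LINT x|gauss. (grad \<phi> x \<bullet> grad \<psi> x - c x * \<phi> x * \<psi> x)
      + (grad \<phi>' x \<bullet> grad \<psi> x - c x * \<phi>' x * \<psi> x))"
    unfolding energy_def
    by (intro Bochner_Integration.integral_add[symmetric] integrable_gauss energy_integrand_ccs assms C1c_C1)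
  then show ?thesis
    unfolding energy_def
    by (simp add: grad_add C1c_C1 assms inner_add_left algebra_simps)
qed

lemma energy_cmult:
  assumes "\<phi> \<in> C1c"
  shows "energy c (\<lambda>x. r * \<phi> x) \<psi> = r * energy c \<phi> \<psi>"
proof -
  have "energy c (\<lambda>x. r * \<phi> x) \<psi> = (LINT x|gauss. r * (grad \<phi> x \<bullet> grad \<psi> x - c x * \<phi> x * \<psi> x))"
    unfolding energy_def by (simp add: grad_cmult C1c_C1 assms algebra_simps)
  then show ?thesis by (simp add: energy_def)
qed

lemma energy_zero: "energy c (\<lambda>x. 0) \<psi> = 0"
  by (simp add: energy_def grad_const)

lemma energy_sum_left:
  assumes "finite I" "\<And>i. i \<in> I \<Longrightarrow> p i \<in> C1c" "\<psi> \<in> C1c" "continuous_on UNIV c"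
  shows "energy c (\<lambda>x. \<Sum>i\<in>I. r i * p i x) \<psi> = (\<Sum>i\<in>I. r i * energy c (p i) \<psi>)"
  using assms(1,2)
proof (induction I)
  case (insert i I)
  have "energy c (\<lambda>x. r i * p i x + (\<Sum>i\<in>I. r i * p i x)) \<psi>
      = energy c (\<lambda>x. r i * p i x) \<psi> + energy c (\<lambda>x. \<Sum>i\<in>I. r i * p i x) \<psi>"
    using insert by (intro energy_add C1c_sum C1c_mult' assms(3,4)) auto
  then show ?case using insert by (simp add: energy_cmult)
qed (simp add: energy_zero)

lemma energy_sum:
  assumes "finite I" "\<And>i. i \<in> I \<Longrightarrow> p i \<in> C1c" "continuous_on UNIV c"
  shows "energy c (\<lambda>x. \<Sum>i\<in>I. r i * p i x) (\<lambda>x. \<Sum>i\<in>I. r i * p i x)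
    = (\<Sum>i\<in>I. \<Sum>j\<in>I. r i * r j * energy c (p i) (p j))"
proof -
  have s: "(\<lambda>x. \<Sum>i\<in>I. r i * p i x) \<in> C1c"
    using assms by (intro C1c_sum C1c_mult') auto
  have e: "energy c (p i) (\<lambda>x. \<Sum>j\<in>I. r j * p j x) = (\<Sum>j\<in>I. r j * energy c (p i) (p j))" if "i \<in> I" for i
    using energy_sum_left[OF assms(1,2) assms(2)[OF that] assms(3), where r = r]
    by (simp add: energy_commute[of c _ "p i"])
  have "energy c (\<lambda>x. \<Sum>i\<in>I. r i * p i x) (\<lambda>x. \<Sum>i\<in>I. r i * p i x)
    = (\<Sum>i\<in>I. r i * energy c (p i) (\<lambda>x. \<Sum>i\<in>I. r i * p i x))"
    using assms s by (intro energy_sum_left) auto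
  then show ?thesis by (simp add: e sum_distrib_left mult.assoc)
qed

section \<open>Pointwise convergence with local bounds\<close>

lemma continuous_bounded_on_ball:
  fixes g :: "'a::euclidean_space \<Rightarrow> 'b::real_normed_vector"
  assumes "continuous_on UNIV g"
  shows "\<exists>B. \<forall>x. norm x \<le> R \<longrightarrow> norm (g x) \<le> B"
proof -
  have "compact (g ` cball 0 R)"
    by (intro compact_continuous_image compact_cball continuous_on_subset[OF assms]) auto
  from compact_imp_bounded[OF this] show ?thesis
    unfolding bounded_iff by (metis imageI mem_cball_0)
qed

text \<open>The bound on each ball is uniform in \<open>m\<close>, so after multiplication by a
  compactly supported weight dominated convergence applies. The notion is closed under sums and
  products, which spares a separate majorant for every integrand.\<close>

definition lb_conv :: "(nat \<Rightarrow> 'a::euclidean_space \<Rightarrow> real) \<Rightarrow> ('a \<Rightarrow> real) \<Rightarrow> bool" where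
  "lb_conv F G \<longleftrightarrow> (\<forall>m. F m \<in> borel_measurable borel) \<and>
     (\<forall>R. \<exists>B. \<forall>m x. norm x \<le> R \<longrightarrow> \<bar>F m x\<bar> \<le> B) \<and> (\<forall>x. (\<lambda>m. F m x) \<longlonglongrightarrow> G x)"

lemma lb_convI:
  assumes "\<And>m. F m \<in> borel_measurable borel"
    "\<And>R. \<exists>B. \<forall>m x. norm x \<le> R \<longrightarrow> \<bar>F m x\<bar> \<le> B" "\<And>x. (\<lambda>m. F m x) \<longlonglongrightarrow> G x"
  shows "lb_conv F G"
  using assms by (simp add: lb_conv_def)

lemma lb_conv_const:
  assumes "continuous_on UNIV g" shows "lb_conv (\<lambda>m. g) g"
proof (rule lb_convI)
  show "\<exists>B. \<forall>m x. norm x \<le> R \<longrightarrow> \<bar>g x\<bar> \<le> B" for R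
    using continuous_bounded_on_ball[OF assms, of R] by auto
  show "g \<in> borel_measurable borel" using assms by (rule borel_measurable_continuous_onI)
  show "(\<lambda>m. g x) \<longlonglongrightarrow> g x" for x by simp
qed

lemma lb_conv_mult:
  assumes "lb_conv F G" "lb_conv F' G'"
  shows "lb_conv (\<lambda>m x. F m x * F' m x) (\<lambda>x. G x * G' x)"
proof (rule lb_convI)
  fix R
  obtain B B' where "\<And>m x. norm x \<le> R \<Longrightarrow> \<bar>F m x\<bar> \<le> B" "\<And>m x. norm x \<le> R \<Longrightarrow> \<bar>F' m x\<bar> \<le> B'"
    using assms unfolding lb_conv_def by meson
  then have "\<bar>F m x * F' m x\<bar> \<le> B * B'" if "norm x \<le> R" for m x
    unfolding abs_mult using that by (intro mult_mono') auto
  then show "\<exists>B. \<forall>m x. norm x \<le> R \<longrightarrow> \<bar>F m x * F' m x\<bar> \<le> B" by blast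
next
  show "(\<lambda>x. F m x * F' m x) \<in> borel_measurable borel" for m
    using assms unfolding lb_conv_def by (intro borel_measurable_times) auto
  show "(\<lambda>m. F m x * F' m x) \<longlonglongrightarrow> G x * G' x" for x
    using assms unfolding lb_conv_def by (intro tendsto_mult) auto
qed

lemma lb_conv_add:
  assumes "lb_conv F G" "lb_conv F' G'"
  shows "lb_conv (\<lambda>m x. F m x + F' m x) (\<lambda>x. G x + G' x)"
proof (rule lb_convI)
  fix R
  obtain B B' where "\<And>m x. norm x \<le> R \<Longrightarrow> \<bar>F m x\<bar> \<le> B" "\<And>m x. norm x \<le> R \<Longrightarrow> \<bar>F' m x\<bar> \<le> B'"
    using assms unfolding lb_conv_def by meson
  then have "\<bar>F m x + F' m x\<bar> \<le> B + B'" if "norm x \<le> R" for m x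
    using that by (meson abs_triangle_ineq add_mono order_trans)
  then show "\<exists>B. \<forall>m x. norm x \<le> R \<longrightarrow> \<bar>F m x + F' m x\<bar> \<le> B" by blast
next
  show "(\<lambda>x. F m x + F' m x) \<in> borel_measurable borel" for m
    using assms unfolding lb_conv_def by (intro borel_measurable_add) auto
  show "(\<lambda>m. F m x + F' m x) \<longlonglongrightarrow> G x + G' x" for x
    using assms unfolding lb_conv_def by (intro tendsto_add) auto
qed

lemma lb_conv_diff:
  assumes "lb_conv F G" "lb_conv F' G'"
  shows "lb_conv (\<lambda>m x. F m x - F' m x) (\<lambda>x. G x - G' x)"
  using lb_conv_add[OF assms(1) lb_conv_mult[OF lb_conv_const assms(2)], of "\<lambda>x. -1"] by simp

lemma lb_conv_dq: "g \<in> C1 \<Longrightarrow> lb_conv (\<lambda>m. dq a m g) (\<lambda>x. a \<bullet> grad g x)"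
  by (rule lb_convI) (auto intro!: C1_measurable C1_dq dq_tendsto intro: dq_bound[of g])

lemma lb_conv_shift:
  assumes "continuous_on UNIV g"
  shows "lb_conv (\<lambda>m x. g (x + (1 / real (Suc m)) *\<^sub>R a)) g"
proof (rule lb_convI)
  fix R
  obtain B where B: "\<And>x. norm x \<le> R + norm a \<Longrightarrow> \<bar>g x\<bar> \<le> B"
    using continuous_bounded_on_ball[OF assms, of "R + norm a"] by auto
  have "norm (x + (1 / real (Suc m)) *\<^sub>R a) \<le> R + norm a" if "norm x \<le> R" for m x
  proof -
    have "norm ((1 / real (Suc m)) *\<^sub>R a) \<le> norm a"
      by (simp add: divide_le_eq mult_le_cancel_left1)
    then show ?thesis using norm_triangle_ineq[of x "(1 / real (Suc m)) *\<^sub>R a"] that by linarith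
  qed
  then show "\<exists>B. \<forall>m x. norm x \<le> R \<longrightarrow> \<bar>g (x + (1 / real (Suc m)) *\<^sub>R a)\<bar> \<le> B" using B by meson
next
  show "(\<lambda>x. g (x + (1 / real (Suc m)) *\<^sub>R a)) \<in> borel_measurable borel" for m
    by (intro borel_measurable_continuous_onI continuous_on_compose2[OF assms] continuous_intros) auto
  fix x
  have "(\<lambda>m. x + (1 / real (Suc m)) *\<^sub>R a) \<longlonglongrightarrow> x + 0 *\<^sub>R a"
    by (intro tendsto_intros LIMSEQ_Suc[OF lim_1_over_n])
  moreover have "isCont g x" using assms by (simp add: continuous_on_eq_continuous_at)
  ultimately show "(\<lambda>m. g (x + (1 / real (Suc m)) *\<^sub>R a)) \<longlonglongrightarrow> g x"
    using isCont_tendsto_compose by fastforce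
qed

lemma integral_lb_conv:
  fixes F :: "nat \<Rightarrow> 'a::euclidean_space \<Rightarrow> real"
  assumes "lb_conv F G" "ccs p"
  shows "(\<lambda>m. LINT x|gauss. p x * F m x) \<longlonglongrightarrow> (LINT x|gauss. p x * G x)"
    and "integrable gauss (\<lambda>x. p x * F m x)"
proof -
  obtain R where R: "\<And>x. norm x \<ge> R \<Longrightarrow> p x = 0" using assms(2) unfolding ccs_def by blast
  obtain B where B: "\<And>m x. norm x \<le> R \<Longrightarrow> \<bar>F m x\<bar> \<le> B"
    using assms(1) unfolding lb_conv_def by meson
  have [measurable]: "p \<in> borel_measurable borel" by (rule ccs_measurable[OF assms(2)])
  have Fm [measurable]: "F m \<in> borel_measurable borel" for m
    using assms(1) by (simp add: lb_conv_def)
  have lim: "(\<lambda>m. F m x) \<longlonglongrightarrow> G x" for x using assms(1) by (simp add: lb_conv_def)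
  have [measurable]: "G \<in> borel_measurable borel"
    by (rule borel_measurable_LIMSEQ_metric[OF Fm lim])
  have i: "integrable gauss (\<lambda>x. norm (p x) * B)"
    by (intro integrable_mult_left integrable_norm integrable_gauss assms)
  have le: "norm (p x * F m x) \<le> norm (p x) * B" for m x
    using B[of x m] R[of x] by (cases "norm x \<le> R") (auto simp: abs_mult intro!: mult_left_mono)
  show "(\<lambda>m. LINT x|gauss. p x * F m x) \<longlonglongrightarrow> (LINT x|gauss. p x * G x)"
    by (rule integral_dominated_convergence[OF _ _ i])
       (use le in \<open>auto intro!: always_eventually tendsto_mult lim\<close>)
  show "integrable gauss (\<lambda>x. p x * F m x)"
    by (rule Bochner_Integration.integrable_bound[OF i]) 
       (use le[of _ m] in \<open>auto intro!: always_eventually intro: order_trans[OF _ abs_ge_self]\<close>)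
qed

section \<open>The equation for translates and difference quotients\<close>

text \<open>The Gaussian weight is not translation invariant. The test function is the translate of
  \<open>\<psi>\<close> times the Cameron-Martin density \<open>E\<close>, which turns the weight at
  \<open>x\<close> into the weight at \<open>x - h\<close>; the gradient of \<open>E\<close>
  contributes the extra term \<open>\<psi> x *\<^sub>R h\<close>.\<close>

lemma weak_solution_shift:
  fixes u :: "'a::euclidean_space \<Rightarrow> real"
  assumes sol: "weak_solution f u" and u: "u \<in> C1" and f: "continuous_on UNIV f" and \<psi>: "\<psi> \<in> C1c"
  shows "(LINT x|gauss. grad u (x + h) \<bullet> (grad \<psi> x + \<psi> x *\<^sub>R h) - f (u (x + h)) * \<psi> x) = 0"
proof -
  define E where "E x = exp (x \<bullet> h - (norm h)\<^sup>2 / 2)" for x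
  define \<phi> where "\<phi> x = \<psi> (x - h) * E x" for x
  have C1E: "E \<in> C1" and gE: "grad E x = E x *\<^sub>R h" for x
  proof -
    have l: "(\<lambda>x. x \<bullet> h - (norm h)\<^sup>2 / 2) \<in> C1" by auto
    show "E \<in> C1"
      unfolding E_def by (rule C1_compose[OF l, of exp exp]) (auto intro!: continuous_intros derivative_eq_intros)
    show "grad E x = E x *\<^sub>R h"
      unfolding E_def by (subst grad_compose[OF l]) (auto simp: grad_diff grad_inner grad_const)
  qed
  have C1: "(\<lambda>x. \<psi> (x - h)) \<in> C1" using C1_shift[OF C1c_C1[OF \<psi>], of "- h"] by simp
  have gs: "grad (\<lambda>x. \<psi> (x - h)) x = grad \<psi> (x - h)" for x
    using grad_shift[OF C1c_C1[OF \<psi>], of "- h"] by simp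
  obtain R where R: "\<And>x. norm x \<ge> R \<Longrightarrow> \<psi> x = 0" using C1c_bounded_support[OF \<psi>] by metis
  have \<phi>: "\<phi> \<in> C1c"
  proof (rule C1cI[of _ "R + norm h"])
    show "\<phi> \<in> C1" unfolding \<phi>_def using C1 C1E by auto
    show "\<phi> x = 0" if "norm x \<ge> R + norm h" for x
      using that norm_triangle_sub[of x h] R by (simp add: \<phi>_def)
  qed
  have g\<phi>: "grad \<phi> x = E x *\<^sub>R (grad \<psi> (x - h) + \<psi> (x - h) *\<^sub>R h)" for x
    unfolding \<phi>_def by (simp add: grad_mult C1 C1E gE gs scaleR_add_right mult.commute)
  have exp_eq: "exp (- (norm x)\<^sup>2 / 2) * E x = exp (- (norm (x - h))\<^sup>2 / 2)" for x
    unfolding E_def exp_add[symmetric] power2_norm_eq_inner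
    by (simp add: inner_diff_left inner_diff_right inner_commute field_simps)
  define K where "K x = grad u (x + h) \<bullet> (grad \<psi> x + \<psi> x *\<^sub>R h) - f (u (x + h)) * \<psi> x" for x
  have contu: "continuous_on UNIV (\<lambda>x. u (x + h))" "continuous_on UNIV (\<lambda>x. grad u (x + h))"
    by (auto intro!: continuous_on_compose2[OF C1_continuous[OF u]]
        continuous_on_compose2[OF C1_grad_continuous[OF u]] continuous_intros)
  have contK: "continuous_on UNIV K"
    unfolding K_def
    by (intro continuous_intros contu C1_grad_continuous_on C1_continuous C1c_C1 \<psi> continuous_on_compose2[OF f contu(1)]) auto
  note [measurable] = borel_measurable_continuous_onI[OF contK] C1_measurable[OF u]
     C1_grad_measurable[OF u] C1_measurable[OF C1c_C1[OF \<phi>]] C1_grad_measurable[OF C1c_C1[OF \<phi>]]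
     borel_measurable_continuous_onI[OF f]
  have "0 = (LINT x|gauss. grad u x \<bullet> grad \<phi> x - f (u x) * \<phi> x)"
    using sol \<phi> by (simp add: weak_solution_def)
  also have "\<dots> = (LINT x|lborel. exp (- (norm x)\<^sup>2 / 2) *\<^sub>R (grad u x \<bullet> grad \<phi> x - f (u x) * \<phi> x))"
    by (rule integral_gauss) measurable
  also have "\<dots> = (LINT x|lborel. exp (- (norm (x - h))\<^sup>2 / 2) * K (x - h))"
    unfolding exp_eq[symmetric] g\<phi> K_def
    by (intro Bochner_Integration.integral_cong) (auto simp: \<phi>_def algebra_simps)
  also have "\<dots> = (LINT x|lborel. exp (- (norm (x + h - h))\<^sup>2 / 2) * K (x + h - h))"
    by (rule integral_shift[symmetric]) measurable
  also have "\<dots> = (LINT x|gauss. K x)" by (subst integral_gauss) auto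
  finally show ?thesis by (simp add: K_def)
qed

text \<open>This is \<open>Suc m\<close> times the difference of the translated and the original
  equation. As \<open>Suc m\<close> times the translation vector is \<open>a\<close>, the term due
  to the Gaussian weight becomes \<open>a \<bullet> grad u\<close> at the translated point, without
  remainder; it is the discrete source of the value \<open>- 1\<close>.\<close>

lemma dq_weak_equation:
  fixes u :: "'a::euclidean_space \<Rightarrow> real"
  assumes sol: "weak_solution f u" and u: "u \<in> C1" and f: "continuous_on UNIV f" and \<psi>: "\<psi> \<in> C1c"
  shows "(LINT x|gauss. grad (dq a m u) x \<bullet> grad \<psi> x)
    = (LINT x|gauss. (dq a m (\<lambda>x. f (u x)) x - a \<bullet> grad u (x + (1 / real (Suc m)) *\<^sub>R a)) * \<psi> x)"
proof -
  define h where "h = (1 / real (Suc m)) *\<^sub>R a"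
  have contu: "continuous_on UNIV (\<lambda>x. u (x + h))" "continuous_on UNIV (\<lambda>x. grad u (x + h))"
    by (auto intro!: continuous_on_compose2[OF C1_continuous[OF u]]
        continuous_on_compose2[OF C1_grad_continuous[OF u]] continuous_intros)
  have contf: "continuous_on UNIV (\<lambda>x. f (u (x + h)))" "continuous_on UNIV (\<lambda>x. f (u x))"
    by (rule continuous_on_compose2[OF f contu(1)] continuous_on_compose2[OF f C1_continuous[OF u]]; simp)+
  define A where "A x = grad u (x + h) \<bullet> (grad \<psi> x + \<psi> x *\<^sub>R h) - f (u (x + h)) * \<psi> x" for x
  define A' where "A' x = grad u x \<bullet> grad \<psi> x - f (u x) * \<psi> x" for x
  have ccsA: "ccs A" "ccs A'" unfolding A_def A'_def
    by (intro ccs_diff ccs_inner' ccs_mult' ccs_add ccs_scaleR' ccs_C1c \<psi> contu contf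
        C1_grad_continuous u continuous_on_const)+
  define X where "X x = grad (dq a m u) x \<bullet> grad \<psi> x" for x
  define Y where "Y x = (dq a m (\<lambda>x. f (u x)) x - a \<bullet> grad u (x + h)) * \<psi> x" for x
  have "continuous_on UNIV (dq a m (\<lambda>x. f (u x)))"
    unfolding dq_def h_def[symmetric] by (intro continuous_intros contf)
  then have ccsXY: "ccs X" "ccs Y" unfolding X_def Y_def
    by (intro ccs_inner' ccs_mult' ccs_C1c \<psi> C1_grad_continuous C1_dq u continuous_intros contu | assumption)+
  have "X x - Y x = real (Suc m) * (A x - A' x)" for x
  proof -
    have k: "real (Suc m) * (grad u (x + h) \<bullet> h) = a \<bullet> grad u (x + h)"
      by (simp add: h_def inner_commute)
    have "X x - Y x = real (Suc m) * ((grad u (x + h) - grad u x) \<bullet> grad \<psi> x)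
      - (real (Suc m) * (f (u (x + h)) - f (u x)) - real (Suc m) * (grad u (x + h) \<bullet> h)) * \<psi> x"
      unfolding X_def Y_def grad_dq[OF u] k by (simp add: dq_def h_def del: of_nat_Suc)
    also have "\<dots> = real (Suc m) * (A x - A' x)"
      unfolding A_def A'_def by (simp add: inner_diff_left inner_add_right algebra_simps del: of_nat_Suc)
    finally show ?thesis .
  qed
  then have "(LINT x|gauss. X x - Y x) = (LINT x|gauss. real (Suc m) * (A x - A' x))" by simp
  also have "\<dots> = real (Suc m) * ((LINT x|gauss. A x) - (LINT x|gauss. A' x))"
    using integrable_gauss[OF ccsA(1)] integrable_gauss[OF ccsA(2)] by simp
  also have "\<dots> = 0"
    using weak_solution_shift[OF sol u f \<psi>, of h] sol \<psi> by (simp add: A_def A'_def weak_solution_def)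
  finally have "(LINT x|gauss. X x) = (LINT x|gauss. Y x)"
    using integrable_gauss[OF ccsXY(1)] integrable_gauss[OF ccsXY(2)] by simp
  then show ?thesis by (simp add: X_def Y_def h_def)
qed

section \<open>The solution, its directional derivatives and the energies of their quotients\<close>

locale gauss_solution =
  fixes f :: "real \<Rightarrow> real" and u :: "'a::euclidean_space \<Rightarrow> real"
  assumes f_C1: "f C1_differentiable_on UNIV"
    and u_C1: "u \<in> C1" and u_H1: "u \<in> H1_gauss" and u_bounded: "bounded (range u)"
    and sol: "weak_solution f u"
begin

definition c :: "'a \<Rightarrow> real" where "c x = deriv f (u x)"

lemma DERIV_f: "DERIV f t :> deriv f t" and continuous_deriv_f: "continuous_on UNIV (deriv f)"
proof -
  obtain D where D: "\<And>t. (f has_vector_derivative D t) (at t)" "continuous_on UNIV D"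
    using f_C1 unfolding C1_differentiable_on_def by blast
  have D': "DERIV f t :> D t" for t using D(1) by (simp add: has_real_derivative_iff_has_vector_derivative)
  then have "deriv f = D" using DERIV_imp_deriv by blast
  then show "DERIV f t :> deriv f t" "continuous_on UNIV (deriv f)" using D' D(2) by auto
qed

lemma continuous_f: "continuous_on UNIV f"
  using DERIV_f DERIV_continuous_on by blast

lemma continuous_c: "continuous_on UNIV c"
  unfolding c_def by (intro continuous_on_compose2[OF continuous_deriv_f] C1_continuous u_C1) auto

text \<open>Boundedness of \<open>u\<close> enters here: \<open>deriv f\<close> may be unbounded on
  the line, but not on the compact closure of the range. The bound supplies the constant of the
  maximum principle.\<close>

lemma c_bounded: obtains M where "M \<ge> 0" "\<And>x. \<bar>c x\<bar> \<le> M"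
proof -
  have "compact (deriv f ` closure (range u))"
    using u_bounded by (intro compact_continuous_image continuous_on_subset[OF continuous_deriv_f]) auto
  from compact_imp_bounded[OF this]
  obtain M where M: "\<And>t. t \<in> closure (range u) \<Longrightarrow> \<bar>deriv f t\<bar> \<le> M"
    unfolding bounded_iff by auto
  have "\<bar>c x\<bar> \<le> M" for x
    unfolding c_def by (rule M) (rule subsetD[OF closure_subset], simp)
  moreover from this[of 0] have "M \<ge> 0" by linarith
  ultimately show ?thesis using that by blast
qed

definition v :: "'a \<Rightarrow> 'a \<Rightarrow> real" where "v a x = a \<bullet> grad u x"

lemma continuous_v: "continuous_on S (v a)"
  unfolding v_def by (intro continuous_intros C1_grad_continuous_on u_C1)

lemma v_square_integrable: "integrable gauss (\<lambda>x. v a x * v b x)"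
proof (rule Bochner_Integration.integrable_bound)
  show "integrable gauss (\<lambda>x. norm a * norm b * (norm (grad u x))\<^sup>2)"
    using H1_gauss_grad_square_integrable[OF u_C1 u_H1] by simp
  have [measurable]: "v a \<in> borel_measurable borel" for a
    using continuous_v by (rule borel_measurable_continuous_onI)
  show "(\<lambda>x. v a x * v b x) \<in> borel_measurable gauss" by measurable
  have "\<bar>v a x * v b x\<bar> \<le> norm a * norm b * (norm (grad u x))\<^sup>2" for x
    using mult_mono'[OF Cauchy_Schwarz_ineq2[of a "grad u x"] Cauchy_Schwarz_ineq2[of b "grad u x"]]
    by (simp add: v_def abs_mult power2_eq_square mult_ac)
  then show "AE x in gauss. norm (v a x * v b x) \<le> norm (norm a * norm b * (norm (grad u x))\<^sup>2)"
    by (auto simp: abs_mult)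
qed

definition dq_rhs :: "'a \<Rightarrow> nat \<Rightarrow> 'a \<Rightarrow> real" where
  "dq_rhs a m x = dq a m (\<lambda>x. f (u x)) x - a \<bullet> grad u (x + (1 / real (Suc m)) *\<^sub>R a)"

lemma C1_f_u: "(\<lambda>x. f (u x)) \<in> C1" and grad_f_u: "grad (\<lambda>x. f (u x)) x = c x *\<^sub>R grad u x"
proof -
  show "(\<lambda>x. f (u x)) \<in> C1"
    by (rule C1_compose[of _ _ "deriv f"])
       (auto intro: u_C1 DERIV_f continuous_on_subset[OF continuous_deriv_f])
  show "grad (\<lambda>x. f (u x)) x = c x *\<^sub>R grad u x"
    unfolding c_def by (intro grad_compose u_C1 DERIV_f)
qed

lemma lb_conv_dq_rhs: "lb_conv (dq_rhs a) (\<lambda>x. c x * v a x - v a x)"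
proof -
  have "lb_conv (\<lambda>m x. dq a m (\<lambda>x. f (u x)) x - v a (x + (1 / real (Suc m)) *\<^sub>R a))
      (\<lambda>x. a \<bullet> grad (\<lambda>x. f (u x)) x - v a x)"
    by (intro lb_conv_diff lb_conv_dq C1_f_u lb_conv_shift continuous_v)
  then show ?thesis by (simp add: dq_rhs_def[abs_def] v_def grad_f_u)
qed

lemma lb_conv_v: "lb_conv (\<lambda>m. dq a m u) (v a)"
  unfolding v_def by (rule lb_conv_dq[OF u_C1])

lemma dq_equation:
  assumes "\<psi> \<in> C1c"
  shows "(LINT x|gauss. grad (dq a m u) x \<bullet> grad \<psi> x) = (LINT x|gauss. dq_rhs a m x * \<psi> x)"
  unfolding dq_rhs_def by (rule dq_weak_equation[OF sol u_C1 continuous_f assms])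

text \<open>The gradients of the quotients may have no limit, but the equation of each quotient,
  tested with the other one times \<open>\<eta>\<^sup>2\<close>, trades them for
  \<open>dq_rhs\<close>, which converges. In the limit the potential cancels, and the term
  \<open>- v\<close> of the equation leaves \<open>- \<eta>\<^sup>2\<close>.\<close>

lemma energy_dq_tendsto:
  assumes \<eta>: "\<eta> \<in> C1c"
  shows "(\<lambda>m. energy c (\<lambda>x. dq a m u x * \<eta> x) (\<lambda>x. dq b m u x * \<eta> x))
     \<longlonglongrightarrow> (LINT x|gauss. v a x * v b x * ((norm (grad \<eta> x))\<^sup>2 - (\<eta> x)\<^sup>2))"
proof -
  have \<eta>1: "\<eta> \<in> C1" by (rule C1c_C1[OF \<eta>])
  define p where "p a m = dq a m u" for a m
  have p: "p a m \<in> C1" for a m unfolding p_def by (intro C1_dq u_C1)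
  have pc: "continuous_on UNIV (p a m)" for a m by (intro C1_continuous p)
  have q: "(\<lambda>x. p a m x * (\<eta> x * \<eta> x)) \<in> C1c" for a m
    by (intro C1c_mult' C1c_mult \<eta> \<eta>1 p)
  have gq: "grad (\<lambda>x. p a m x * (\<eta> x * \<eta> x)) x
      = p a m x *\<^sub>R (\<eta> x *\<^sub>R grad \<eta> x + \<eta> x *\<^sub>R grad \<eta> x) + (\<eta> x * \<eta> x) *\<^sub>R grad (p a m) x" for a m x
    using p \<eta>1 by (subst grad_mult) (auto simp: grad_mult)
  have gp: "grad (\<lambda>x. p a m x * \<eta> x) x = p a m x *\<^sub>R grad \<eta> x + \<eta> x *\<^sub>R grad (p a m) x" for a m x
    using p \<eta>1 by (rule grad_mult)
  define X where "X a b m x = grad (p a m) x \<bullet> grad (\<lambda>x. p b m x * (\<eta> x * \<eta> x)) x" for a b m x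
  have X: "(LINT x|gauss. X a b m x) = (LINT x|gauss. (\<eta> x * \<eta> x) * (dq_rhs a m x * p b m x))" for a b m
    unfolding X_def using dq_equation[OF q[of b m], of a m] by (simp add: p_def mult_ac)
  have iX: "integrable gauss (X a b m)" for a b m
    unfolding X_def[abs_def] by (intro integrable_gauss ccs_inner' ccs_C1c q C1_grad_continuous p)
  define N where "N x = (norm (grad \<eta> x))\<^sup>2" for x
  have N: "ccs N" unfolding N_def power2_norm_eq_inner
    by (intro ccs_inner ccs_C1c \<eta> C1_grad_continuous \<eta>1)
  have \<eta>\<eta>: "ccs (\<lambda>x. \<eta> x * \<eta> x)" by (intro ccs_mult ccs_C1c \<eta> C1_continuous \<eta>1)
  have lb: "lb_conv (p a) (v a)" for a unfolding p_def by (rule lb_conv_v)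
  have lbrp: "lb_conv (\<lambda>m x. dq_rhs a m x * p b m x) (\<lambda>x. (c x * v a x - v a x) * v b x)" for a b
    by (intro lb_conv_mult lb_conv_dq_rhs lb)
  have lbpp: "lb_conv (\<lambda>m x. p a m x * p b m x) (\<lambda>x. v a x * v b x)"
    by (intro lb_conv_mult lb)
  have lbcpp: "lb_conv (\<lambda>m x. c x * (p a m x * p b m x)) (\<lambda>x. c x * (v a x * v b x))"
    by (intro lb_conv_mult lb lb_conv_const continuous_c)
  note ints = integral_lb_conv(2)[OF lbpp N] integral_lb_conv(2)[OF lbcpp \<eta>\<eta>]
  \<comment> \<open>Pointwise, \<open>\<nabla>(p \<eta>) \<bullet> \<nabla>(q \<eta>)\<close> is
    half of \<open>\<nabla>p \<bullet> \<nabla>(q \<eta>\<^sup>2) + \<nabla>q \<bullet> \<nabla>(p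
    \<eta>\<^sup>2)\<close>, plus \<open>p q\<close> times the squared norm of
    \<open>\<nabla>\<eta>\<close>; the symmetrization makes the mixed terms match.\<close>
  have e: "energy c (\<lambda>x. p a m x * \<eta> x) (\<lambda>x. p b m x * \<eta> x)
     = ((LINT x|gauss. (\<eta> x * \<eta> x) * (dq_rhs a m x * p b m x)) + (LINT x|gauss. (\<eta> x * \<eta> x) * (dq_rhs b m x * p a m x))) / 2
       + (LINT x|gauss. N x * (p a m x * p b m x)) - (LINT x|gauss. (\<eta> x * \<eta> x) * (c x * (p a m x * p b m x)))" for m
  proof -
    have "energy c (\<lambda>x. p a m x * \<eta> x) (\<lambda>x. p b m x * \<eta> x)
      = (LINT x|gauss. (X a b m x + X b a m x) / 2 + N x * (p a m x * p b m x) - (\<eta> x * \<eta> x) * (c x * (p a m x * p b m x)))"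
      unfolding energy_def X_def gq gp N_def power2_norm_eq_inner
      by (intro Bochner_Integration.integral_cong)
         (auto simp: inner_add_left inner_add_right inner_commute field_simps)
    also have "\<dots> = ((LINT x|gauss. X a b m x) + (LINT x|gauss. X b a m x)) / 2
       + (LINT x|gauss. N x * (p a m x * p b m x)) - (LINT x|gauss. (\<eta> x * \<eta> x) * (c x * (p a m x * p b m x)))"
      using iX[of a b m] iX[of b a m] ints by simp
    finally show ?thesis by (simp add: X)
  qed
  have "(\<lambda>m. energy c (\<lambda>x. p a m x * \<eta> x) (\<lambda>x. p b m x * \<eta> x))
    \<longlonglongrightarrow> ((LINT x|gauss. (\<eta> x * \<eta> x) * ((c x * v a x - v a x) * v b x)) + (LINT x|gauss. (\<eta> x * \<eta> x) * ((c x * v b x - v b x) * v a x))) / 2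
       + (LINT x|gauss. N x * (v a x * v b x)) - (LINT x|gauss. (\<eta> x * \<eta> x) * (c x * (v a x * v b x)))"
    unfolding e
    by (intro tendsto_intros integral_lb_conv lbrp lbpp lbcpp N \<eta>\<eta>) auto
  also have "((LINT x|gauss. (\<eta> x * \<eta> x) * ((c x * v a x - v a x) * v b x)) + (LINT x|gauss. (\<eta> x * \<eta> x) * ((c x * v b x - v b x) * v a x))) / 2
       + (LINT x|gauss. N x * (v a x * v b x)) - (LINT x|gauss. (\<eta> x * \<eta> x) * (c x * (v a x * v b x)))
    = (LINT x|gauss. ((\<eta> x * \<eta> x) * ((c x * v a x - v a x) * v b x) + (\<eta> x * \<eta> x) * ((c x * v b x - v b x) * v a x)) / 2
       + N x * (v a x * v b x) - (\<eta> x * \<eta> x) * (c x * (v a x * v b x)))"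
  proof -
    have i: "integrable gauss (\<lambda>x. (\<eta> x * \<eta> x) * ((c x * v a x - v a x) * v b x))" for a b
      by (intro integrable_gauss ccs_mult \<eta>\<eta> continuous_intros continuous_c continuous_v)
    have i': "integrable gauss (\<lambda>x. (\<eta> x * \<eta> x) * (c x * (v a x * v b x)))"
      by (intro integrable_gauss ccs_mult \<eta>\<eta> continuous_intros continuous_c continuous_v)
    have i'': "integrable gauss (\<lambda>x. N x * (v a x * v b x))"
      by (intro integrable_gauss ccs_mult N continuous_intros continuous_v)
    show ?thesis using i[of a b] i[of b a] i' i'' by simp
  qed
  also have "\<dots> = (LINT x|gauss. v a x * v b x * ((norm (grad \<eta> x))\<^sup>2 - (\<eta> x)\<^sup>2))"
    by (intro Bochner_Integration.integral_cong) (auto simp: N_def field_simps power2_eq_square)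
  finally show ?thesis by (simp add: p_def)
qed

text \<open>Wherever \<open>\<phi>\<close> or its gradient is nonzero the cutoff is invisible, so
  the equation of the quotient can be tested with \<open>\<phi>\<close> itself; the potential
  cancels and \<open>- v a\<close> remains.\<close>

lemma energy_dq_test_tendsto:
  assumes \<eta>: "\<eta> \<in> C1c" and \<phi>: "\<phi> \<in> C1c"
    and one: "\<And>x. \<phi> x \<noteq> 0 \<or> grad \<phi> x \<noteq> 0 \<Longrightarrow> \<eta> x = 1 \<and> grad \<eta> x = 0"
  shows "(\<lambda>m. energy c (\<lambda>x. dq a m u x * \<eta> x) \<phi>) \<longlonglongrightarrow> - (LINT x|gauss. v a x * \<phi> x)"
proof -
  define p where "p m = dq a m u" for m
  have p: "p m \<in> C1" for m unfolding p_def by (intro C1_dq u_C1)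
  have \<phi>c: "ccs \<phi>" by (rule ccs_C1c[OF \<phi>])
  have lb: "lb_conv (\<lambda>m x. c x * p m x) (\<lambda>x. c x * v a x)"
    unfolding p_def by (intro lb_conv_mult lb_conv_v lb_conv_const continuous_c)
  have e: "energy c (\<lambda>x. p m x * \<eta> x) \<phi>
      = (LINT x|gauss. \<phi> x * dq_rhs a m x) - (LINT x|gauss. \<phi> x * (c x * p m x))" for m
  proof -
    have "grad (\<lambda>x. p m x * \<eta> x) x \<bullet> grad \<phi> x - c x * (p m x * \<eta> x) * \<phi> x
        = grad (p m) x \<bullet> grad \<phi> x - \<phi> x * (c x * p m x)" for x
      using one[of x] p C1c_C1[OF \<eta>] by (cases "\<phi> x \<noteq> 0 \<or> grad \<phi> x \<noteq> 0") (auto simp: grad_mult)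
    then have "energy c (\<lambda>x. p m x * \<eta> x) \<phi> = (LINT x|gauss. grad (p m) x \<bullet> grad \<phi> x - \<phi> x * (c x * p m x))"
      by (simp add: energy_def)
    also have "\<dots> = (LINT x|gauss. grad (p m) x \<bullet> grad \<phi> x) - (LINT x|gauss. \<phi> x * (c x * p m x))"
      by (intro Bochner_Integration.integral_diff integral_lb_conv(2)[OF lb \<phi>c]
          integrable_gauss ccs_inner' ccs_C1c \<phi> C1_grad_continuous p)
    finally show ?thesis using dq_equation[OF \<phi>, of a m] by (simp add: p_def mult.commute)
  qed
  have "(\<lambda>m. energy c (\<lambda>x. p m x * \<eta> x) \<phi>)
     \<longlonglongrightarrow> (LINT x|gauss. \<phi> x * (c x * v a x - v a x)) - (LINT x|gauss. \<phi> x * (c x * v a x))"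
    unfolding e by (intro tendsto_diff integral_lb_conv lb_conv_dq_rhs lb \<phi>c)
  also have "(LINT x|gauss. \<phi> x * (c x * v a x - v a x)) - (LINT x|gauss. \<phi> x * (c x * v a x))
      = (LINT x|gauss. \<phi> x * (c x * v a x - v a x) - \<phi> x * (c x * v a x))"
    by (intro Bochner_Integration.integral_diff[symmetric] integrable_gauss ccs_mult \<phi>c continuous_intros
        continuous_c continuous_v)
  also have "\<dots> = (LINT x|gauss. - (v a x * \<phi> x))"
    by (intro Bochner_Integration.integral_cong) (auto simp: algebra_simps)
  finally show ?thesis by (simp add: p_def)
qed

end

section \<open>Strong maximum principle\<close>

lemma pos_sq_sum_nonzero: "pos_sq t + pos_sq (1 - t) \<noteq> 0"
proof -
  have "pos_sq t > 0 \<or> pos_sq (1 - t) > 0"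
    using pos_sq_eq_0_iff[of t] pos_sq_eq_0_iff[of "1 - t"] pos_sq_nonneg[of t] pos_sq_nonneg[of "1 - t"]
    by linarith
  then show ?thesis using pos_sq_nonneg[of t] pos_sq_nonneg[of "1 - t"] by linarith
qed

lemma GDERIV_scale:
  assumes "GDERIV u (s *\<^sub>R x) :> D"
  shows "GDERIV (\<lambda>x. u (s *\<^sub>R x)) x :> s *\<^sub>R D"
proof -
  have "((\<lambda>x. u (s *\<^sub>R x)) has_derivative (\<lambda>h. (s *\<^sub>R h) \<bullet> D)) (at x)"
    using assms unfolding gderiv_def
    by (rule has_derivative_compose[rotated]) (auto intro!: derivative_eq_intros)
  then show ?thesis by (simp add: gderiv_def)
qed

text \<open>All cutoffs are dilates of a single one, which yields the slope bound
  \<open>C / R\<close> with a common \<open>C\<close>.\<close>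

lemma cutoff_family:
  shows "\<exists>C>0. \<forall>R>0. \<exists>\<eta>\<in>(C1c :: ('a::euclidean_space \<Rightarrow> real) set). (\<forall>x. 0 \<le> \<eta> x \<and> \<eta> x \<le> 1) \<and>
       (\<forall>x. norm x \<le> R \<longrightarrow> \<eta> x = 1) \<and> (\<forall>x. norm x < R \<longrightarrow> grad \<eta> x = 0) \<and> (\<forall>x. norm (grad \<eta> x) \<le> C / R)"
proof -
  \<comment> \<open>\<open>t x \<ge> 1\<close> on the unit ball and \<open>t x \<le> 0\<close>
    outside the ball of radius \<open>sqrt 2\<close>, so the quotient below falls from 1 to 0 in
    between.\<close>
  define t where "t x = 2 - x \<bullet> x" for x :: 'a
  define \<eta> where "\<eta> x = pos_sq (t x) / (pos_sq (t x) + pos_sq (1 - t x))" for x :: 'a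
  have "GDERIV t x :> - (2 *\<^sub>R x)" for x
    unfolding t_def gderiv_def by (auto intro!: derivative_eq_intros simp: inner_commute)
  then have t: "t \<in> C1" by (rule C1I) (auto intro!: continuous_intros)
  have \<eta>1: "\<eta> \<in> C1" unfolding \<eta>_def
    by (intro C1_divide C1_pos_sq C1_add C1_diff C1_const t pos_sq_sum_nonzero)
  have one: "\<eta> x = 1" if "norm x \<le> 1" for x
  proof -
    have "x \<bullet> x \<le> 1" using that by (simp add: norm_eq_sqrt_inner)
    then have "1 - t x \<le> 0" by (simp add: t_def)
    then have "pos_sq (1 - t x) = 0" by (rule pos_sq_0)
    then show ?thesis using pos_sq_sum_nonzero[of "t x"] by (simp add: \<eta>_def)
  qed
  have zero: "\<eta> x = 0" if "norm x \<ge> 2" for x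
  proof -
    have "(norm x)\<^sup>2 \<ge> 2\<^sup>2" using that by (intro power_mono) auto
    then have "t x \<le> 0" by (simp add: t_def power2_norm_eq_inner)
    then show ?thesis by (simp add: \<eta>_def pos_sq_0)
  qed
  have range: "0 \<le> \<eta> x" "\<eta> x \<le> 1" for x
    using pos_sq_nonneg[of "t x"] pos_sq_nonneg[of "1 - t x"] pos_sq_sum_nonzero[of "t x"]
    by (auto simp: \<eta>_def divide_le_eq)
  have \<eta>c: "\<eta> \<in> C1c" using C1cI[OF \<eta>1 zero] .
  obtain C where C: "C > 0" "\<And>x. norm (grad \<eta> x) \<le> C"
    using ccs_bounded[OF ccs_C1c(2)[OF \<eta>c]] by metis
  have "\<exists>\<zeta>\<in>(C1c :: ('a \<Rightarrow> real) set). (\<forall>x. 0 \<le> \<zeta> x \<and> \<zeta> x \<le> 1) \<and>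
       (\<forall>x. norm x \<le> R \<longrightarrow> \<zeta> x = 1) \<and> (\<forall>x. norm x < R \<longrightarrow> grad \<zeta> x = 0) \<and> (\<forall>x. norm (grad \<zeta> x) \<le> C / R)"
    if "R > 0" for R
  proof -
    define \<zeta> where "\<zeta> x = \<eta> ((1 / R) *\<^sub>R x)" for x
    have g: "GDERIV \<zeta> x :> (1 / R) *\<^sub>R grad \<eta> ((1 / R) *\<^sub>R x)" for x
      unfolding \<zeta>_def by (rule GDERIV_scale[OF C1_GDERIV[OF \<eta>1]])
    have "\<zeta> \<in> C1"
      by (rule C1I[OF g]) (auto intro!: continuous_intros continuous_on_compose2[OF C1_grad_continuous[OF \<eta>1]])
    then have "\<zeta> \<in> C1c"
      by (rule C1cI[of _ "2 * R"]) (use that in \<open>auto simp: \<zeta>_def field_simps intro!: zero\<close>)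
    moreover have one': "\<zeta> x = 1" if "norm x \<le> R" for x
      unfolding \<zeta>_def using that \<open>R > 0\<close> by (intro one) auto
    moreover have "grad \<zeta> x = 0" if "norm x < R" for x
      by (rule grad_locally_constant[of "ball 0 R" _ _ 1]) (use that one' in auto)
    moreover have "norm (grad \<zeta> x) \<le> C / R" for x
      using that C(2)[of "(1 / R) *\<^sub>R x"] by (simp add: grad_eqI[OF g] divide_right_mono)
    moreover have "0 \<le> \<zeta> x \<and> \<zeta> x \<le> 1" for x using range by (simp add: \<zeta>_def)
    ultimately show ?thesis by - (rule bexI[of _ \<zeta>], simp_all)
  qed
  with C(1) show ?thesis by blast
qed

section \<open>The regularized distance and its kernels\<close>

text \<open>A substitute for the distance to \<open>y\<close> that is positive and C1 at
  \<open>y\<close> too, so that powers with negative exponents can be used in test functions, at the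
  price of error terms proportional to \<open>\<epsilon>\<close>.\<close>

definition reg_dist :: "'a::euclidean_space \<Rightarrow> real \<Rightarrow> 'a \<Rightarrow> real" where
  "reg_dist y \<epsilon> x = sqrt ((x - y) \<bullet> (x - y) + \<epsilon>)"

lemma reg_dist_sq: "\<epsilon> > 0 \<Longrightarrow> (reg_dist y \<epsilon> x)\<^sup>2 = (x - y) \<bullet> (x - y) + \<epsilon>"
  unfolding reg_dist_def by (intro real_sqrt_pow2) (simp add: add_nonneg_nonneg)

lemma reg_dist_pos: "\<epsilon> > 0 \<Longrightarrow> reg_dist y \<epsilon> x > 0"
  unfolding reg_dist_def by (simp add: add_nonneg_pos)

lemma reg_dist_lower: "\<epsilon> > 0 \<Longrightarrow> reg_dist y \<epsilon> x \<ge> sqrt \<epsilon>"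
  unfolding reg_dist_def by simp

lemma norm_le_reg_dist: "\<epsilon> > 0 \<Longrightarrow> norm (x - y) \<le> reg_dist y \<epsilon> x"
  unfolding reg_dist_def norm_eq_sqrt_inner by simp

lemma GDERIV_reg_dist:
  assumes "\<epsilon> > 0"
  shows "GDERIV (reg_dist y \<epsilon>) x :> (1 / reg_dist y \<epsilon> x) *\<^sub>R (x - y)"
proof -
  define s where "s x = (x - y) \<bullet> (x - y) + \<epsilon>" for x
  have s: "s x > 0" for x using assms by (simp add: s_def add_nonneg_pos)
  have "GDERIV s x :> 2 *\<^sub>R (x - y)"
    unfolding s_def gderiv_def by (auto intro!: derivative_eq_intros simp: inner_commute)
  then have "GDERIV (\<lambda>x. sqrt (s x)) x :> (inverse (sqrt (s x)) / 2) *\<^sub>R (2 *\<^sub>R (x - y))"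
    by (rule GDERIV_DERIV_compose[of s x _ sqrt, OF _ DERIV_real_sqrt[OF s]])
  then show ?thesis
    by (simp add: reg_dist_def[abs_def] s_def inverse_eq_divide)
qed

lemma C1_reg_dist: "\<epsilon> > 0 \<Longrightarrow> reg_dist y \<epsilon> \<in> C1"
proof (rule C1I[OF GDERIV_reg_dist])
  assume "\<epsilon> > 0"
  then have "reg_dist y \<epsilon> x \<noteq> 0" for x using reg_dist_pos[of \<epsilon> y x] by simp
  moreover have "continuous_on UNIV (reg_dist y \<epsilon>)"
    unfolding reg_dist_def by (intro continuous_intros)
  ultimately show "continuous_on UNIV (\<lambda>x. (1 / reg_dist y \<epsilon> x) *\<^sub>R (x - y))"
    by (intro continuous_intros) auto
qed

lemma grad_reg_dist: "\<epsilon> > 0 \<Longrightarrow> grad (reg_dist y \<epsilon>) x = (1 / reg_dist y \<epsilon> x) *\<^sub>R (x - y)"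
  by (rule grad_eqI) (rule GDERIV_reg_dist)

lemma DERIV_inverse_power:
  fixes t :: real
  assumes "t \<noteq> 0"
  shows "DERIV (\<lambda>t. 1 / t ^ N) t :> - real N / t ^ (N + 1)"
proof -
  have "DERIV (\<lambda>t. inverse (t ^ N)) t :> - (real N * t ^ (N - Suc 0) * inverse ((t ^ N) ^ Suc (Suc 0)))"
    using assms by (intro DERIV_inverse_fun DERIV_pow) simp
  moreover have "- (real N * t ^ (N - Suc 0) * inverse ((t ^ N) ^ Suc (Suc 0))) = - real N / t ^ (N + 1)"
    using assms by (cases N) (simp_all add: field_simps)
  ultimately show ?thesis by (simp add: inverse_eq_divide)
qed

text \<open>The kernels \<open>\<epsilon> \<tau>\<^sup>-\<^sup>n\<^sup>-\<^sup>2\<close>, where \<open>\<tau>\<close> is \<^const>\<open>reg_dist\<close>, have bounded mass as \<open>\<epsilon> \<rightarrow> 0\<close>, because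
  \<open>n \<epsilon> \<tau>\<^sup>-\<^sup>n\<^sup>-\<^sup>2\<close> is the divergence of \<open>\<tau>\<^sup>-\<^sup>n (x - y)\<close>.\<close>

lemma reg_dist_kernel_mass:
  fixes y :: "'a::euclidean_space"
  defines "N \<equiv> DIM('a)"
  assumes \<eta>: "\<eta> \<in> C1c" and flat: "\<And>x. norm (x - y) < 1 \<Longrightarrow> grad \<eta> x = 0" and nonneg: "\<And>x. 0 \<le> \<eta> x"
  obtains C where "C \<ge> 0" "\<And>\<epsilon>. \<epsilon> > 0 \<Longrightarrow> (LINT x|gauss. \<eta> x * (\<epsilon> / reg_dist y \<epsilon> x ^ (N + 2))) \<le> C"
proof -
  have N: "real N \<ge> 1" unfolding N_def using DIM_positive[where 'a='a] by linarith
  have \<eta>1: "\<eta> \<in> C1" by (rule C1c_C1[OF \<eta>])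
  \<comment> \<open>The bound involves \<open>\<eta>\<close> only where its gradient is nonzero;
    there the distance to \<open>y\<close> is at least 1, so the power of \<open>\<tau>\<close> is
    at most 1 and \<open>C\<close> does not depend on \<open>\<epsilon>\<close>.\<close>
  define C where "C = (LINT x|lborel. \<bar>(x - y) \<bullet> grad \<eta> x\<bar>)"
  have "(LINT x|gauss. \<eta> x * (\<epsilon> / reg_dist y \<epsilon> x ^ (N + 2))) \<le> C" if \<epsilon>: "\<epsilon> > 0" for \<epsilon>
  proof -
    define \<tau> where "\<tau> = reg_dist y \<epsilon>"
    have \<tau>: "\<tau> x > 0" "\<tau> x \<noteq> 0" "(x - y) \<bullet> (x - y) = (\<tau> x)\<^sup>2 - \<epsilon>" "norm (x - y) \<le> \<tau> x" for x
      using reg_dist_pos[OF \<epsilon>, of y x] reg_dist_sq[OF \<epsilon>, of y x] norm_le_reg_dist[OF \<epsilon>]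
      by (auto simp: \<tau>_def)
    have \<tau>1: "\<tau> \<in> C1" and g\<tau>: "grad \<tau> x = (1 / \<tau> x) *\<^sub>R (x - y)" for x
      using C1_reg_dist[OF \<epsilon>] grad_reg_dist[OF \<epsilon>] by (auto simp: \<tau>_def)
    have dp: "DERIV (\<lambda>t. 1 / t ^ N) (\<tau> x) :> - real N / \<tau> x ^ (N + 1)" for x
      using \<tau>(2) by (rule DERIV_inverse_power)
    define p where "p x = 1 / \<tau> x ^ N" for x
    have p1: "p \<in> C1" unfolding p_def
      by (rule C1_compose[OF \<tau>1 dp]) (use \<tau>(2) in \<open>auto intro!: continuous_intros\<close>)
    have gp: "grad p x = (- real N / \<tau> x ^ (N + 2)) *\<^sub>R (x - y)" for x
      unfolding p_def by (subst grad_compose[OF \<tau>1 dp]) (simp add: g\<tau>)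
    define k where "k x = \<epsilon> / \<tau> x ^ (N + 2)" for x
    have kc: "continuous_on UNIV k" unfolding k_def
      by (intro continuous_intros C1_continuous \<tau>1) (use \<tau>(2) in auto)
    have k0: "k x \<ge> 0" for x using \<tau>(1)[of x] \<epsilon> by (simp add: k_def)
    have "real N * (\<eta> x * p x) + (x - y) \<bullet> grad (\<lambda>x. \<eta> x * p x) x
        = real N * (\<eta> x * k x) + p x * ((x - y) \<bullet> grad \<eta> x)" for x
    proof -
      have "p x = (\<tau> x)\<^sup>2 / \<tau> x ^ (N + 2)" using \<tau>(2)[of x] by (simp add: p_def power2_eq_square)
      then have "real N * p x - real N / \<tau> x ^ (N + 2) * ((\<tau> x)\<^sup>2 - \<epsilon>) = real N * k x"
        unfolding k_def by (simp add: diff_divide_distrib right_diff_distrib)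
      then have "real N * (\<eta> x * p x) - \<eta> x * (real N / \<tau> x ^ (N + 2) * ((\<tau> x)\<^sup>2 - \<epsilon>)) = real N * (\<eta> x * k x)"
        by algebra
      moreover have "(x - y) \<bullet> grad (\<lambda>x. \<eta> x * p x) x
          = \<eta> x * (- real N / \<tau> x ^ (N + 2) * ((\<tau> x)\<^sup>2 - \<epsilon>)) + p x * ((x - y) \<bullet> grad \<eta> x)"
        unfolding grad_mult[OF \<eta>1 p1] gp inner_add_right inner_scaleR_right \<tau>(3) ..
      ultimately show ?thesis by simp
    qed
    then have "(LINT x|lborel. real N * (\<eta> x * k x) + p x * ((x - y) \<bullet> grad \<eta> x)) = 0"
      using dilation_identity[of "\<lambda>x. \<eta> x * p x" y] C1c_mult[OF \<eta> p1] by (simp add: N_def)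
    moreover have ik: "integrable lborel (\<lambda>x. \<eta> x * k x)"
      by (intro ccs_integrable ccs_mult ccs_C1c \<eta> kc)
    moreover have cg: "ccs (\<lambda>x. (x - y) \<bullet> grad \<eta> x)"
      by (intro ccs_inner' ccs_C1c \<eta> continuous_intros)
    then have ig: "integrable lborel (\<lambda>x. p x * ((x - y) \<bullet> grad \<eta> x))"
      by (intro ccs_integrable ccs_mult' C1_continuous p1)
    ultimately have "real N * (LINT x|lborel. \<eta> x * k x) = - (LINT x|lborel. p x * ((x - y) \<bullet> grad \<eta> x))"
      by simp
    also have "\<dots> \<le> \<bar>LINT x|lborel. p x * ((x - y) \<bullet> grad \<eta> x)\<bar>" by simp
    also have "\<dots> \<le> (LINT x|lborel. \<bar>p x * ((x - y) \<bullet> grad \<eta> x)\<bar>)"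
      by (rule integral_abs_bound)
    also have "\<dots> \<le> C" unfolding C_def
    proof (rule integral_mono)
      show "integrable lborel (\<lambda>x. \<bar>p x * ((x - y) \<bullet> grad \<eta> x)\<bar>)" "integrable lborel (\<lambda>x. \<bar>(x - y) \<bullet> grad \<eta> x\<bar>)"
        using ig ccs_integrable[OF cg] by auto
      show "\<bar>p x * ((x - y) \<bullet> grad \<eta> x)\<bar> \<le> \<bar>(x - y) \<bullet> grad \<eta> x\<bar>" for x
      proof (cases "norm (x - y) < 1")
        case False
        then have "\<tau> x \<ge> 1" using \<tau>(4)[of x] by linarith
        then have "p x \<le> 1" "p x \<ge> 0" by (auto simp: p_def)
        then show ?thesis by (simp add: abs_mult mult_left_le_one_le)
      qed (simp add: flat)
    qed
    finally have "real N * (LINT x|lborel. \<eta> x * k x) \<le> C" .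
    moreover have "(LINT x|lborel. \<eta> x * k x) \<ge> 0"
      by (intro Bochner_Integration.integral_nonneg mult_nonneg_nonneg nonneg k0)
    moreover have "1 * (LINT x|lborel. \<eta> x * k x) \<le> real N * (LINT x|lborel. \<eta> x * k x)"
      using N calculation(2) by (rule mult_right_mono)
    ultimately have "(LINT x|lborel. \<eta> x * k x) \<le> C" by linarith
    moreover have "(LINT x|gauss. \<eta> x * k x) \<le> (LINT x|lborel. \<eta> x * k x)"
    proof -
      have c: "ccs (\<lambda>x. \<eta> x * k x)" by (intro ccs_mult ccs_C1c \<eta> kc)
      have "(LINT x|gauss. \<eta> x * k x) = (LINT x|lborel. exp (- (norm x)\<^sup>2 / 2) *\<^sub>R (\<eta> x * k x))"
        by (rule integral_gauss[OF ccs_measurable[OF c]])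
      also have "\<dots> \<le> (LINT x|lborel. \<eta> x * k x)"
      proof (rule integral_mono)
        show "integrable lborel (\<lambda>x. exp (- (norm x)\<^sup>2 / 2) *\<^sub>R (\<eta> x * k x))"
          by (intro ccs_integrable ccs_scaleR c continuous_intros) auto
        show "exp (- (norm x)\<^sup>2 / 2) *\<^sub>R (\<eta> x * k x) \<le> \<eta> x * k x" for x
          using nonneg[of x] k0[of x] by (simp add: mult_left_le_one_le)
      qed (rule ik)
      finally show ?thesis .
    qed
    ultimately show ?thesis by (simp add: k_def \<tau>_def)
  qed
  moreover have "C \<ge> 0" unfolding C_def by (rule Bochner_Integration.integral_nonneg) simp
  ultimately show ?thesis using that by blast
qed

text \<open>The kernels concentrate at \<open>y\<close>. Near \<open>y\<close> the function
  \<open>w\<close> is small and the mass is bounded; away from \<open>y\<close> the kernel itself is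
  of order \<open>\<epsilon>\<close>.\<close>

lemma reg_dist_kernel_tendsto_0:
  fixes y :: "'a::euclidean_space" and w :: "'a \<Rightarrow> real"
  defines "N \<equiv> DIM('a)"
  assumes \<eta>: "\<eta> \<in> C1c" and flat: "\<And>x. norm (x - y) < 1 \<Longrightarrow> grad \<eta> x = 0" and nonneg: "\<And>x. 0 \<le> \<eta> x"
    and w: "continuous_on UNIV w" "\<And>x. 0 \<le> w x" "w y = 0" and "e > 0"
  obtains \<epsilon>0 where "\<epsilon>0 > 0"
    "\<And>\<epsilon>. 0 < \<epsilon> \<Longrightarrow> \<epsilon> \<le> \<epsilon>0 \<Longrightarrow> (LINT x|gauss. w x * (\<eta> x * (\<epsilon> / reg_dist y \<epsilon> x ^ (N + 2)))) \<le> e"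
proof -
  obtain C where C: "C \<ge> 0"
    "\<And>\<epsilon>. \<epsilon> > 0 \<Longrightarrow> (LINT x|gauss. \<eta> x * (\<epsilon> / reg_dist y \<epsilon> x ^ (N + 2))) \<le> C"
    using reg_dist_kernel_mass[OF \<eta> flat nonneg] unfolding N_def by metis
  define d where "d = e / (2 * (C + 1))"
  have d: "d > 0" "d * C \<le> e / 2"
    using C(1) \<open>e > 0\<close> by (auto simp: d_def field_simps)
  have "isCont w y" using w(1) by (simp add: continuous_on_eq_continuous_at)
  then obtain s where s: "s > 0" "\<And>x. dist x y < s \<Longrightarrow> dist (w x) (w y) < d"
    using d(1) unfolding continuous_at_eps_delta by blast
  have wd: "w x \<le> d" if "norm (x - y) < s" for x
    using s(2)[of x] that w by (simp add: dist_norm)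
  define I where "I = (LINT x|gauss. w x * \<eta> x)"
  have I0: "I \<ge> 0" unfolding I_def by (intro Bochner_Integration.integral_nonneg mult_nonneg_nonneg nonneg w)
  \<comment> \<open>At distance at least \<open>s\<close> the kernel is at most
    \<open>\<epsilon> / s ^ (N + 2)\<close>, so this choice makes the far part at most
    \<open>e / 2\<close>; the summand 1 guards against \<open>I = 0\<close>.\<close>
  define \<epsilon>0 where "\<epsilon>0 = e / 2 * s ^ (N + 2) / (I + 1)"
  have "\<epsilon>0 > 0" using \<open>e > 0\<close> s(1) I0 by (simp add: \<epsilon>0_def)
  moreover have "(LINT x|gauss. w x * (\<eta> x * (\<epsilon> / reg_dist y \<epsilon> x ^ (N + 2)))) \<le> e"
    if \<epsilon>: "0 < \<epsilon>" "\<epsilon> \<le> \<epsilon>0" for \<epsilon>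
  proof -
    define k where "k x = \<epsilon> / reg_dist y \<epsilon> x ^ (N + 2)" for x
    have "reg_dist y \<epsilon> x \<noteq> 0" for x using reg_dist_pos[OF \<epsilon>(1), of y x] by simp
    then have kc: "continuous_on UNIV k" unfolding k_def
      by (intro continuous_intros C1_continuous C1_reg_dist \<epsilon>) auto
    have k0: "k x \<ge> 0" for x using reg_dist_pos[OF \<epsilon>(1), of y x] \<epsilon> by (simp add: k_def)
    have c1: "ccs (\<lambda>x. w x * (\<eta> x * k x))" by (intro ccs_mult ccs_mult' ccs_C1c \<eta> kc w)
    have c2: "ccs (\<lambda>x. \<eta> x * k x)" by (intro ccs_mult ccs_C1c \<eta> kc)
    have c3: "ccs (\<lambda>x. w x * \<eta> x)" by (intro ccs_mult' ccs_C1c \<eta> w)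
    have le: "w x * (\<eta> x * k x) \<le> d * (\<eta> x * k x) + \<epsilon> / s ^ (N + 2) * (w x * \<eta> x)" for x
    proof (cases "norm (x - y) < s")
      case True
      have "w x * (\<eta> x * k x) \<le> d * (\<eta> x * k x)"
        using wd[OF True] nonneg[of x] k0[of x] by (intro mult_right_mono) auto
      moreover have "\<epsilon> / s ^ (N + 2) * (w x * \<eta> x) \<ge> 0" using \<epsilon> s nonneg w by simp
      ultimately show ?thesis by linarith
    next
      case False
      then have "s \<le> reg_dist y \<epsilon> x" using norm_le_reg_dist[OF \<epsilon>(1), of x y] by linarith
      then have "k x \<le> \<epsilon> / s ^ (N + 2)"
        unfolding k_def using \<epsilon> s by (intro divide_left_mono power_mono mult_pos_pos zero_less_power) auto
      then have "k x * (w x * \<eta> x) \<le> \<epsilon> / s ^ (N + 2) * (w x * \<eta> x)"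
        using nonneg w by (intro mult_right_mono) auto
      moreover have "d * (\<eta> x * k x) \<ge> 0" using d nonneg k0 by simp
      ultimately show ?thesis by (simp add: mult_ac)
    qed
    have "(LINT x|gauss. w x * (\<eta> x * k x)) \<le> (LINT x|gauss. d * (\<eta> x * k x) + \<epsilon> / s ^ (N + 2) * (w x * \<eta> x))"
      using integrable_gauss[OF c1] integrable_gauss[OF c2] integrable_gauss[OF c3] le
      by (intro integral_mono) auto
    also have "\<dots> = d * (LINT x|gauss. \<eta> x * k x) + \<epsilon> / s ^ (N + 2) * I"
      using integrable_gauss[OF c2] integrable_gauss[OF c3] by (simp add: I_def)
    also have "\<dots> \<le> d * C + e / 2"
    proof (rule add_mono)
      show "d * (LINT x|gauss. \<eta> x * k x) \<le> d * C"
        using C(2)[OF \<epsilon>(1)] d by (simp add: k_def)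
      have "\<epsilon> * (I + 1) \<le> e / 2 * s ^ (N + 2)"
        using \<epsilon>(2) I0 by (simp add: \<epsilon>0_def field_simps)
      moreover have "\<epsilon> * I \<le> \<epsilon> * (I + 1)" using \<epsilon> by simp
      ultimately have "\<epsilon> * I \<le> e / 2 * s ^ (N + 2)" by linarith
      then show "\<epsilon> / s ^ (N + 2) * I \<le> e / 2" using s(1) by (simp add: field_simps)
    qed
    also have "\<dots> \<le> e" using d by simp
    finally show ?thesis by (simp add: k_def)
  qed
  ultimately show ?thesis using that by blast
qed


text \<open>The barrier is radial around \<open>y\<close>: with \<open>\<tau>\<close> the function \<^const>\<open>reg_dist\<close>, it satisfies
  \<open>\<nabla>\<psi> = - \<tau>\<^sup>-\<^sup>n (T - \<tau>)\<^sub>+\<^sup>2 (x - y)\<close>. The factor \<open>(T - \<tau>)\<^sub>+\<^sup>2\<close> makes \<open>\<Delta>\<psi>\<close> so positive away from \<open>y\<close> that for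
  small \<open>T\<close> it absorbs the drift and the zeroth order term.\<close>

lemma barrier:
  fixes y :: "'a::euclidean_space"
  defines "N \<equiv> DIM('a)"
  assumes T: "0 < T" "T \<le> 1" "(norm y + 1) * T + M * T\<^sup>2 \<le> 1" and M: "0 \<le> M" and \<epsilon>: "0 < \<epsilon>"
  obtains \<psi> \<theta> where "\<psi> \<in> C1c" "\<theta> \<in> C1c" "\<And>x. 0 \<le> \<psi> x" "\<And>x. grad \<psi> x = - (\<theta> x *\<^sub>R (x - y))"
    "\<And>x. real N * \<theta> x + (x - y) \<bullet> grad \<theta> x - \<theta> x * (x \<bullet> (x - y)) + M * \<psi> x
       \<le> - (max 0 (T - reg_dist y \<epsilon> x) / reg_dist y \<epsilon> x ^ (N - 1))
          + (if reg_dist y \<epsilon> x < T then (real N + 2) * (\<epsilon> / reg_dist y \<epsilon> x ^ (N + 2)) else 0)"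
proof -
  obtain n where n: "N = Suc n"
    unfolding N_def using DIM_positive[where 'a='a] gr0_implies_Suc by blast
  define \<tau> where "\<tau> = reg_dist y \<epsilon>"
  have \<tau>: "\<tau> x > 0" "\<tau> x \<noteq> 0" "(x - y) \<bullet> (x - y) = (\<tau> x)\<^sup>2 - \<epsilon>" "norm (x - y) \<le> \<tau> x" "sqrt \<epsilon> \<le> \<tau> x" for x
    using reg_dist_pos[OF \<epsilon>, of y x] reg_dist_sq[OF \<epsilon>, of y x] norm_le_reg_dist[OF \<epsilon>] reg_dist_lower[OF \<epsilon>]
    by (auto simp: \<tau>_def)
  have \<tau>1: "\<tau> \<in> C1" and g\<tau>: "grad \<tau> x = (1 / \<tau> x) *\<^sub>R (x - y)" for x
    using C1_reg_dist[OF \<epsilon>] grad_reg_dist[OF \<epsilon>] by (auto simp: \<tau>_def)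
  define K where "K t = pos_sq (T - t) * (1 / t ^ N)" for t
  define K' where "K' t = pos_sq (T - t) * (- real N / t ^ (N + 1)) + (- (2 * max 0 (T - t))) * (1 / t ^ N)" for t
  have DK: "DERIV K t :> K' t" if "t \<noteq> 0" for t
  proof -
    have "DERIV (\<lambda>t. pos_sq (T - t)) t :> 2 * max 0 (T - t) * (0 - 1)"
      by (rule DERIV_chain2[OF DERIV_pos_sq]) (auto intro!: derivative_eq_intros)
    then have "DERIV (\<lambda>t. pos_sq (T - t)) t :> - (2 * max 0 (T - t))" by simp
    from DERIV_mult'[OF this DERIV_inverse_power[OF that]] show ?thesis
      by (simp add: K_def[abs_def] K'_def)
  qed
  have K'c: "continuous_on {0<..} K'"
    unfolding K'_def by (intro continuous_intros continuous_on_compose2[OF continuous_pos_sq[of UNIV]]) auto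
  define \<theta> where "\<theta> x = K (\<tau> x)" for x
  have \<theta>1: "\<theta> \<in> C1"
    unfolding \<theta>_def
    by (rule C1_compose[OF \<tau>1 DK]) (use \<tau> in \<open>auto intro: continuous_on_subset[OF K'c]\<close>)
  have g\<theta>: "grad \<theta> x = (K' (\<tau> x) / \<tau> x) *\<^sub>R (x - y)" for x
    unfolding \<theta>_def using \<tau>(2) by (subst grad_compose[OF \<tau>1 DK]) (auto simp: g\<tau>)
  \<comment> \<open>\<open>- \<kappa>\<close> is the derivative of the barrier as a function of
    \<open>\<tau>\<close>. Since \<open>\<nabla>\<tau> = (x - y) / \<tau>\<close>, this gives
    \<open>\<theta> = \<kappa> (\<tau>) / \<tau>\<close>.\<close>
  define \<kappa> where "\<kappa> t = pos_sq (T - t) * (1 / t ^ n)" for t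
  have \<kappa>c: "continuous_on S \<kappa>" if "\<And>t. t \<in> S \<Longrightarrow> t > 0" for S
    unfolding \<kappa>_def
    by (intro continuous_intros continuous_on_compose2[OF continuous_pos_sq[of UNIV]]) (use that in force)+
  \<comment> \<open>All values of \<open>\<tau>\<close> are at least \<open>sqrt \<epsilon>\<close>,
    hence strictly above \<open>a\<close>: integrals from \<open>a\<close> avoid the singularity of
    \<open>\<kappa>\<close> at 0, and \<open>G\<close> is differentiable at every
    \<open>\<tau> x\<close>.\<close>
  define a where "a = sqrt \<epsilon> / 2"
  have "sqrt \<epsilon> > 0" using \<epsilon> by simp
  then have a: "a > 0" "a < \<tau> x" for x using \<tau>(5)[of x] unfolding a_def by linarith+
  \<comment> \<open>The integral of \<open>\<kappa>\<close> from \<open>t\<close> to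
    \<open>T\<close>, written as a difference so that it makes sense for \<open>t > T\<close> as
    well, where \<open>\<kappa>\<close> vanishes. If \<open>T < a\<close>, the first integral is
    over the empty set and equals 0.\<close>
  define G where "G t = integral {a..T} \<kappa> - integral {a..t} \<kappa>" for t
  have DG: "DERIV G t :> - \<kappa> t" if "t > a" for t
  proof -
    have "((\<lambda>x. integral {a..x} \<kappa>) has_real_derivative \<kappa> t) (at t within {a..t + 1})"
      using that a(1) by (intro integral_has_real_derivative \<kappa>c) auto
    then have "DERIV (\<lambda>x. integral {a..x} \<kappa>) t :> \<kappa> t"
      using that by (subst (asm) at_within_Icc_at) auto
    then show ?thesis unfolding G_def by (auto intro!: derivative_eq_intros)
  qed
  have G_T: "G T = 0" by (simp add: G_def)
  have \<kappa>0: "\<kappa> t \<ge> 0" if "t > 0" for t using that by (simp add: \<kappa>_def pos_sq_nonneg)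
  have \<kappa>_zero: "\<kappa> t = 0" if "t \<ge> T" for t using that by (simp add: \<kappa>_def pos_sq_0)
  have G_upper: "G t = 0" if "t \<ge> T" "t > a" for t
  proof (cases "t = T")
    case False
    then have "T < t" using that by simp
    show ?thesis
    proof (cases "T > a")
      case True
      obtain z where "T < z" "z < t" "G t - G T = (t - T) * - \<kappa> z"
        using MVT2[OF \<open>T < t\<close>, of G "\<lambda>t. - \<kappa> t"] DG True by force
      then show ?thesis using \<kappa>_zero[of z] G_T by simp
    next
      case False
      have "integral {a..t} \<kappa> = integral {a..t} (\<lambda>_. 0)"
        using False by (intro integral_cong) (auto intro: \<kappa>_zero)
      moreover have "integral {a..T} \<kappa> = 0" using False by (cases "T = a") auto
      ultimately show ?thesis by (simp add: G_def)
    qed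
  qed (simp add: G_T)
  \<comment> \<open>The third power of \<open>T - t\<close> exceeds that of the expected gain
    \<open>(T - t) / t ^ n\<close> by two, so the zeroth order term is negligible for small
    \<open>T\<close>.\<close>
  have G_bounds: "0 \<le> G t \<and> G t \<le> (T - t) ^ 3 / t ^ n" if t: "a < t" "t < T" for t
  proof -
    obtain z where z: "t < z" "z < T" "G T - G t = (T - t) * - \<kappa> z"
      using MVT2[OF t(2), of G "\<lambda>t. - \<kappa> t"] DG t by force
    have t0: "t > 0" using t a by linarith
    have "\<kappa> z \<le> (T - t)\<^sup>2 / t ^ n"
    proof -
      have "pos_sq (T - z) \<le> (T - t)\<^sup>2" unfolding pos_sq_def using z by (intro power_mono) auto
      moreover have "1 / z ^ n \<le> 1 / t ^ n" using z t0 by (intro divide_left_mono power_mono mult_pos_pos) auto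
      ultimately have "\<kappa> z \<le> (T - t)\<^sup>2 * (1 / t ^ n)"
        unfolding \<kappa>_def using z t0 by (intro mult_mono pos_sq_nonneg) auto
      then show ?thesis by simp
    qed
    then have "(T - t) * \<kappa> z \<le> (T - t) * ((T - t)\<^sup>2 / t ^ n)" using that by (intro mult_left_mono) auto
    moreover have "0 \<le> (T - t) * \<kappa> z" using \<kappa>0[of z] z t0 that by simp
    moreover have "G t = (T - t) * \<kappa> z" using z G_T by simp
    ultimately show ?thesis by (simp add: power2_eq_square power3_eq_cube)
  qed
  define \<psi> where "\<psi> x = G (\<tau> x)" for x
  have \<psi>1: "\<psi> \<in> C1"
    unfolding \<psi>_def
    by (rule C1_compose[OF \<tau>1 DG[OF a(2)]]) (use \<tau>(1) in \<open>auto intro!: continuous_intros \<kappa>c\<close>)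
  have g\<psi>: "grad \<psi> x = - (\<theta> x *\<^sub>R (x - y))" for x
  proof -
    have "\<theta> x = \<kappa> (\<tau> x) / \<tau> x" by (simp add: \<theta>_def K_def \<kappa>_def n)
    then show ?thesis
      unfolding \<psi>_def by (subst grad_compose[OF \<tau>1 DG[OF a(2)]]) (simp add: g\<tau>)
  qed
  have far: "\<psi> x = 0" "\<theta> x = 0" if "norm x \<ge> norm y + T" for x
  proof -
    have "\<tau> x \<ge> T" using that \<tau>(4)[of x] norm_triangle_ineq2[of x y] by linarith
    then show "\<psi> x = 0" "\<theta> x = 0" using G_upper a(2) by (auto simp: \<psi>_def \<theta>_def K_def pos_sq_0)
  qed
  show thesis
  proof
    show "\<psi> \<in> C1c" using C1cI[OF \<psi>1 far(1)] .
    show "\<theta> \<in> C1c" using C1cI[OF \<theta>1 far(2)] .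
    show "grad \<psi> x = - (\<theta> x *\<^sub>R (x - y))" for x by (rule g\<psi>)
    show "0 \<le> \<psi> x" for x
      unfolding \<psi>_def using G_upper[of "\<tau> x"] G_bounds[of "\<tau> x"] a(2)[of x] by (cases "\<tau> x < T") auto
    show "real N * \<theta> x + (x - y) \<bullet> grad \<theta> x - \<theta> x * (x \<bullet> (x - y)) + M * \<psi> x
       \<le> - (max 0 (T - reg_dist y \<epsilon> x) / reg_dist y \<epsilon> x ^ (N - 1))
          + (if reg_dist y \<epsilon> x < T then (real N + 2) * (\<epsilon> / reg_dist y \<epsilon> x ^ (N + 2)) else 0)" for x
      unfolding \<tau>_def[symmetric]
    proof (cases "\<tau> x < T")
      case False
      then have "\<theta> x = 0" "\<psi> x = 0" "K' (\<tau> x) = 0"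
        using G_upper[of "\<tau> x"] a(2)[of x] by (auto simp: \<theta>_def K_def K'_def \<psi>_def pos_sq_0)
      then show "real N * \<theta> x + (x - y) \<bullet> grad \<theta> x - \<theta> x * (x \<bullet> (x - y)) + M * \<psi> x
       \<le> - (max 0 (T - \<tau> x) / \<tau> x ^ (N - 1)) + (if \<tau> x < T then (real N + 2) * (\<epsilon> / \<tau> x ^ (N + 2)) else 0)"
        using False by (simp add: g\<theta>)
    next
      case True
      define t where "t = \<tau> x"
      define s where "s = T - t"
      define q where "q = t ^ n"
      have t: "0 < t" "t < T" "a < t" using True \<tau>(1)[of x] a(2)[of x] by (auto simp: t_def)
      have s: "0 < s" "s \<le> T" "s \<le> 1" using t T by (auto simp: s_def)
      have q: "q > 0" using t by (simp add: q_def)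
      have th: "\<theta> x = s\<^sup>2 / (q * t)"
        using t by (simp add: \<theta>_def K_def t_def[symmetric] n q_def s_def pos_sq_def mult.commute)
      have gth: "(x - y) \<bullet> grad \<theta> x = (- real N * s\<^sup>2 / (q * t\<^sup>2) - 2 * s / (q * t)) / t * (t\<^sup>2 - \<epsilon>)"
        using t
        by (simp add: g\<theta> \<tau>(3) t_def[symmetric] K'_def n q_def s_def pos_sq_def power2_eq_square mult_ac,
            auto simp: field_simps)
      have ps: "\<psi> x \<le> s ^ 3 / q"
        using G_bounds[OF t(3,2)] by (simp add: \<psi>_def t_def[symmetric] s_def q_def)
      have "norm x \<le> norm y + 1"
        using \<tau>(4)[of x] norm_triangle_ineq2[of x y] t T by (simp add: t_def)
      then have "\<bar>x \<bullet> (x - y)\<bar> \<le> (norm y + 1) * t"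
        using Cauchy_Schwarz_ineq2[of x "x - y"] mult_mono'[of "norm x" "norm y + 1" "norm (x - y)" t] \<tau>(4)[of x]
        by (simp add: t_def)
      then have "- (\<theta> x * (x \<bullet> (x - y))) \<le> s\<^sup>2 / (q * t) * ((norm y + 1) * t)"
        unfolding th mult_minus_right[symmetric] using q t by (intro mult_left_mono) auto
      then have drift: "- (\<theta> x * (x \<bullet> (x - y))) \<le> s / q * (s * (norm y + 1))"
        using t q by (simp add: power2_eq_square)
      have "M * \<psi> x \<le> M * (s ^ 3 / q)" using ps M by (rule mult_left_mono)
      then have zeroth: "M * \<psi> x \<le> s / q * (M * s\<^sup>2)" by (simp add: power2_eq_square power3_eq_cube mult_ac)
      \<comment> \<open>The field \<open>(x - y) / \<bar>x - y\<bar> ^ N\<close> is divergence free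
        off \<open>y\<close>. So only the derivative of \<open>(T - \<tau>)\<^sup>2\<close>
        survives, apart from terms carrying a factor \<open>\<epsilon>\<close> that measure the
        regularization.\<close>
      have main: "real N * \<theta> x + (x - y) \<bullet> grad \<theta> x = - 2 * (s / q) + (real N * s\<^sup>2 + 2 * s * t) * (\<epsilon> / (q * t ^ 3))"
        unfolding th gth using t q by (simp add: field_simps power2_eq_square power3_eq_cube)
      have "real N * s\<^sup>2 + 2 * s * t \<le> real N * 1 + 2 * 1 * 1"
        using s t T by (intro add_mono mult_mono mult_left_mono power_le_one) auto
      then have err: "(real N * s\<^sup>2 + 2 * s * t) * (\<epsilon> / (q * t ^ 3)) \<le> (real N + 2) * (\<epsilon> / (q * t ^ 3))"
        using \<epsilon> q t by (intro mult_right_mono) auto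
      \<comment> \<open>Half of the gain \<open>2 * (s / q)\<close> pays for the drift and the
        zeroth order term; this is the origin of the smallness condition on
        \<open>T\<close>.\<close>
      have "s * (norm y + 1) + M * s\<^sup>2 \<le> T * (norm y + 1) + M * T\<^sup>2"
        using s M T by (intro add_mono mult_right_mono mult_left_mono power_mono) auto
      also have "\<dots> \<le> 1" using T(3) by (simp add: mult.commute)
      finally have "s / q * (s * (norm y + 1) + M * s\<^sup>2) \<le> s / q * 1"
        using s q by (intro mult_left_mono) auto
      then have "s / q * (s * (norm y + 1)) + s / q * (M * s\<^sup>2) \<le> s / q" by (simp add: distrib_left)
      then have "real N * \<theta> x + (x - y) \<bullet> grad \<theta> x - \<theta> x * (x \<bullet> (x - y)) + M * \<psi> x
         \<le> - (s / q) + (real N + 2) * (\<epsilon> / (q * t ^ 3))"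
        using main err drift zeroth by linarith
      then show "real N * \<theta> x + (x - y) \<bullet> grad \<theta> x - \<theta> x * (x \<bullet> (x - y)) + M * \<psi> x
       \<le> - (max 0 (T - \<tau> x) / \<tau> x ^ (N - 1)) + (if \<tau> x < T then (real N + 2) * (\<epsilon> / \<tau> x ^ (N + 2)) else 0)"
        using True s by (simp add: t_def[symmetric] s_def[symmetric] n q_def power3_eq_cube mult_ac)
    qed
  qed
qed

text \<open>The factor next to \<open>w\<close> is \<open>- L \<psi> + M \<psi>\<close>, so
  \<open>super\<close> says that \<open>w\<close> is a supersolution of \<open>- L + M\<close>, in a
  form without derivatives of \<open>w\<close>. At a zero \<open>y\<close> the barrier shows that
  \<open>w\<close> times a fixed tent function around \<open>y\<close> has an integral below an
  error that vanishes with \<open>\<epsilon>\<close>. So the zero set is open, and it is closed by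
  continuity.\<close>

lemma strong_maximum_principle:
  fixes w :: "'a::euclidean_space \<Rightarrow> real"
  assumes w: "continuous_on UNIV w" "\<And>x. 0 \<le> w x" and M: "0 \<le> M"
    and super: "\<And>y \<psi> \<theta>. \<psi> \<in> C1c \<Longrightarrow> \<theta> \<in> C1c \<Longrightarrow> (\<And>x. 0 \<le> \<psi> x) \<Longrightarrow>
      (\<And>x. grad \<psi> x = - (\<theta> x *\<^sub>R (x - y))) \<Longrightarrow>
      0 \<le> (LINT x|gauss. w x * (real (DIM('a)) * \<theta> x + (x - y) \<bullet> grad \<theta> x - \<theta> x * (x \<bullet> (x - y)) + M * \<psi> x))"
    and "w x0 = 0"
  shows "w x = 0"
proof -
  define N where "N = DIM('a)"
  have local: "\<exists>\<rho>>0. \<forall>x\<in>ball y \<rho>. w x = 0" if wy: "w y = 0" for y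
  proof -
    \<comment> \<open>Then \<open>(norm y + 1) * T + M * T = 1 - T\<close>, and
      \<open>T \<le> 1\<close> gives \<open>M * T\<^sup>2 \<le> M * T\<close>, which is the
      smallness condition of the barrier.\<close>
    define T where "T = 1 / (norm y + 2 + M)"
    have pos: "norm y + 2 + M \<ge> 1" using M by (simp add: add_increasing)
    have T: "0 < T" "T \<le> 1" using pos by (auto simp: T_def)
    have "M * T\<^sup>2 \<le> M * T" using T M by (intro mult_left_mono) (auto simp: power2_eq_square mult_le_cancel_left1)
    moreover have "(norm y + 1) * T + M * T = (norm y + 1 + M) / (norm y + 2 + M)"
      by (simp add: T_def add_divide_distrib)
    moreover have "\<dots> \<le> 1" using pos by simp
    ultimately have T3: "(norm y + 1) * T + M * T\<^sup>2 \<le> 1" by linarith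
    obtain \<eta> :: "'a \<Rightarrow> real" where \<eta>: "\<eta> \<in> C1c" "\<And>x. 0 \<le> \<eta> x" "\<And>x. norm x \<le> norm y + 1 \<Longrightarrow> \<eta> x = 1"
      "\<And>x. norm x < norm y + 1 \<Longrightarrow> grad \<eta> x = 0"
    proof -
      have "norm y + 1 > 0" by (simp add: add_nonneg_pos)
      then show ?thesis using cutoff_family[where 'a = 'a] that by metis
    qed
    have flat: "grad \<eta> x = 0" if "norm (x - y) < 1" for x
      using \<eta>(4)[of x] that norm_triangle_ineq2[of x y] by simp
    \<comment> \<open>A lower bound, independent of \<open>\<epsilon>\<close>, for the gain of the
      barrier.\<close>
    define b where "b x = max 0 (T / 4 - norm (x - y))" for x
    have bc: "ccs b"
      unfolding ccs_def b_def
    proof (intro conjI continuous_intros exI allI impI)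
      fix x :: 'a assume "norm x \<ge> norm y + T"
      then show "max 0 (T / 4 - norm (x - y)) = 0" using T norm_triangle_ineq2[of x y] by simp
    qed
    define I where "I = (LINT x|gauss. w x * b x)"
    have "I \<le> e" if "e > 0" for e
    proof -
      have "e / (real N + 2) > 0" using \<open>e > 0\<close> by simp
      then obtain \<epsilon>0 where \<epsilon>0: "\<epsilon>0 > 0"
        "\<And>\<epsilon>. 0 < \<epsilon> \<Longrightarrow> \<epsilon> \<le> \<epsilon>0 \<Longrightarrow>
          (LINT x|gauss. w x * (\<eta> x * (\<epsilon> / reg_dist y \<epsilon> x ^ (N + 2)))) \<le> e / (real N + 2)"
        using reg_dist_kernel_tendsto_0[OF \<eta>(1) flat \<eta>(2) w wy] unfolding N_def by metis
      \<comment> \<open>With \<open>\<epsilon> \<le> T\<^sup>2 / 16\<close> the regularized distance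
        is at most \<open>T / 2\<close> on the support of \<open>b\<close>, so the gain there
        dominates \<open>b\<close>.\<close>
      define \<epsilon> where "\<epsilon> = min \<epsilon>0 (T\<^sup>2 / 16)"
      have \<epsilon>: "0 < \<epsilon>" "\<epsilon> \<le> \<epsilon>0" "\<epsilon> \<le> T\<^sup>2 / 16" using \<epsilon>0 T by (auto simp: \<epsilon>_def)
      define \<tau> where "\<tau> = reg_dist y \<epsilon>"
      have \<tau>0: "\<tau> x > 0" for x using reg_dist_pos[OF \<epsilon>(1)] by (simp add: \<tau>_def)
      obtain \<psi> \<theta> where b: "\<psi> \<in> C1c" "\<theta> \<in> C1c" "\<And>x. 0 \<le> \<psi> x" "\<And>x. grad \<psi> x = - (\<theta> x *\<^sub>R (x - y))"
        "\<And>x. real N * \<theta> x + (x - y) \<bullet> grad \<theta> x - \<theta> x * (x \<bullet> (x - y)) + M * \<psi> x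
       \<le> - (max 0 (T - \<tau> x) / \<tau> x ^ (N - 1)) + (if \<tau> x < T then (real N + 2) * (\<epsilon> / \<tau> x ^ (N + 2)) else 0)"
        using barrier[OF T T3 M \<epsilon>(1)] unfolding N_def \<tau>_def by metis
      define E where "E x = real N * \<theta> x + (x - y) \<bullet> grad \<theta> x - \<theta> x * (x \<bullet> (x - y)) + M * \<psi> x" for x
      define k where "k x = \<epsilon> / \<tau> x ^ (N + 2)" for x
      have k0: "k x \<ge> 0" for x using \<tau>0[of x] \<epsilon> by (simp add: k_def)
      have "\<tau> x \<noteq> 0" for x using \<tau>0[of x] by simp
      then have kc: "continuous_on UNIV k" unfolding k_def
        by (intro continuous_intros C1_continuous) (auto simp: \<tau>_def intro: C1_reg_dist \<epsilon>)
      have Ec: "ccs E" unfolding E_def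
        by (intro ccs_add ccs_diff ccs_mult' ccs_mult ccs_inner' ccs_C1c b continuous_intros)
      have Eb: "E x \<le> - b x + (real N + 2) * (\<eta> x * k x)" for x
      proof -
        have "b x \<le> max 0 (T - \<tau> x) / \<tau> x ^ (N - 1)"
        proof (cases "norm (x - y) < T / 4")
          case True
          have "(\<tau> x)\<^sup>2 = (norm (x - y))\<^sup>2 + \<epsilon>"
            using reg_dist_sq[OF \<epsilon>(1), of y x] by (simp add: \<tau>_def power2_norm_eq_inner)
          moreover have "(norm (x - y))\<^sup>2 \<le> (T / 4)\<^sup>2"
            using True by (intro power_mono) simp_all
          moreover have "(T / 4)\<^sup>2 = T\<^sup>2 / 16" "(T / 2)\<^sup>2 = T\<^sup>2 / 4" by (simp_all add: power_divide)
          ultimately have "(\<tau> x)\<^sup>2 \<le> (T / 2)\<^sup>2" using \<epsilon>(3) zero_le_power2[of T] by linarith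
          from this have t: "\<tau> x \<le> T / 2" by (rule power2_le_imp_le) (simp add: T(1) less_imp_le)
          have "\<tau> x ^ (N - 1) \<le> 1" using t T \<tau>0[of x] by (intro power_le_one) auto
          then have "max 0 (T - \<tau> x) \<le> max 0 (T - \<tau> x) / \<tau> x ^ (N - 1)"
            using \<tau>0[of x] by (simp add: le_divide_eq mult_left_le)
          moreover have "T / 4 - norm (x - y) \<le> T - \<tau> x"
            using t T norm_ge_zero[of "x - y"] by linarith
          then have "b x \<le> max 0 (T - \<tau> x)" unfolding b_def by (intro max.mono) simp_all
          ultimately show ?thesis by linarith
        qed (use \<tau>0[of x] in \<open>auto simp: b_def\<close>)
        moreover have "(if \<tau> x < T then (real N + 2) * (\<epsilon> / \<tau> x ^ (N + 2)) else 0) \<le> (real N + 2) * (\<eta> x * k x)"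
        proof (cases "\<tau> x < T")
          case True
          then have "norm x \<le> norm y + 1"
            using norm_le_reg_dist[OF \<epsilon>(1), of x y] norm_triangle_ineq2[of x y] T by (simp add: \<tau>_def)
          then show ?thesis using True \<eta>(3) by (simp add: k_def)
        qed (use \<eta>(2) k0 in auto)
        ultimately show ?thesis using b(5)[of x] by (simp add: E_def)
      qed
      have c1: "ccs (\<lambda>x. w x * E x)" by (intro ccs_mult' Ec w)
      have c2: "ccs (\<lambda>x. w x * b x)" by (intro ccs_mult' bc w)
      have c3: "ccs (\<lambda>x. w x * (\<eta> x * k x))" by (intro ccs_mult' ccs_mult ccs_C1c \<eta> kc w)
      have "0 \<le> (LINT x|gauss. w x * E x)"
        unfolding E_def N_def by (rule super[OF b(1-4)])
      also have "\<dots> \<le> (LINT x|gauss. - (w x * b x) + (real N + 2) * (w x * (\<eta> x * k x)))"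
      proof (rule integral_mono)
        show "w x * E x \<le> - (w x * b x) + (real N + 2) * (w x * (\<eta> x * k x))" for x
          using mult_left_mono[OF Eb w(2), of x x] by (simp add: algebra_simps)
      qed (use integrable_gauss[OF c1] integrable_gauss[OF c2] integrable_gauss[OF c3] in auto)
      also have "\<dots> = - I + (real N + 2) * (LINT x|gauss. w x * (\<eta> x * k x))"
        using integrable_gauss[OF c2] integrable_gauss[OF c3] by (simp add: I_def)
      finally have "I \<le> (real N + 2) * (LINT x|gauss. w x * (\<eta> x * k x))" by simp
      also have "\<dots> \<le> (real N + 2) * (e / (real N + 2))"
        using \<epsilon>0(2)[OF \<epsilon>(1,2)] by (intro mult_left_mono) (auto simp: k_def \<tau>_def)
      finally show ?thesis by simp
    qed
    then have I: "I \<le> 0" by (rule field_le_epsilon[of I 0, simplified])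
    have "w x = 0" if x: "x \<in> ball y (T / 4)" for x
    proof (rule ccontr)
      assume "w x \<noteq> 0"
      moreover have "b x \<noteq> 0" using x by (simp add: b_def dist_norm norm_minus_commute)
      moreover have c: "ccs (\<lambda>x. w x * b x)" by (intro ccs_mult' bc w)
      ultimately have "0 < I" unfolding I_def
        by (intro integral_gauss_pos[of _ x] integrable_gauss c)
           (use c w in \<open>auto simp: ccs_def b_def\<close>)
      then show False using I by simp
    qed
    then show ?thesis using T by (intro exI[of _ "T / 4"]) auto
  qed
  have "open {x. w x = 0}"
    unfolding open_contains_ball using local by blast
  moreover have "closed {x. w x = 0}"
    by (intro closed_Collect_eq w continuous_on_const)
  ultimately have "{x. w x = 0} = {} \<or> {x. w x = 0} = UNIV"
    using clopen[of "{x. w x = 0}"] by simp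
  then show ?thesis using \<open>w x0 = 0\<close> by auto
qed

section \<open>Negative directions\<close>

text \<open>On the compact unit sphere of \<open>S\<close> the limit form is at most
  \<open>- d\<close> for some \<open>d > 0\<close>. Coordinates there are at most 1 in absolute
  value, so the form stays negative once the errors of the entries sum to less than
  \<open>d\<close>; homogeneity does the rest.\<close>

lemma eventually_negative_form:
  fixes A :: "nat \<Rightarrow> 'e::euclidean_space \<Rightarrow> 'e \<Rightarrow> real"
  assumes lim: "\<And>i j. i \<in> Basis \<Longrightarrow> j \<in> Basis \<Longrightarrow> (\<lambda>m. A m i j) \<longlonglongrightarrow> A0 i j"
    and S: "subspace S"
    and neg: "\<And>x. x \<in> S \<Longrightarrow> x \<noteq> 0 \<Longrightarrow> (\<Sum>i\<in>Basis. \<Sum>j\<in>Basis. (x \<bullet> i) * (x \<bullet> j) * A0 i j) < 0"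
  shows "\<forall>\<^sub>F m in sequentially. \<forall>x\<in>S. x \<noteq> 0 \<longrightarrow>
    (\<Sum>i\<in>Basis. \<Sum>j\<in>Basis. (x \<bullet> i) * (x \<bullet> j) * A m i j) < 0"
proof -
  define q where "q A x = (\<Sum>i\<in>Basis. \<Sum>j\<in>Basis. (x \<bullet> i) * (x \<bullet> j) * A i j)"
    for A and x :: 'e
  have q_scale: "q A (r *\<^sub>R x) = r\<^sup>2 * q A x" for A r x
    by (simp add: q_def sum_distrib_left power2_eq_square mult_ac)
  define K where "K = S \<inter> sphere 0 1"
  have "compact K" unfolding K_def using S by (intro closed_Int_compact closed_subspace) auto
  have cq: "continuous_on K (q A0)" unfolding q_def by (intro continuous_intros)
  have "\<exists>d>0. \<forall>x\<in>K. q A0 x \<le> - d"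
  proof (cases "K = {}")
    case False
    obtain x where x: "x \<in> K" "\<And>y. y \<in> K \<Longrightarrow> q A0 y \<le> q A0 x"
      using continuous_attains_sup[OF \<open>compact K\<close> False cq] by blast
    have "q A0 x < 0" unfolding q_def by (rule neg) (use x(1) in \<open>auto simp: K_def\<close>)
    then show ?thesis using x(2) by (intro exI[of _ "- q A0 x"]) auto
  qed (auto intro: exI[of _ 1])
  then obtain d where d: "d > 0" "\<And>x. x \<in> K \<Longrightarrow> q A0 x \<le> - d" by blast
  define D where "D m = (\<Sum>i\<in>Basis. \<Sum>j\<in>Basis. \<bar>A m i j - A0 i j\<bar>)" for m
  have "D \<longlonglongrightarrow> (\<Sum>i\<in>(Basis :: 'e set). \<Sum>j\<in>(Basis :: 'e set). \<bar>A0 i j - A0 i j\<bar>)"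
    unfolding D_def by (intro tendsto_intros lim)
  then have "D \<longlonglongrightarrow> 0" by simp
  then have "\<forall>\<^sub>F m in sequentially. D m < d" using d(1) by (rule order_tendstoD)
  then show ?thesis
  proof (rule eventually_mono)
    fix m assume m: "D m < d"
    have *: "q (A m) x < 0" if x: "x \<in> K" for x
    proof -
      have n: "norm x = 1" using x by (simp add: K_def)
      have "q (A m) x - q A0 x = (\<Sum>i\<in>Basis. \<Sum>j\<in>Basis. (x \<bullet> i) * (x \<bullet> j) * (A m i j - A0 i j))"
        by (simp add: q_def sum_subtractf right_diff_distrib)
      also have "\<dots> \<le> D m"
        unfolding D_def
      proof (intro sum_mono)
        fix i j :: 'e assume "i \<in> Basis" "j \<in> Basis"
        then have "\<bar>x \<bullet> i\<bar> \<le> 1" "\<bar>x \<bullet> j\<bar> \<le> 1" using Basis_le_norm n by metis+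
        then have "\<bar>x \<bullet> i\<bar> * \<bar>x \<bullet> j\<bar> \<le> 1" by (simp add: mult_le_one)
        then have "\<bar>x \<bullet> i\<bar> * \<bar>x \<bullet> j\<bar> * \<bar>A m i j - A0 i j\<bar> \<le> 1 * \<bar>A m i j - A0 i j\<bar>"
          by (rule mult_right_mono) simp
        then show "(x \<bullet> i) * (x \<bullet> j) * (A m i j - A0 i j) \<le> \<bar>A m i j - A0 i j\<bar>"
          using abs_ge_self[of "(x \<bullet> i) * (x \<bullet> j) * (A m i j - A0 i j)"] by (simp add: abs_mult)
      qed
      finally show ?thesis using d(2)[OF x] m by linarith
    qed
    show "\<forall>x\<in>S. x \<noteq> 0 \<longrightarrow> (\<Sum>i\<in>Basis. \<Sum>j\<in>Basis. (x \<bullet> i) * (x \<bullet> j) * A m i j) < 0"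
    proof (intro ballI impI)
      fix x assume x: "x \<in> S" "x \<noteq> 0"
      have "(1 / norm x) *\<^sub>R x \<in> K" using x S by (auto simp: K_def subspace_scale)
      from *[OF this] have "(1 / norm x)\<^sup>2 * q (A m) x < 0" by (simp only: q_scale)
      then have "q (A m) x < 0" by (metis mult_nonneg_nonneg not_less zero_le_power2)
      then show "(\<Sum>i\<in>Basis. \<Sum>j\<in>Basis. (x \<bullet> i) * (x \<bullet> j) * A m i j) < 0" by (simp add: q_def)
    qed
  qed
qed

text \<open>This is \<open>dilation_identity\<close> for \<open>p * \<theta>\<close> times the
  Gaussian density, whose logarithmic gradient \<open>- x\<close> produces the drift term. If
  \<open>\<nabla>\<psi> = - \<theta> (x - y)\<close>, it frees \<open>p\<close> of its derivative in
  the energy of \<open>p\<close> against \<open>\<psi>\<close>.\<close>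

lemma integral_radial_by_parts:
  fixes y :: "'a::euclidean_space"
  assumes p: "p \<in> C1" and \<theta>: "\<theta> \<in> C1c"
  shows "(LINT x|gauss. p x * (real (DIM('a)) * \<theta> x + (x - y) \<bullet> grad \<theta> x - \<theta> x * (x \<bullet> (x - y))))
    = - (LINT x|gauss. \<theta> x * ((x - y) \<bullet> grad p x))"
proof -
  define \<rho> where "\<rho> x = exp (- (norm x)\<^sup>2 / 2)" for x :: 'a
  have g: "GDERIV \<rho> x :> - (\<rho> x *\<^sub>R x)" for x
    unfolding \<rho>_def power2_norm_eq_inner gderiv_def
    by (auto intro!: derivative_eq_intros simp: fun_eq_iff inner_commute)
  have \<rho>1: "\<rho> \<in> C1" by (rule C1I[OF g]) (auto simp: \<rho>_def intro!: continuous_intros)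
  have \<theta>1: "\<theta> \<in> C1" by (rule C1c_C1[OF \<theta>])
  have p\<theta>: "(\<lambda>x. p x * \<theta> x) \<in> C1c" using C1c_mult'[OF \<theta> p] .
  define X where "X x = p x * (real (DIM('a)) * \<theta> x + (x - y) \<bullet> grad \<theta> x - \<theta> x * (x \<bullet> (x - y)))" for x
  define Y where "Y x = \<theta> x * ((x - y) \<bullet> grad p x)" for x
  have X: "ccs X" unfolding X_def
    by (intro ccs_mult' ccs_diff ccs_add ccs_mult ccs_inner' ccs_C1c \<theta> continuous_intros C1_continuous p)
  have Y: "ccs Y" unfolding Y_def
    by (intro ccs_mult ccs_C1c \<theta> continuous_intros C1_grad_continuous_on p)
  have "real (DIM('a)) * ((p x * \<theta> x) * \<rho> x) + (x - y) \<bullet> grad (\<lambda>x. (p x * \<theta> x) * \<rho> x) x = \<rho> x *\<^sub>R (X x + Y x)" for x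
  proof -
    have "grad (\<lambda>x. (p x * \<theta> x) * \<rho> x) x
        = (p x * \<theta> x) *\<^sub>R (- (\<rho> x *\<^sub>R x)) + \<rho> x *\<^sub>R (p x *\<^sub>R grad \<theta> x + \<theta> x *\<^sub>R grad p x)"
      using grad_mult[OF C1_mult[OF p \<theta>1] \<rho>1] grad_mult[OF p \<theta>1] grad_eqI[OF g] by simp
    then have "(x - y) \<bullet> grad (\<lambda>x. (p x * \<theta> x) * \<rho> x) x
        = - (p x * \<theta> x * (\<rho> x * (x \<bullet> (x - y)))) + \<rho> x * (p x * ((x - y) \<bullet> grad \<theta> x) + \<theta> x * ((x - y) \<bullet> grad p x))"
      by (simp only: inner_add_right inner_scaleR_right inner_minus_right inner_commute[of "x - y" x] scaleR_conv_of_real of_real_eq_id id_apply)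
    then show ?thesis unfolding X_def Y_def by (simp add: algebra_simps)
  qed
  then have "(LINT x|lborel. \<rho> x *\<^sub>R (X x + Y x)) = 0"
    using dilation_identity[OF C1c_mult[OF p\<theta> \<rho>1], of y] by simp
  then have "(LINT x|gauss. X x + Y x) = 0"
    using integral_gauss[of "\<lambda>x. X x + Y x"] ccs_measurable[OF ccs_add[OF X Y]] by (simp add: \<rho>_def)
  then have "(LINT x|gauss. X x) = - (LINT x|gauss. Y x)"
    using integrable_gauss[OF X] integrable_gauss[OF Y] by simp
  then show ?thesis by (simp only: X_def Y_def)
qed

text \<open>The form may be degenerate, hence the separate case \<open>a = 0\<close>. The
  consequence of interest is that functions whose energies tend to 0 become orthogonal to each test
  function in the limit; this is how a minimizer turns into a weak solution.\<close>

lemma energy_Cauchy_Schwarz: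
  assumes nonneg: "\<And>\<phi>. \<phi> \<in> C1c \<Longrightarrow> 0 \<le> energy c \<phi> \<phi>" and c: "continuous_on UNIV c"
    and \<phi>: "\<phi> \<in> C1c" and \<psi>: "\<psi> \<in> C1c"
  shows "(energy c \<phi> \<psi>)\<^sup>2 \<le> energy c \<phi> \<phi> * energy c \<psi> \<psi>"
proof -
  have q: "0 \<le> s\<^sup>2 * energy c \<phi> \<phi> + 2 * s * t * energy c \<phi> \<psi> + t\<^sup>2 * energy c \<psi> \<psi>" for s t
  proof -
    have s: "(\<lambda>x. s * \<phi> x) \<in> C1c" "(\<lambda>x. t * \<psi> x) \<in> C1c" using \<phi> \<psi> by auto
    then have st: "(\<lambda>x. s * \<phi> x + t * \<psi> x) \<in> C1c" by auto
    have "energy c (\<lambda>x. s * \<phi> x + t * \<psi> x) \<zeta> = s * energy c \<phi> \<zeta> + t * energy c \<psi> \<zeta>" if "\<zeta> \<in> C1c" for \<zeta>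
      using energy_add[OF s that c] by (simp add: energy_cmult \<phi> \<psi>)
    note e = this
    have "0 \<le> energy c (\<lambda>x. s * \<phi> x + t * \<psi> x) (\<lambda>x. s * \<phi> x + t * \<psi> x)" by (rule nonneg[OF st])
    also have "\<dots> = s * (s * energy c \<phi> \<phi> + t * energy c \<psi> \<phi>) + t * (s * energy c \<phi> \<psi> + t * energy c \<psi> \<psi>)"
      using e[OF st] e[OF \<phi>] e[OF \<psi>] energy_commute[of c \<phi> "\<lambda>x. s * \<phi> x + t * \<psi> x"]
        energy_commute[of c \<psi> "\<lambda>x. s * \<phi> x + t * \<psi> x"] by simp
    finally show ?thesis using energy_commute[of c \<psi> \<phi>] by (simp add: power2_eq_square algebra_simps)
  qed
  define a b d where "a = energy c \<phi> \<phi>" and "b = energy c \<phi> \<psi>" and "d = energy c \<psi> \<psi>"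
  have "a \<ge> 0" "d \<ge> 0" using nonneg \<phi> \<psi> by (auto simp: a_def d_def)
  have q': "0 \<le> s\<^sup>2 * a + 2 * s * t * b + t\<^sup>2 * d" for s t using q by (simp add: a_def b_def d_def)
  show ?thesis
  proof (cases "a = 0")
    case True
    have "b = 0"
    proof (rule ccontr)
      assume "b \<noteq> 0"
      have "0 \<le> 2 * (- (d + 1) / b) * 1 * b + d" using q'[of "- (d + 1) / b" 1] True by simp
      moreover have e: "2 * (- (d + 1) / b) * 1 * b = - 2 * (d + 1)" using \<open>b \<noteq> 0\<close> by simp
      ultimately have "0 \<le> - 2 * (d + 1) + d" unfolding e by simp
      then show False using \<open>d \<ge> 0\<close> by simp
    qed
    then show ?thesis using True by (simp add: a_def b_def)
  next
    case False
    have "0 \<le> b\<^sup>2 * a + 2 * (- b) * a * b + a\<^sup>2 * d" using q'[of "- b" a] by simp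
    then have "0 \<le> a * (a * d - b\<^sup>2)" by (simp add: power2_eq_square algebra_simps)
    then have "b\<^sup>2 \<le> a * d" using False \<open>a \<ge> 0\<close> by (simp add: zero_le_mult_iff)
    then show ?thesis by (simp add: a_def b_def d_def)
  qed
qed

section \<open>A negative direction of the shifted form raises the Morse index\<close>

context gauss_solution
begin

definition grad_span :: "'a set" where "grad_span = span (range (grad u))"

text \<open>A vector of the span that is orthogonal to all values of \<open>grad u\<close> is
  orthogonal to itself. Thus \<open>v\<close> is injective in its direction on
  \<open>grad_span\<close>.\<close>

lemma v_eq_0_imp: "e \<in> grad_span \<Longrightarrow> (\<And>x. v e x = 0) \<Longrightarrow> e = 0"
proof -
  assume e: "e \<in> grad_span" "\<And>x. v e x = 0"
  have "orthogonal e y" if "y \<in> range (grad u)" for y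
    using e(2) that by (auto simp: orthogonal_def v_def)
  then have "orthogonal e e" using orthogonal_to_span[of e "range (grad u)"] e(1) unfolding grad_span_def by blast
  then show "e = 0" by (simp add: orthogonal_self)
qed

text \<open>The scale is \<open>R + 1\<close>, so that it is positive for every index.\<close>

lemma cutoff_sequence:
  obtains C and \<eta> :: "nat \<Rightarrow> 'a \<Rightarrow> real" where "C > 0" "\<And>R. \<eta> R \<in> C1c" "\<And>R x. 0 \<le> \<eta> R x \<and> \<eta> R x \<le> 1"
    "\<And>R x. norm x < real (Suc R) \<Longrightarrow> \<eta> R x = 1 \<and> grad (\<eta> R) x = 0"
    "\<And>R x. norm (grad (\<eta> R) x) \<le> C / real (Suc R)"
proof -
  obtain C where C: "C > 0" "\<forall>R>0. \<exists>\<eta>\<in>(C1c :: ('a \<Rightarrow> real) set). (\<forall>x. 0 \<le> \<eta> x \<and> \<eta> x \<le> 1) \<and>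
       (\<forall>x. norm x \<le> R \<longrightarrow> \<eta> x = 1) \<and> (\<forall>x. norm x < R \<longrightarrow> grad \<eta> x = 0) \<and> (\<forall>x. norm (grad \<eta> x) \<le> C / R)"
    using cutoff_family[where 'a = 'a] by blast
  have "\<forall>n. \<exists>\<eta>. \<eta> \<in> (C1c :: ('a \<Rightarrow> real) set) \<and> (\<forall>x. 0 \<le> \<eta> x \<and> \<eta> x \<le> 1) \<and>
       (\<forall>x. norm x \<le> real (Suc n) \<longrightarrow> \<eta> x = 1) \<and> (\<forall>x. norm x < real (Suc n) \<longrightarrow> grad \<eta> x = 0) \<and>
       (\<forall>x. norm (grad \<eta> x) \<le> C / real (Suc n))"
  proof
    fix n
    have "real (Suc n) > 0" by simp
    with C(2) show "\<exists>\<eta>. \<eta> \<in> (C1c :: ('a \<Rightarrow> real) set) \<and> (\<forall>x. 0 \<le> \<eta> x \<and> \<eta> x \<le> 1) \<and>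
       (\<forall>x. norm x \<le> real (Suc n) \<longrightarrow> \<eta> x = 1) \<and> (\<forall>x. norm x < real (Suc n) \<longrightarrow> grad \<eta> x = 0) \<and>
       (\<forall>x. norm (grad \<eta> x) \<le> C / real (Suc n))" by blast
  qed
  from choice[OF this] obtain \<eta> where \<eta>: "\<forall>n. \<eta> n \<in> (C1c :: ('a \<Rightarrow> real) set) \<and> (\<forall>x. 0 \<le> \<eta> n x \<and> \<eta> n x \<le> 1) \<and>
       (\<forall>x. norm x \<le> real (Suc n) \<longrightarrow> \<eta> n x = 1) \<and> (\<forall>x. norm x < real (Suc n) \<longrightarrow> grad (\<eta> n) x = 0) \<and>
       (\<forall>x. norm (grad (\<eta> n) x) \<le> C / real (Suc n))" ..
  show ?thesis
    by (rule that[OF C(1), of \<eta>]) (use \<eta> in \<open>simp_all add: less_imp_le\<close>)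
qed

text \<open>At each point the integrand is eventually constant in \<open>R\<close>, and
  \<open>C\<^sup>2 + 1\<close> times the absolute value of the integrable function
  \<open>v a x * v b x\<close> dominates.\<close>

lemma truncated_tendsto:
  fixes \<eta> :: "nat \<Rightarrow> 'a \<Rightarrow> real"
  assumes C: "C > 0" and \<eta>: "\<And>R. \<eta> R \<in> C1c" "\<And>R x. 0 \<le> \<eta> R x \<and> \<eta> R x \<le> 1"
    "\<And>R x. norm x < real (Suc R) \<Longrightarrow> \<eta> R x = 1 \<and> grad (\<eta> R) x = 0"
    "\<And>R x. norm (grad (\<eta> R) x) \<le> C / real (Suc R)"
  shows "(\<lambda>R. LINT x|gauss. v a x * v b x * ((norm (grad (\<eta> R) x))\<^sup>2 - (\<eta> R x)\<^sup>2))
    \<longlonglongrightarrow> - (LINT x|gauss. v a x * v b x)"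
proof -
  have i: "integrable gauss (\<lambda>x. norm (v a x * v b x) * (C\<^sup>2 + 1))"
    by (intro integrable_mult_left integrable_norm v_square_integrable)
  have m: "v a \<in> borel_measurable borel" "v b \<in> borel_measurable borel"
    using continuous_v by (auto intro: borel_measurable_continuous_onI)
  have "(\<lambda>R. LINT x|gauss. v a x * v b x * ((norm (grad (\<eta> R) x))\<^sup>2 - (\<eta> R x)\<^sup>2))
    \<longlonglongrightarrow> (LINT x|gauss. v a x * v b x * (0 - 1))"
  proof (rule integral_dominated_convergence[OF _ _ i])
    show "(\<lambda>x. v a x * v b x * (0 - 1)) \<in> borel_measurable gauss" using m by simp
    show "(\<lambda>x. v a x * v b x * ((norm (grad (\<eta> R) x))\<^sup>2 - (\<eta> R x)\<^sup>2)) \<in> borel_measurable gauss" for R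
      using m C1_measurable[OF C1c_C1[OF \<eta>(1)[of R]]] C1_grad_measurable[OF C1c_C1[OF \<eta>(1)[of R]]] by simp
    show "AE x in gauss. (\<lambda>R. v a x * v b x * ((norm (grad (\<eta> R) x))\<^sup>2 - (\<eta> R x)\<^sup>2)) \<longlonglongrightarrow> v a x * v b x * (0 - 1)"
    proof (rule always_eventually, rule allI, rule tendsto_eventually)
      fix x :: 'a
      obtain R0 :: nat where "norm x < real R0" using reals_Archimedean2 by blast
      then have "norm x < real (Suc R)" if "R \<ge> R0" for R using that by linarith
      then have "v a x * v b x * ((norm (grad (\<eta> R) x))\<^sup>2 - (\<eta> R x)\<^sup>2) = v a x * v b x * (0 - 1)" if "R \<ge> R0" for R
        using \<eta>(3)[of x R] that by simp
      then show "\<forall>\<^sub>F R in sequentially. v a x * v b x * ((norm (grad (\<eta> R) x))\<^sup>2 - (\<eta> R x)\<^sup>2) = v a x * v b x * (0 - 1)"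
        unfolding eventually_sequentially by blast
    qed
    show "AE x in gauss. norm (v a x * v b x * ((norm (grad (\<eta> R) x))\<^sup>2 - (\<eta> R x)\<^sup>2))
        \<le> norm (v a x * v b x) * (C\<^sup>2 + 1)" for R
    proof (intro always_eventually allI)
      fix x
      have "C / real (Suc R) \<le> C" using C by (simp add: divide_le_eq mult_le_cancel_left1)
      then have "norm (grad (\<eta> R) x) \<le> C" using \<eta>(4)[where R = R and x = x] by linarith
      then have "(norm (grad (\<eta> R) x))\<^sup>2 \<le> C\<^sup>2" by (rule power_mono) simp
      moreover have "(\<eta> R x)\<^sup>2 \<le> 1" using \<eta>(2)[of R x] by (simp add: power_le_one)
      moreover have "0 \<le> (norm (grad (\<eta> R) x))\<^sup>2" "0 \<le> (\<eta> R x)\<^sup>2" "0 \<le> C\<^sup>2" by simp_all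
      ultimately have "\<bar>(norm (grad (\<eta> R) x))\<^sup>2 - (\<eta> R x)\<^sup>2\<bar> \<le> C\<^sup>2 + 1" by linarith
      then show "norm (v a x * v b x * ((norm (grad (\<eta> R) x))\<^sup>2 - (\<eta> R x)\<^sup>2)) \<le> norm (v a x * v b x) * (C\<^sup>2 + 1)"
        unfolding norm_mult[of "v a x * v b x"] by (intro mult_left_mono) auto
    qed
  qed
  then show ?thesis by simp
qed

text \<open>In the limit the form is \<open>- \<parallel>v e + s \<phi>\<parallel>\<^sup>2 + s\<^sup>2 \<kappa>\<close> with \<open>\<kappa> < 0\<close> at \<open>(e, s)\<close>, which is negative definite on
  \<open>grad_span \<times> \<real>\<close>.\<close>

lemma negative_direction_increases_index:
  assumes \<phi>: "\<phi> \<in> C1c" and neg: "energy (\<lambda>x. c x - 1) \<phi> \<phi> < 0" and morse: "morse_index f u k"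
  shows "dim grad_span + 1 \<le> k"
proof -
  have \<phi>c: "ccs \<phi>" by (rule ccs_C1c[OF \<phi>])
  have \<phi>cont: "continuous_on UNIV \<phi>" by (rule C1_continuous[OF C1c_C1[OF \<phi>]])
  define \<kappa> where "\<kappa> = energy (\<lambda>x. c x - 1) \<phi> \<phi>"
  have e\<phi>: "energy c \<phi> \<phi> = \<kappa> - (LINT x|gauss. \<phi> x * \<phi> x)"
  proof -
    have "energy c \<phi> \<phi> = (LINT x|gauss. (grad \<phi> x \<bullet> grad \<phi> x - (c x - 1) * \<phi> x * \<phi> x) - \<phi> x * \<phi> x)"
      unfolding energy_def by (intro Bochner_Integration.integral_cong) (auto simp: algebra_simps)
    also have "\<dots> = \<kappa> - (LINT x|gauss. \<phi> x * \<phi> x)"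
      unfolding \<kappa>_def energy_def
      by (intro Bochner_Integration.integral_diff integrable_gauss energy_integrand_ccs ccs_mult \<phi>c \<phi>cont \<phi>
          C1c_C1 continuous_intros continuous_c)
    finally show ?thesis .
  qed
  obtain C and \<eta> :: "nat \<Rightarrow> 'a \<Rightarrow> real" where \<eta>: "C > 0" "\<And>R. \<eta> R \<in> C1c" "\<And>R x. 0 \<le> \<eta> R x \<and> \<eta> R x \<le> 1"
    "\<And>R x. norm x < real (Suc R) \<Longrightarrow> \<eta> R x = 1 \<and> grad (\<eta> R) x = 0"
    "\<And>R x. norm (grad (\<eta> R) x) \<le> C / real (Suc R)"
    by (rule cutoff_sequence) blast
  obtain \<rho> where \<rho>: "\<rho> > 0" "\<And>x. norm x \<ge> \<rho> \<Longrightarrow> \<phi> x = 0" "\<And>x. norm x \<ge> \<rho> \<Longrightarrow> grad \<phi> x = 0"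
    using C1c_grad_support[OF \<phi>] by metis
  \<comment> \<open>Indexing by the Euclidean space \<open>'a \<times> real\<close> lets its
    \<open>Basis\<close> supply coordinates for the directions and for the multiple of
    \<open>\<phi>\<close> at once.\<close>
  define P where "P R m i = (\<lambda>x. dq (fst i) m u x * \<eta> R x + snd i * \<phi> x)" for R m and i :: "'a \<times> real"
  define L where "L R a b = (LINT x|gauss. v a x * v b x * ((norm (grad (\<eta> R) x))\<^sup>2 - (\<eta> R x)\<^sup>2))" for R a b
  define AR where "AR R i j = L R (fst i) (fst j) - snd j * (LINT x|gauss. v (fst i) x * \<phi> x)
      - snd i * (LINT x|gauss. v (fst j) x * \<phi> x) + snd i * snd j * energy c \<phi> \<phi>" for R and i j :: "'a \<times> real"
  define A where "A i j = - (LINT x|gauss. v (fst i) x * v (fst j) x) - snd j * (LINT x|gauss. v (fst i) x * \<phi> x)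
      - snd i * (LINT x|gauss. v (fst j) x * \<phi> x) + snd i * snd j * energy c \<phi> \<phi>" for i j :: "'a \<times> real"
  have Pc: "P R m i \<in> C1c" for R m i
    unfolding P_def by (intro C1c_add C1c_mult' \<eta> \<phi> C1_dq u_C1 C1_const)
  have lim1: "(\<lambda>m. energy c (P R m i) (P R m j)) \<longlonglongrightarrow> AR R i j" if R: "real R \<ge> \<rho>" for R i j
  proof -
    \<comment> \<open>By the choice of \<open>\<rho>\<close> such a point has norm less than
      \<open>\<rho> \<le> R\<close>, which lies inside the ball of radius \<open>R + 1\<close> where
      the cutoff is flat.\<close>
    have one: "\<eta> R x = 1 \<and> grad (\<eta> R) x = 0" if "\<phi> x \<noteq> 0 \<or> grad \<phi> x \<noteq> 0" for x
      by (rule \<eta>(4)) (use that \<rho> R in force)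
    define p where "p a m = (\<lambda>x. dq a m u x * \<eta> R x)" for a m
    have p: "p a m \<in> C1c" for a m unfolding p_def by (intro C1c_mult' \<eta> C1_dq u_C1)
    have s: "(\<lambda>x. r * \<phi> x) \<in> C1c" for r using \<phi> by auto
    have add: "energy c (\<lambda>x. p a m x + r * \<phi> x) \<psi> = energy c (p a m) \<psi> + r * energy c \<phi> \<psi>" if "\<psi> \<in> C1c" for a m r \<psi>
      using energy_add[OF p s that continuous_c] by (simp add: energy_cmult \<phi>)
    have "energy c (P R m i) (P R m j) = energy c (p (fst i) m) (p (fst j) m) + snd j * energy c (p (fst i) m) \<phi>
        + snd i * energy c (p (fst j) m) \<phi> + snd i * snd j * energy c \<phi> \<phi>" for m
    proof -
      have "energy c (P R m i) (P R m j) = energy c (P R m j) (p (fst i) m) + snd i * energy c (P R m j) \<phi>"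
        using add[OF Pc[of R m j], of "fst i" m "snd i"]
        by (simp add: P_def p_def energy_commute[of c _ "\<lambda>x. dq (fst j) m u x * \<eta> R x + snd j * \<phi> x"])
      also have "\<dots> = energy c (p (fst j) m) (p (fst i) m) + snd j * energy c \<phi> (p (fst i) m)
          + snd i * (energy c (p (fst j) m) \<phi> + snd j * energy c \<phi> \<phi>)"
        using add[OF p[of "fst i" m], of "fst j" m "snd j"] add[OF \<phi>, of "fst j" m "snd j"]
        by (simp add: P_def p_def)
      finally show ?thesis
        using energy_commute[of c "p (fst j) m" "p (fst i) m"] energy_commute[of c \<phi> "p (fst i) m"]
        by (simp add: algebra_simps)
    qed
    moreover have "(\<lambda>m. energy c (p (fst i) m) (p (fst j) m) + snd j * energy c (p (fst i) m) \<phi>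
        + snd i * energy c (p (fst j) m) \<phi> + snd i * snd j * energy c \<phi> \<phi>)
      \<longlonglongrightarrow> L R (fst i) (fst j) + snd j * (- (LINT x|gauss. v (fst i) x * \<phi> x))
      + snd i * (- (LINT x|gauss. v (fst j) x * \<phi> x)) + snd i * snd j * energy c \<phi> \<phi>"
      unfolding L_def p_def
      by (intro tendsto_add tendsto_mult tendsto_const energy_dq_tendsto energy_dq_test_tendsto \<eta> \<phi> one)
    ultimately show ?thesis by (simp add: AR_def)
  qed
  have lim2: "(\<lambda>R. AR R i j) \<longlonglongrightarrow> A i j" for i j
    unfolding AR_def A_def L_def
    by (intro tendsto_add tendsto_diff tendsto_const truncated_tendsto[OF \<eta>])
  define S where "S = grad_span \<times> (UNIV :: real set)"
  have S: "subspace S" unfolding S_def grad_span_def by (intro subspace_Times subspace_span subspace_UNIV)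
  have A_neg: "(\<Sum>i\<in>Basis. \<Sum>j\<in>Basis. (z \<bullet> i) * (z \<bullet> j) * A i j) < 0" if z: "z \<in> S" "z \<noteq> 0" for z
  proof -
    define g where "g i = (\<lambda>x. v (fst i) x + snd i * \<phi> x)" for i :: "'a \<times> real"
    have gc: "continuous_on UNIV (g i)" for i unfolding g_def by (intro continuous_intros continuous_v \<phi>cont)
    have v\<phi>: "integrable gauss (\<lambda>x. v a x * \<phi> x)" for a
      by (intro integrable_gauss ccs_mult' \<phi>c continuous_v)
    have \<phi>\<phi>: "integrable gauss (\<lambda>x. \<phi> x * \<phi> x)"
      by (intro integrable_gauss ccs_mult \<phi>c \<phi>cont)
    have gg_eq: "g i x * g j x = v (fst i) x * v (fst j) x + snd j * (v (fst i) x * \<phi> x)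
       + snd i * (v (fst j) x * \<phi> x) + snd i * snd j * (\<phi> x * \<phi> x)" for i j x
      by (simp add: g_def algebra_simps)
    have gg: "integrable gauss (\<lambda>x. g i x * g j x)" for i j
      unfolding gg_eq
      by (intro Bochner_Integration.integrable_add integrable_mult_right v\<phi> \<phi>\<phi> v_square_integrable)
    have A_eq: "A i j = snd i * snd j * \<kappa> - (LINT x|gauss. g i x * g j x)" for i j
      unfolding gg_eq A_def e\<phi> using v\<phi>[of "fst i"] v\<phi>[of "fst j"] \<phi>\<phi> v_square_integrable[of "fst i" "fst j"]
      by (simp add: algebra_simps)
    have rep: "(\<Sum>i\<in>Basis. (z \<bullet> i) * g i x) = g z x" for x
    proof -
      have lin: "linear (\<lambda>i. g i x)"
        by (rule linearI) (auto simp: g_def v_def algebra_simps)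
      have "g (\<Sum>i\<in>Basis. (z \<bullet> i) *\<^sub>R i) x = (\<Sum>i\<in>Basis. g ((z \<bullet> i) *\<^sub>R i) x)"
        by (rule linear_sum[OF lin])
      also have "\<dots> = (\<Sum>i\<in>Basis. (z \<bullet> i) * g i x)"
        using linear_cmul[OF lin] by simp
      finally show ?thesis by (simp add: euclidean_representation)
    qed
    have reps: "(\<Sum>i\<in>Basis. (z \<bullet> i) * snd i) = snd z"
    proof -
      have "snd (\<Sum>i\<in>Basis. (z \<bullet> i) *\<^sub>R i) = (\<Sum>i\<in>Basis. (z \<bullet> i) * snd i)"
        by (simp add: snd_sum)
      then show ?thesis by (simp add: euclidean_representation)
    qed
    have "(\<Sum>i\<in>Basis. \<Sum>j\<in>Basis. (z \<bullet> i) * (z \<bullet> j) * A i j)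
      = (\<Sum>i\<in>Basis. \<Sum>j\<in>Basis. ((z \<bullet> i) * snd i) * ((z \<bullet> j) * snd j) * \<kappa>)
        - (\<Sum>i\<in>Basis. \<Sum>j\<in>Basis. (LINT x|gauss. ((z \<bullet> i) * g i x) * ((z \<bullet> j) * g j x)))"
      unfolding A_eq sum_subtractf[symmetric]
      by (intro sum.cong refl) (simp add: algebra_simps flip: integral_mult_right_zero)
    also have "(\<Sum>i\<in>Basis. \<Sum>j\<in>Basis. ((z \<bullet> i) * snd i) * ((z \<bullet> j) * snd j) * \<kappa>) = (snd z)\<^sup>2 * \<kappa>"
      unfolding reps[symmetric] power2_eq_square by (simp only: sum_distrib_right[symmetric] sum_product[symmetric])
    also have "(\<Sum>i\<in>Basis. \<Sum>j\<in>Basis. (LINT x|gauss. ((z \<bullet> i) * g i x) * ((z \<bullet> j) * g j x)))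
        = (LINT x|gauss. (\<Sum>i\<in>Basis. \<Sum>j\<in>Basis. ((z \<bullet> i) * g i x) * ((z \<bullet> j) * g j x)))"
    proof -
      have i: "integrable gauss (\<lambda>x. ((z \<bullet> i) * g i x) * ((z \<bullet> j) * g j x))" for i j
        using integrable_mult_right[OF gg[of i j], of "(z \<bullet> i) * (z \<bullet> j)"] by (simp add: mult_ac)
      show ?thesis using i by simp
    qed
    also have "\<dots> = (LINT x|gauss. g z x * g z x)"
      unfolding rep[symmetric] by (simp add: sum_product)
    finally have eq: "(\<Sum>i\<in>Basis. \<Sum>j\<in>Basis. (z \<bullet> i) * (z \<bullet> j) * A i j) = (snd z)\<^sup>2 * \<kappa> - (LINT x|gauss. g z x * g z x)" .
    have g0: "(LINT x|gauss. g z x * g z x) \<ge> 0" by (rule Bochner_Integration.integral_nonneg) simp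
    \<comment> \<open>A nonzero real component is settled by \<open>\<kappa> < 0\<close>; otherwise
      the first component \<open>e \<noteq> 0\<close> lies in the span, so \<open>v e\<close> is not
      identically 0 and its norm is positive.\<close>
    show ?thesis
    proof (cases "snd z = 0")
      case True
      then have "fst z \<noteq> 0" "fst z \<in> grad_span" using z by (auto simp: S_def prod_eq_iff)
      then obtain x where "v (fst z) x \<noteq> 0" using v_eq_0_imp by blast
      then have "g z x * g z x \<noteq> 0" using True by (simp add: g_def)
      then have "(LINT x|gauss. g z x * g z x) > 0"
        by (intro integral_gauss_pos[OF gg] continuous_intros gc) auto
      then show ?thesis using eq True by simp
    next
      case False
      then have "(snd z)\<^sup>2 * \<kappa> < 0" using neg by (simp add: \<kappa>_def mult_pos_neg)
      then show ?thesis using eq g0 by linarith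
    qed
  qed
  have "\<forall>\<^sub>F R in sequentially. \<forall>z\<in>S. z \<noteq> 0 \<longrightarrow> (\<Sum>i\<in>Basis. \<Sum>j\<in>Basis. (z \<bullet> i) * (z \<bullet> j) * AR R i j) < 0"
    by (rule eventually_negative_form[OF lim2 S A_neg])
  moreover have "\<forall>\<^sub>F R in sequentially. real R \<ge> \<rho>"
    using filterlim_real_sequentially by (simp add: filterlim_at_top)
  ultimately have "\<forall>\<^sub>F R in sequentially. (\<forall>z\<in>S. z \<noteq> 0 \<longrightarrow> (\<Sum>i\<in>Basis. \<Sum>j\<in>Basis. (z \<bullet> i) * (z \<bullet> j) * AR R i j) < 0) \<and> real R \<ge> \<rho>"
    by (rule eventually_conj)
  \<comment> \<open>The radius is fixed before \<open>m\<close> is chosen, because the energies of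
    the quotients converge only for a fixed cutoff.\<close>
  then obtain R where R: "\<And>z. z \<in> S \<Longrightarrow> z \<noteq> 0 \<Longrightarrow> (\<Sum>i\<in>Basis. \<Sum>j\<in>Basis. (z \<bullet> i) * (z \<bullet> j) * AR R i j) < 0"
      "real R \<ge> \<rho>"
    using eventually_happens by fastforce
  have "\<forall>\<^sub>F m in sequentially. \<forall>z\<in>S. z \<noteq> 0 \<longrightarrow>
      (\<Sum>i\<in>Basis. \<Sum>j\<in>Basis. (z \<bullet> i) * (z \<bullet> j) * energy c (P R m i) (P R m j)) < 0"
    by (rule eventually_negative_form[OF lim1[OF R(2)] S R(1)])
  then obtain m where m: "\<And>z. z \<in> S \<Longrightarrow> z \<noteq> 0 \<Longrightarrow>
      (\<Sum>i\<in>Basis. \<Sum>j\<in>Basis. (z \<bullet> i) * (z \<bullet> j) * energy c (P R m i) (P R m j)) < 0"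
    using eventually_happens by fastforce
  define \<xi> where "\<xi> z = (\<lambda>x. \<Sum>i\<in>Basis. (z \<bullet> i) * P R m i x)" for z :: "'a \<times> real"
  have \<xi>c: "\<xi> z \<in> C1c" for z
    unfolding \<xi>_def by (intro C1c_sum C1c_mult' Pc C1_const finite_Basis)
  have lin: "linear \<xi>"
    by (rule linearI) (auto simp: \<xi>_def fun_eq_iff scaleR_fun_def inner_add_left algebra_simps
        sum.distrib sum_distrib_left)
  have Qneg: "Q f u (\<xi> z) < 0" if "z \<in> S" "z \<noteq> 0" for z
  proof -
    have "Q f u (\<xi> z) = energy c (\<xi> z) (\<xi> z)"
      using Q_eq_energy[OF \<xi>c, of f u z] continuous_c by (simp add: c_def[abs_def])
    also have "\<dots> < 0" unfolding \<xi>_def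
      using m[OF that] Pc continuous_c by (subst energy_sum) auto
    finally show ?thesis .
  qed
  have inj: "inj_on \<xi> S"
    unfolding linear_injective_on_subspace_0[OF lin S]
  proof (intro ballI impI)
    fix z assume z: "z \<in> S" "\<xi> z = 0"
    have "Q f u (\<xi> z) = energy c (\<lambda>x. 0) (\<lambda>x. 0)"
      using Q_eq_energy[OF \<xi>c, of f u z] continuous_c z(2) by (simp add: c_def[abs_def] zero_fun_def)
    then show "z = 0" using Qneg[OF z(1)] by (auto simp: energy_zero)
  qed
  have "negative_subspace f u (\<xi> ` S)"
    unfolding negative_subspace_def
  proof (intro conjI ballI)
    show "subspace (\<xi> ` S)" by (rule linear_subspace_image[OF lin S])
    show "\<xi> ` S \<subseteq> H1_gauss" using C1c_H1_gauss[OF \<xi>c] by blast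
    fix p assume "p \<in> \<xi> ` S - {0}"
    then obtain z where "z \<in> S" "p = \<xi> z" "\<xi> z \<noteq> 0" by blast
    moreover from this have "z \<noteq> 0" using linear_0[OF lin] by blast
    ultimately show "Q f u p < 0" using Qneg by blast
  qed
  then have "dim (\<xi> ` S) \<le> k"
    using morse unfolding morse_index_def has_dimension_def by blast
  \<comment> \<open>The image lies in a function space that is not Euclidean, so the equality of
    dimensions is derived from a basis of \<open>S\<close>.\<close>
  moreover have "dim (\<xi> ` S) = dim S"
  proof -
    obtain B where B: "B \<subseteq> S" "independent B" "S \<subseteq> span B" "card B = dim S"
      by (rule basis_exists)
    have spB: "span B = S" using B S by (metis span_subspace)
    have "independent (\<xi> ` B)"
      using lin B(2) inj unfolding spB[symmetric] by (rule linear_independent_injective_image)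
    moreover have "span (\<xi> ` B) = span (\<xi> ` S)"
      using linear_span_image[OF lin, of B] spB span_eq_iff[of "\<xi> ` S"] linear_subspace_image[OF lin S] by metis
    ultimately have "dim (\<xi> ` S) = card (\<xi> ` B)" by (intro dim_eq_card) auto
    then show ?thesis using B inj by (metis card_image inj_on_subset)
  qed
  moreover have "dim S = dim grad_span + 1"
    unfolding S_def using dim_Times[of grad_span "UNIV :: real set"] by (simp add: grad_span_def)
  ultimately show ?thesis by simp
qed

section \<open>Absolute values of the directional derivatives\<close>

text \<open>Subtracting \<open>d\<close> makes the smoothed absolute value vanish at 0, so that
  composition with it preserves compact support; slope at most 1 means that it does not increase the
  norm of a gradient.\<close>

lemma sqrt_regularization:
  fixes d :: real
  assumes "d > 0"
  shows "\<bar>sqrt (t\<^sup>2 + d\<^sup>2) - d\<bar> \<le> \<bar>t\<bar>" "\<bar>t / sqrt (t\<^sup>2 + d\<^sup>2)\<bar> \<le> 1"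
    "DERIV (\<lambda>t. sqrt (t\<^sup>2 + d\<^sup>2) - d) t :> t / sqrt (t\<^sup>2 + d\<^sup>2)"
proof -
  have pos: "t\<^sup>2 + d\<^sup>2 > 0" using assms by (simp add: add_nonneg_pos)
  have "sqrt (t\<^sup>2 + d\<^sup>2) \<le> \<bar>t\<bar> + \<bar>d\<bar>" by (rule sqrt_sum_squares_le_sum_abs)
  moreover have "d \<le> sqrt (t\<^sup>2 + d\<^sup>2)" using real_sqrt_sum_squares_ge2[of d t] by simp
  ultimately show "\<bar>sqrt (t\<^sup>2 + d\<^sup>2) - d\<bar> \<le> \<bar>t\<bar>" using assms by linarith
  have "\<bar>t\<bar> \<le> sqrt (t\<^sup>2 + d\<^sup>2)" by (simp add: real_le_rsqrt)
  then show "\<bar>t / sqrt (t\<^sup>2 + d\<^sup>2)\<bar> \<le> 1" using pos by (simp add: abs_divide divide_le_eq)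
  have D: "DERIV (\<lambda>t. sqrt (t\<^sup>2 + d\<^sup>2)) t :> inverse (sqrt (t\<^sup>2 + d\<^sup>2)) / 2 * (2 * t)"
  proof (rule DERIV_chain2[where f = sqrt and g = "\<lambda>t. t\<^sup>2 + d\<^sup>2"])
    show "DERIV sqrt (t\<^sup>2 + d\<^sup>2) :> inverse (sqrt (t\<^sup>2 + d\<^sup>2)) / 2" by (rule DERIV_real_sqrt[OF pos])
    show "DERIV (\<lambda>t. t\<^sup>2 + d\<^sup>2) t :> 2 * t"
      using DERIV_add[OF DERIV_pow[of 2 t] DERIV_const[of "d\<^sup>2"]] by simp
  qed
  have "inverse s / 2 * (2 * t) - 0 = t / s" for s :: real
    by (cases "s = 0") (simp_all add: field_simps)
  then show "DERIV (\<lambda>t. sqrt (t\<^sup>2 + d\<^sup>2) - d) t :> t / sqrt (t\<^sup>2 + d\<^sup>2)"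
    using DERIV_diff[OF D DERIV_const[of d]] by (simp only:)
qed

text \<open>If the form is nonnegative, then \<open>v e\<close> minimizes it with value \<open>0\<close>, and so does \<open>\<bar>v e\<bar>\<close>; the
  latter is therefore a weak solution of the linearized equation. The approximating sequence consists of
  smoothed absolute values of truncated difference quotients.\<close>

lemma abs_v_truncated_bound:
  assumes nonneg: "\<And>\<phi>. \<phi> \<in> C1c \<Longrightarrow> 0 \<le> energy (\<lambda>x. c x - 1) \<phi> \<phi>"
    and \<psi>: "\<psi> \<in> C1c" and \<theta>: "\<theta> \<in> C1c" and g: "\<And>x. grad \<psi> x = - (\<theta> x *\<^sub>R (x - y))"
    and \<eta>: "\<eta> \<in> C1c" "\<And>x. 0 \<le> \<eta> x"
  defines "H \<equiv> \<lambda>x. real (DIM('a)) * \<theta> x + (x - y) \<bullet> grad \<theta> x - \<theta> x * (x \<bullet> (x - y)) + (1 - c x) * \<psi> x"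
  shows "(LINT x|gauss. H x * (\<bar>v e x\<bar> * \<eta> x))\<^sup>2
    \<le> (LINT x|gauss. v e x * v e x * (norm (grad \<eta> x))\<^sup>2) * energy (\<lambda>x. c x - 1) \<psi> \<psi>"
proof -
  define c' where "c' = (\<lambda>x. c x - 1)"
  have c': "continuous_on UNIV c'" unfolding c'_def by (intro continuous_intros continuous_c)
  define d where "d m = 1 / real (Suc m)" for m
  have d: "d m > 0" for m by (simp add: d_def)
  define q where "q m x = dq e m u x * \<eta> x" for m x
  have q: "q m \<in> C1c" for m unfolding q_def by (intro C1c_mult' \<eta> C1_dq u_C1)
  define h where "h m t = sqrt (t\<^sup>2 + (d m)\<^sup>2) - d m" for m t
  define h' where "h' m t = t / sqrt (t\<^sup>2 + (d m)\<^sup>2)" for m t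
  have h: "\<bar>h m t\<bar> \<le> \<bar>t\<bar>" "\<bar>h' m t\<bar> \<le> 1" "DERIV (h m) t :> h' m t" for m t
    using sqrt_regularization[OF d[of m], of t] by (auto simp: h_def[abs_def] h'_def)
  have h'c: "continuous_on UNIV (h' m)" for m
  proof -
    have "sqrt (t\<^sup>2 + (d m)\<^sup>2) \<noteq> 0" for t using d[of m] by (simp add: add_nonneg_eq_0_iff)
    then show ?thesis unfolding h'_def by (intro continuous_intros) auto
  qed
  define n where "n m x = h m (q m x)" for m x
  have n: "n m \<in> C1c" for m
    unfolding n_def by (rule C1c_compose[OF q h(3) h'c]) (use d[of m] in \<open>simp add: h_def\<close>)
  have gn: "grad (n m) x = h' m (q m x) *\<^sub>R grad (q m) x" for m x
    unfolding n_def by (intro grad_compose h(3) C1c_C1 q)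
  have lbq: "lb_conv q (\<lambda>x. v e x * \<eta> x)"
    unfolding q_def by (intro lb_conv_mult lb_conv_v lb_conv_const C1_continuous C1c_C1 \<eta>)
  have lbn: "lb_conv n (\<lambda>x. \<bar>v e x\<bar> * \<eta> x)"
  proof (rule lb_convI)
    show "n m \<in> borel_measurable borel" for m by (intro C1_measurable C1c_C1 n)
    show "\<exists>B. \<forall>m x. norm x \<le> R \<longrightarrow> \<bar>n m x\<bar> \<le> B" for R
      using lbq h(1) unfolding lb_conv_def n_def by (meson order_trans)
    fix x
    have "(\<lambda>m. q m x) \<longlonglongrightarrow> v e x * \<eta> x" using lbq by (simp add: lb_conv_def)
    moreover have "d \<longlonglongrightarrow> 0" unfolding d_def by (rule LIMSEQ_Suc[OF lim_1_over_n])
    ultimately have "(\<lambda>m. n m x) \<longlonglongrightarrow> sqrt ((v e x * \<eta> x)\<^sup>2 + 0\<^sup>2) - 0"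
      unfolding n_def h_def by (intro tendsto_intros)
    then show "(\<lambda>m. n m x) \<longlonglongrightarrow> \<bar>v e x\<bar> * \<eta> x" using \<eta>(2)[of x] by (simp add: abs_mult)
  qed
  obtain \<rho> where \<rho>: "\<rho> > 0" "\<And>x. norm x \<ge> \<rho> \<Longrightarrow> \<eta> x = 0" using C1c_bounded_support[OF \<eta>(1)] by blast
  \<comment> \<open>\<open>1 - c\<close> need not have compact support; multiplied by a
    \<open>\<zeta>\<close> that is 1 wherever \<open>\<eta>\<close> is nonzero it becomes an
    admissible weight for \<open>integral_lb_conv\<close>.\<close>
  obtain \<zeta> :: "'a \<Rightarrow> real" where \<zeta>: "\<zeta> \<in> C1c" "\<And>x. norm x \<le> \<rho> \<Longrightarrow> \<zeta> x = 1"
    using cutoff_family[where 'a = 'a] \<rho>(1) by metis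
  have \<zeta>\<eta>: "\<zeta> x = 1 \<or> \<eta> x = 0" for x using \<rho>(2)[of x] \<zeta>(2)[of x] by (cases "norm x \<le> \<rho>") auto
  have pc: "ccs (\<lambda>x. \<zeta> x * (1 - c x))" by (intro ccs_mult ccs_C1c \<zeta> continuous_intros continuous_c)
  define err where "err m = (LINT x|gauss. (\<zeta> x * (1 - c x)) * (n m x * n m x - q m x * q m x))" for m
  have lbd: "lb_conv (\<lambda>m x. n m x * n m x - q m x * q m x) (\<lambda>x. (\<bar>v e x\<bar> * \<eta> x) * (\<bar>v e x\<bar> * \<eta> x) - (v e x * \<eta> x) * (v e x * \<eta> x))"
    by (intro lb_conv_diff lb_conv_mult lbn lbq)
  have lim0: "(\<bar>v e x\<bar> * \<eta> x) * (\<bar>v e x\<bar> * \<eta> x) - (v e x * \<eta> x) * (v e x * \<eta> x) = 0" for x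
    using abs_mult_self_eq[of "v e x"] by algebra
  then have err_lim: "err \<longlonglongrightarrow> 0"
    using integral_lb_conv(1)[OF lbd pc] unfolding err_def lim0 by simp
  \<comment> \<open>Smoothing does not increase the gradient part. The zeroth order part changes by
    \<open>err m\<close>, which tends to 0 because \<open>n m\<close> and \<open>q m\<close> have
    limits with equal squares.\<close>
  have energy_n: "energy c' (n m) (n m) \<le> energy c' (q m) (q m) + err m" for m
  proof -
    define D where "D x = (\<zeta> x * (1 - c x)) * (n m x * n m x - q m x * q m x)" for x
    have D: "D x = (1 - c x) * (n m x * n m x - q m x * q m x)" for x
      using \<zeta>\<eta>[of x] d[of m] by (auto simp: D_def n_def q_def h_def)
    have iD: "integrable gauss D" unfolding D_def by (rule integral_lb_conv(2)[OF lbd pc])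
    have i: "integrable gauss (\<lambda>x. grad (n m) x \<bullet> grad (n m) x - c' x * n m x * n m x)"
        "integrable gauss (\<lambda>x. grad (q m) x \<bullet> grad (q m) x - c' x * q m x * q m x)"
      by (intro integrable_gauss energy_integrand_ccs n q C1c_C1 c')+
    have "grad (n m) x \<bullet> grad (n m) x \<le> grad (q m) x \<bullet> grad (q m) x" for x
    proof -
      have "norm (grad (n m) x) \<le> 1 * norm (grad (q m) x)"
        unfolding gn norm_scaleR real_norm_def by (intro mult_right_mono h) simp
      then show ?thesis by (simp add: norm_le)
    qed
    then have "grad (n m) x \<bullet> grad (n m) x - c' x * n m x * n m x
       \<le> (grad (q m) x \<bullet> grad (q m) x - c' x * q m x * q m x) + D x" for x
      by (simp add: D c'_def algebra_simps)
    then have "energy c' (n m) (n m) \<le> (LINT x|gauss. (grad (q m) x \<bullet> grad (q m) x - c' x * q m x * q m x) + D x)"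
      unfolding energy_def using i iD by (intro integral_mono) auto
    also have "\<dots> = energy c' (q m) (q m) + (LINT x|gauss. D x)"
      using i iD by (simp add: energy_def)
    also have "(LINT x|gauss. D x) = err m" by (simp only: err_def D_def)
    finally show ?thesis .
  qed
  \<comment> \<open>The shift of the potential by 1 adds the integral of the squared truncated
    quotient, whose limit cancels the \<open>- \<eta>\<^sup>2\<close> of
    \<open>energy_dq_tendsto\<close>; only the slope of the cutoff remains.\<close>
  have q_lim: "(\<lambda>m. energy c' (q m) (q m)) \<longlonglongrightarrow> (LINT x|gauss. v e x * v e x * (norm (grad \<eta> x))\<^sup>2)"
  proof -
    have \<eta>\<eta>: "ccs (\<lambda>x. \<eta> x * \<eta> x)" by (intro ccs_mult ccs_C1c \<eta> C1_continuous C1c_C1)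
    have gg: "ccs (\<lambda>x. (norm (grad \<eta> x))\<^sup>2)" unfolding power2_norm_eq_inner
      by (intro ccs_inner ccs_C1c \<eta> C1_grad_continuous C1c_C1)
    have lbd: "lb_conv (\<lambda>m x. dq e m u x * dq e m u x) (\<lambda>x. v e x * v e x)"
      by (intro lb_conv_mult lb_conv_v)
    have e: "energy c' (q m) (q m) = energy c (q m) (q m) + (LINT x|gauss. (\<eta> x * \<eta> x) * (dq e m u x * dq e m u x))" for m
    proof -
      have "energy c' (q m) (q m) = (LINT x|gauss. (grad (q m) x \<bullet> grad (q m) x - c x * q m x * q m x)
          + (\<eta> x * \<eta> x) * (dq e m u x * dq e m u x))"
        unfolding energy_def c'_def q_def by (intro Bochner_Integration.integral_cong) (auto simp: algebra_simps)
      also have "\<dots> = energy c (q m) (q m) + (LINT x|gauss. (\<eta> x * \<eta> x) * (dq e m u x * dq e m u x))"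
        unfolding energy_def
        by (intro Bochner_Integration.integral_add integral_lb_conv(2)[OF lbd \<eta>\<eta>] integrable_gauss
            energy_integrand_ccs q C1c_C1 continuous_c)
      finally show ?thesis .
    qed
    have "(\<lambda>m. energy c' (q m) (q m)) \<longlonglongrightarrow> (LINT x|gauss. v e x * v e x * ((norm (grad \<eta> x))\<^sup>2 - (\<eta> x)\<^sup>2))
        + (LINT x|gauss. (\<eta> x * \<eta> x) * (v e x * v e x))"
      unfolding e unfolding q_def
      by (intro tendsto_add energy_dq_tendsto \<eta> integral_lb_conv(1)[OF lbd \<eta>\<eta>])
    also have "(LINT x|gauss. v e x * v e x * ((norm (grad \<eta> x))\<^sup>2 - (\<eta> x)\<^sup>2)) + (LINT x|gauss. (\<eta> x * \<eta> x) * (v e x * v e x))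
      = (LINT x|gauss. v e x * v e x * ((norm (grad \<eta> x))\<^sup>2 - (\<eta> x)\<^sup>2) + (\<eta> x * \<eta> x) * (v e x * v e x))"
      by (intro Bochner_Integration.integral_add[symmetric] integrable_gauss ccs_mult \<eta>\<eta> ccs_mult' ccs_diff gg
          continuous_intros continuous_v) (simp add: power2_eq_square \<eta>\<eta>)
    also have "\<dots> = (LINT x|gauss. v e x * v e x * (norm (grad \<eta> x))\<^sup>2)"
      by (intro Bochner_Integration.integral_cong) (auto simp: power2_eq_square algebra_simps)
    finally show ?thesis .
  qed
  have Hc: "ccs H" unfolding H_def
    by (intro ccs_add ccs_diff ccs_mult' ccs_mult ccs_inner' ccs_C1c \<theta> \<psi> continuous_intros continuous_c)
  \<comment> \<open>The derivative is moved from \<open>n m\<close>, whose gradients need not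
    converge, to \<open>\<theta>\<close>; afterwards pointwise convergence of \<open>n m\<close>
    suffices.\<close>
  have en: "energy c' (n m) \<psi> = (LINT x|gauss. H x * n m x)" for m
  proof -
    define F where "F x = real (DIM('a)) * \<theta> x + (x - y) \<bullet> grad \<theta> x - \<theta> x * (x \<bullet> (x - y))" for x
    have Fc: "ccs F" unfolding F_def
      by (intro ccs_add ccs_diff ccs_mult' ccs_mult ccs_inner' ccs_C1c \<theta> continuous_intros)
    have nc: "continuous_on UNIV (n m)" by (intro C1_continuous C1c_C1 n)
    have i1: "integrable gauss (\<lambda>x. \<theta> x * ((x - y) \<bullet> grad (n m) x))"
      by (intro integrable_gauss ccs_mult ccs_C1c \<theta> continuous_intros C1_grad_continuous_on C1c_C1 n)
    have i2: "integrable gauss (\<lambda>x. (1 - c x) * \<psi> x * n m x)"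
      by (intro integrable_gauss ccs_mult ccs_mult' ccs_C1c \<psi> continuous_intros continuous_c nc)
    have i3: "integrable gauss (\<lambda>x. n m x * F x)" by (intro integrable_gauss ccs_mult' Fc nc)
    have "energy c' (n m) \<psi> = (LINT x|gauss. - (\<theta> x * ((x - y) \<bullet> grad (n m) x)) + (1 - c x) * \<psi> x * n m x)"
      unfolding energy_def c'_def g
      by (intro Bochner_Integration.integral_cong) (auto simp: inner_commute algebra_simps)
    also have "\<dots> = - (LINT x|gauss. \<theta> x * ((x - y) \<bullet> grad (n m) x)) + (LINT x|gauss. (1 - c x) * \<psi> x * n m x)"
      using i1 i2 by simp
    also have "\<dots> = (LINT x|gauss. n m x * F x) + (LINT x|gauss. (1 - c x) * \<psi> x * n m x)"
      using integral_radial_by_parts[OF C1c_C1[OF n[of m]] \<theta>, of y] by (simp add: F_def)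
    also have "\<dots> = (LINT x|gauss. n m x * F x + (1 - c x) * \<psi> x * n m x)"
      using i2 i3 by simp
    also have "\<dots> = (LINT x|gauss. H x * n m x)"
      by (intro Bochner_Integration.integral_cong) (auto simp: H_def F_def algebra_simps)
    finally show ?thesis .
  qed
  have "(energy c' (n m) \<psi>)\<^sup>2 \<le> (energy c' (q m) (q m) + err m) * energy c' \<psi> \<psi>" for m
  proof -
    have "(energy c' (n m) \<psi>)\<^sup>2 \<le> energy c' (n m) (n m) * energy c' \<psi> \<psi>"
      using nonneg by (intro energy_Cauchy_Schwarz c' n \<psi>) (simp add: c'_def)
    also have "\<dots> \<le> (energy c' (q m) (q m) + err m) * energy c' \<psi> \<psi>"
      using nonneg[OF \<psi>] by (intro mult_right_mono energy_n) (simp add: c'_def)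
    finally show ?thesis .
  qed
  moreover have "(\<lambda>m. (energy c' (n m) \<psi>)\<^sup>2) \<longlonglongrightarrow> (LINT x|gauss. H x * (\<bar>v e x\<bar> * \<eta> x))\<^sup>2"
    unfolding en by (intro tendsto_power integral_lb_conv(1)[OF lbn Hc])
  moreover have "(\<lambda>m. (energy c' (q m) (q m) + err m) * energy c' \<psi> \<psi>)
      \<longlonglongrightarrow> ((LINT x|gauss. v e x * v e x * (norm (grad \<eta> x))\<^sup>2) + 0) * energy c' \<psi> \<psi>"
    by (intro tendsto_mult tendsto_add tendsto_const q_lim err_lim)
  ultimately show ?thesis
    unfolding c'_def[symmetric] by (metis (no_types, lifting) LIMSEQ_le add.right_neutral)
qed

text \<open>As \<open>v e\<close> is square integrable and the cutoff has slope at most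
  \<open>C / (R + 1)\<close>, the right-hand side of the truncated bound decays like
  \<open>1 / (R + 1)\<^sup>2\<close>, while the left-hand side is constant once the cutoff is 1 on
  the support of \<open>H\<close>.\<close>

lemma abs_v_equation:
  assumes nonneg: "\<And>\<phi>. \<phi> \<in> C1c \<Longrightarrow> 0 \<le> energy (\<lambda>x. c x - 1) \<phi> \<phi>"
    and \<psi>: "\<psi> \<in> C1c" and \<theta>: "\<theta> \<in> C1c" and g: "\<And>x. grad \<psi> x = - (\<theta> x *\<^sub>R (x - y))"
  defines "H \<equiv> \<lambda>x. real (DIM('a)) * \<theta> x + (x - y) \<bullet> grad \<theta> x - \<theta> x * (x \<bullet> (x - y)) + (1 - c x) * \<psi> x"
  shows "(LINT x|gauss. H x * \<bar>v e x\<bar>) = 0"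
proof -
  define I where "I = (LINT x|gauss. H x * \<bar>v e x\<bar>)"
  obtain C and \<eta> :: "nat \<Rightarrow> 'a \<Rightarrow> real" where \<eta>: "C > 0" "\<And>R. \<eta> R \<in> C1c" "\<And>R x. 0 \<le> \<eta> R x \<and> \<eta> R x \<le> 1"
    "\<And>R x. norm x < real (Suc R) \<Longrightarrow> \<eta> R x = 1 \<and> grad (\<eta> R) x = 0"
    "\<And>R x. norm (grad (\<eta> R) x) \<le> C / real (Suc R)"
    by (rule cutoff_sequence) blast
  have Hc: "ccs H" unfolding H_def
    by (intro ccs_add ccs_diff ccs_mult' ccs_mult ccs_inner' ccs_C1c \<theta> \<psi> continuous_intros continuous_c)
  then obtain \<rho> where \<rho>: "\<And>x. norm x \<ge> \<rho> \<Longrightarrow> H x = 0" unfolding ccs_def by blast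
  define K where "K = (LINT x|gauss. v e x * v e x)"
  define E where "E = energy (\<lambda>x. c x - 1) \<psi> \<psi>"
  have E0: "E \<ge> 0" unfolding E_def by (rule nonneg[OF \<psi>])
  have le: "I\<^sup>2 \<le> (C / real (Suc R))\<^sup>2 * K * E" if R: "real R \<ge> \<rho>" for R
  proof -
    have "(\<lambda>x. H x * (\<bar>v e x\<bar> * \<eta> R x)) = (\<lambda>x. H x * \<bar>v e x\<bar>)"
    proof
      fix x
      show "H x * (\<bar>v e x\<bar> * \<eta> R x) = H x * \<bar>v e x\<bar>"
        using \<rho>[of x] \<eta>(4)[of x R] R by (cases "norm x \<ge> \<rho>") auto
    qed
    moreover have "(LINT x|gauss. H x * (\<bar>v e x\<bar> * \<eta> R x))\<^sup>2
      \<le> (LINT x|gauss. v e x * v e x * (norm (grad (\<eta> R) x))\<^sup>2) * E"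
      unfolding H_def E_def using \<eta>(3)
      by (intro abs_v_truncated_bound[OF nonneg \<psi> \<theta> g]) (auto intro: \<eta>(2))
    ultimately have "I\<^sup>2 \<le> (LINT x|gauss. v e x * v e x * (norm (grad (\<eta> R) x))\<^sup>2) * E"
      by (simp add: I_def)
    also have "(LINT x|gauss. v e x * v e x * (norm (grad (\<eta> R) x))\<^sup>2) \<le> (LINT x|gauss. (C / real (Suc R))\<^sup>2 * (v e x * v e x))"
    proof (rule integral_mono)
      have "ccs (\<lambda>x. (norm (grad (\<eta> R) x))\<^sup>2)" unfolding power2_norm_eq_inner
        by (intro ccs_inner ccs_C1c \<eta>(2) C1_grad_continuous C1c_C1)
      then show "integrable gauss (\<lambda>x. v e x * v e x * (norm (grad (\<eta> R) x))\<^sup>2)"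
        by (intro integrable_gauss ccs_mult' continuous_intros continuous_v)
      show "integrable gauss (\<lambda>x. (C / real (Suc R))\<^sup>2 * (v e x * v e x))"
        by (intro integrable_mult_right v_square_integrable)
      fix x
      have "(norm (grad (\<eta> R) x))\<^sup>2 \<le> (C / real (Suc R))\<^sup>2"
        by (intro power_mono \<eta>(5)) simp
      then have "v e x * v e x * (norm (grad (\<eta> R) x))\<^sup>2 \<le> v e x * v e x * (C / real (Suc R))\<^sup>2"
        by (rule mult_left_mono) simp
      then show "v e x * v e x * (norm (grad (\<eta> R) x))\<^sup>2 \<le> (C / real (Suc R))\<^sup>2 * (v e x * v e x)"
        by (simp only: mult.commute)
    qed
    also have "\<dots> = (C / real (Suc R))\<^sup>2 * K" by (simp add: K_def)
    finally show ?thesis using E0 by (simp add: mult_right_mono)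
  qed
  have "(\<lambda>R. C * (1 / real (Suc R))) \<longlonglongrightarrow> C * 0"
    by (intro tendsto_mult tendsto_const LIMSEQ_Suc[OF lim_1_over_n])
  then have "(\<lambda>R. (C / real (Suc R))\<^sup>2 * K * E) \<longlonglongrightarrow> 0\<^sup>2 * K * E"
    by (intro tendsto_mult tendsto_power tendsto_const) simp
  then have lim: "(\<lambda>R. (C / real (Suc R))\<^sup>2 * K * E) \<longlonglongrightarrow> 0" by simp
  obtain R0 :: nat where "\<rho> \<le> real R0" using real_arch_simple by blast
  then have "\<exists>N. \<forall>R\<ge>N. I\<^sup>2 \<le> (C / real (Suc R))\<^sup>2 * K * E"
    by (intro exI[of _ R0] allI impI le) linarith
  then have "I\<^sup>2 \<le> 0" by (rule LIMSEQ_le_const[OF lim])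
  then show ?thesis by (simp add: I_def)
qed

text \<open>Otherwise the strong maximum principle applies to \<open>\<bar>v e\<bar>\<close> for some \<open>e \<noteq> 0\<close> in the span that is
  orthogonal to \<open>grad u 0\<close>.\<close>

lemma exists_negative_direction:
  assumes "dim grad_span \<ge> 2"
  shows "\<exists>\<phi>\<in>C1c. energy (\<lambda>x. c x - 1) \<phi> \<phi> < 0"
proof (rule ccontr)
  assume "\<not> ?thesis"
  then have nonneg: "0 \<le> energy (\<lambda>x. c x - 1) \<phi> \<phi>" if "\<phi> \<in> C1c" for \<phi> using that by force
  obtain e where e: "e \<in> grad_span" "e \<noteq> 0" "v e 0 = 0"
  proof -
    have d1: "dim (span {grad u 0}) \<le> 1" by (simp add: dim_insert)
    have spW: "span grad_span = grad_span" unfolding grad_span_def by (rule span_span)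
    have "span {grad u 0} \<noteq> grad_span"
    proof
      assume "span {grad u 0} = grad_span"
      with d1 have "dim grad_span \<le> 1" by metis
      with assms show False by simp
    qed
    moreover have "span {grad u 0} \<subseteq> grad_span" unfolding grad_span_def by (intro span_mono) auto
    ultimately have "span {grad u 0} \<subset> span grad_span" unfolding spW by blast
    then obtain e where e: "e \<noteq> 0" "e \<in> span grad_span" "\<And>y. y \<in> span {grad u 0} \<Longrightarrow> orthogonal e y"
      by (rule orthogonal_to_subspace_exists_gen) blast
    have "orthogonal e (grad u 0)" by (intro e span_base) simp
    then show ?thesis using that[of e] e spW by (simp add: v_def orthogonal_def)
  qed
  obtain M where M: "M \<ge> 0" "\<And>x. \<bar>c x\<bar> \<le> M" using c_bounded by blast
  have "\<bar>v e x\<bar> = 0" for x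
  proof (rule strong_maximum_principle[of "\<lambda>x. \<bar>v e x\<bar>" "M + 1" 0 x])
    show "continuous_on UNIV (\<lambda>x. \<bar>v e x\<bar>)" by (intro continuous_intros continuous_v)
    show "0 \<le> M + 1" using M by simp
    show "\<bar>v e 0\<bar> = 0" using e by simp
    fix y :: 'a and \<psi> \<theta> :: "'a \<Rightarrow> real"
    assume t: "\<psi> \<in> C1c" "\<theta> \<in> C1c" "\<And>x. 0 \<le> \<psi> x" "\<And>x. grad \<psi> x = - (\<theta> x *\<^sub>R (x - y))"
    define F where "F x = real (DIM('a)) * \<theta> x + (x - y) \<bullet> grad \<theta> x - \<theta> x * (x \<bullet> (x - y))" for x
    have Fc: "ccs F" unfolding F_def
      by (intro ccs_add ccs_diff ccs_mult' ccs_mult ccs_inner' ccs_C1c t continuous_intros)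
    have i1: "integrable gauss (\<lambda>x. (F x + (1 - c x) * \<psi> x) * \<bar>v e x\<bar>)"
      by (intro integrable_gauss ccs_mult ccs_add ccs_mult' Fc ccs_C1c t continuous_intros continuous_c continuous_v)
    have i2: "integrable gauss (\<lambda>x. \<bar>v e x\<bar> * (F x + (M + 1) * \<psi> x))"
      by (intro integrable_gauss ccs_add ccs_mult' Fc ccs_C1c t continuous_intros continuous_v)
    have "0 = (LINT x|gauss. (F x + (1 - c x) * \<psi> x) * \<bar>v e x\<bar>)"
      unfolding F_def by (rule abs_v_equation[OF nonneg t(1,2,4), symmetric])
    also have "\<dots> \<le> (LINT x|gauss. \<bar>v e x\<bar> * (F x + (M + 1) * \<psi> x))"
    proof (rule integral_mono[OF i1 i2])
      fix x
      \<comment> \<open>The maximum principle has a constant zeroth order coefficient. Enlarging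
        \<open>1 - c x\<close> to \<open>M + 1\<close> keeps the inequality, because both
        \<open>\<psi>\<close> and the absolute value are nonnegative.\<close>
      have "1 - c x \<le> M + 1" using M(2)[of x] by linarith
      then have "(1 - c x) * \<psi> x \<le> (M + 1) * \<psi> x" using t(3) by (rule mult_right_mono)
      then have "\<bar>v e x\<bar> * (F x + (1 - c x) * \<psi> x) \<le> \<bar>v e x\<bar> * (F x + (M + 1) * \<psi> x)"
        by (intro mult_left_mono) auto
      then show "(F x + (1 - c x) * \<psi> x) * \<bar>v e x\<bar> \<le> \<bar>v e x\<bar> * (F x + (M + 1) * \<psi> x)"
        by (simp add: mult.commute)
    qed
    finally show "0 \<le> (LINT x|gauss. \<bar>v e x\<bar> * (real (DIM('a)) * \<theta> x + (x - y) \<bullet> grad \<theta> x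
        - \<theta> x * (x \<bullet> (x - y)) + (M + 1) * \<psi> x))"
      by (simp add: F_def)
  qed simp
  then show False using v_eq_0_imp[OF e(1)] e(2) by simp
qed

section \<open>From the dimension of the span to the number of variables\<close>

text \<open>The bound equals 1 for \<open>k \<le> 2\<close>, also where the subtraction truncates,
  and \<open>k - 1\<close> for \<open>k \<ge> 3\<close>; this is the source of the two cases of the
  theorem.\<close>

lemma dim_grad_span_le: "morse_index f u k \<Longrightarrow> dim grad_span \<le> max 1 (k - 1)"
  using exists_negative_direction negative_direction_increases_index by fastforce

text \<open>The segment from the projection \<open>p\<close> to \<open>x\<close> is orthogonal to
  \<open>grad_span\<close>, hence to the gradient at each of its points, and \<open>u\<close> is
  constant along it.\<close>

lemma u_factors:
  obtains B where "finite B" "card B = dim grad_span" "\<And>b. b \<in> B \<Longrightarrow> norm b = 1"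
    "\<And>x. u x = u (\<Sum>b\<in>B. (b \<bullet> x) *\<^sub>R b)"
proof -
  obtain B where B: "B \<subseteq> grad_span" "pairwise orthogonal B" "\<And>b. b \<in> B \<Longrightarrow> norm b = 1" "independent B"
    "card B = dim grad_span" "span B = grad_span"
    using orthonormal_basis_subspace[of grad_span] unfolding grad_span_def by (metis subspace_span)
  have fin: "finite B" using B(4) by (rule independent_imp_finite)
  have "u x = u (\<Sum>b\<in>B. (b \<bullet> x) *\<^sub>R b)" for x
  proof -
    define p where "p = (\<Sum>b\<in>B. (b \<bullet> x) *\<^sub>R b)"
    have "(x - p) \<bullet> b = 0" if b: "b \<in> B" for b
    proof -
      have "p \<bullet> b = (\<Sum>b'\<in>B. if b' = b then b \<bullet> x else 0)"
        unfolding p_def inner_sum_left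
      proof (rule sum.cong[OF refl])
        fix b' assume "b' \<in> B"
        then show "((b' \<bullet> x) *\<^sub>R b') \<bullet> b = (if b' = b then b \<bullet> x else 0)"
          using B(2) b B(3)[OF b] by (auto simp: pairwise_def orthogonal_def norm_eq_1)
      qed
      then have "p \<bullet> b = x \<bullet> b" using b fin by (simp add: inner_commute)
      then show ?thesis by (simp only: inner_diff_left)
    qed
    then have "orthogonal (x - p) y" if "y \<in> grad_span" for y
      using orthogonal_to_span[of y B "x - p"] that B(6) by (auto simp: orthogonal_def)
    then have "(x - p) \<bullet> grad u y = 0" for y
      by (auto simp: grad_span_def orthogonal_def intro: span_base)
    then have "DERIV (\<lambda>t. u (p + t *\<^sub>R (x - p))) t :> 0" for t
      using DERIV_along_line[OF u_C1, of p "x - p" t] by simp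
    then have "u (p + 1 *\<^sub>R (x - p)) = u (p + 0 *\<^sub>R (x - p))"
      by (intro DERIV_isconst_all) blast
    then show ?thesis by (simp add: p_def)
  qed
  then show ?thesis using that fin B(3,5) by blast
qed

end

theorem theorem3:
  fixes f :: "real \<Rightarrow> real" and u :: "real^'n \<Rightarrow> real" and k :: nat
  assumes "f C1_differentiable_on UNIV"
    and "u \<in> C1" and "u \<in> H1_gauss" and "bounded (range u)"
    and "weak_solution f u"
    and "morse_index f u k"
  shows "(k \<le> 2 \<longrightarrow>
            (\<exists>\<omega>\<in>sphere 0 1. \<exists>u\<^sub>0::real \<Rightarrow> real. \<forall>x. u x = u\<^sub>0 (\<omega> \<bullet> x))) \<and>
         (3 \<le> k \<and> k \<le> CARD('n) \<longrightarrow>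
            (\<exists>(C :: nat \<Rightarrow> 'n \<Rightarrow> real) (u\<^sub>0 :: (nat \<Rightarrow> real) \<Rightarrow> real).
               \<forall>x. u x = u\<^sub>0 (matrix_app (k - 1) C x)))"
proof -
  interpret gauss_solution f u by unfold_locales (fact assms)+
  have dim: "dim grad_span \<le> max 1 (k - 1)" by (rule dim_grad_span_le[OF assms(6)])
  obtain B where B: "finite B" "card B = dim grad_span" "\<And>b. b \<in> B \<Longrightarrow> norm b = 1"
    "\<And>x. u x = u (\<Sum>b\<in>B. (b \<bullet> x) *\<^sub>R b)"
    using u_factors by blast
  show ?thesis
  proof (intro conjI impI)
    assume "k \<le> 2"
    then have "card B \<le> 1" using dim B(2) by simp
    show "\<exists>\<omega>\<in>sphere 0 1. \<exists>u\<^sub>0::real \<Rightarrow> real. \<forall>x. u x = u\<^sub>0 (\<omega> \<bullet> x)"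
    proof (cases "B = {}")
      case True
      \<comment> \<open>An empty basis means that \<open>u\<close> is constant, and any unit vector
        serves as the direction.\<close>
      obtain \<omega> :: "real^'n" where "norm \<omega> = 1" using vector_choose_size[of 1] by auto
      then show ?thesis
        using B(4) True by (intro bexI[of _ \<omega>] exI[of _ "\<lambda>_. u 0"]) auto
    next
      case False
      then have "card B = 1" using \<open>card B \<le> 1\<close> B(1) by (simp add: le_Suc_eq)
      then obtain b where b: "B = {b}" by (auto simp: card_1_singleton_iff)
      then have "u x = u ((b \<bullet> x) *\<^sub>R b)" for x using B(4)[of x] by simp
      then show ?thesis
        using B(3)[of b] b by (intro bexI[of _ b] exI[of _ "\<lambda>t. u (t *\<^sub>R b)"]) auto
    qed
  next
    assume "3 \<le> k \<and> k \<le> CARD('n)"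
    then have le: "card B \<le> k - 1" using dim B(2) by linarith
    obtain h where h: "bij_betw h {0..<card B} B" using ex_bij_betw_nat_finite[OF B(1)] by blast
    \<comment> \<open>The basis vectors form the first \<open>card B\<close> rows. Since the span
      may have dimension less than \<open>k - 1\<close>, the remaining rows are filled with zeros,
      and \<open>u0\<close> ignores the corresponding entries.\<close>
    define C where "C i j = (if i < card B then h i $ j else 0)" for i and j :: 'n
    define u0 where "u0 y = u (\<Sum>i = 0..<card B. y i *\<^sub>R h i)" for y
    have "u x = u0 (matrix_app (k - 1) C x)" for x
    proof -
      have "matrix_app (k - 1) C x i = h i \<bullet> x" if "i < card B" for i
        using that le by (simp add: matrix_app_def C_def inner_vec_def)
      then have "u0 (matrix_app (k - 1) C x) = u (\<Sum>i = 0..<card B. (h i \<bullet> x) *\<^sub>R h i)"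
        by (simp add: u0_def)
      also have "(\<Sum>i = 0..<card B. (h i \<bullet> x) *\<^sub>R h i) = (\<Sum>b\<in>B. (b \<bullet> x) *\<^sub>R b)"
        by (rule sum.reindex_bij_betw[OF h])
      finally show ?thesis using B(4)[of x] by simp
    qed
    then show "\<exists>(C :: nat \<Rightarrow> 'n \<Rightarrow> real) (u\<^sub>0 :: (nat \<Rightarrow> real) \<Rightarrow> real).
               \<forall>x. u x = u\<^sub>0 (matrix_app (k - 1) C x)" by blast
  qed
qed

end
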